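(* Let $A_1,\dots,A_M\in\mathbb{R}^{n\times n}$, $\mathcal{M}=\{1,\dots,M\}$ and $A(w)=\sum_{i\in\mathcal{M}}w_iA_i$ for $w\in\mathcal{W}$. (DT) Let $\bar{\mathcal{X}}=\bigcap_{i\in\mathcal{M}}\ker(A_i-I)$ and $m=\dim(\bar{\mathcal{X}})$. The following are equivalent: (a) the difference inclusion $x(k+1)=A(w(k))x(k)$ is strongly convergent; (b) there exists an invertible matrix $T\in\mathbb{R}^{n\times n}$ such that, for all $i\in\mathcal{M}$, $$T^{-1}A_iT=\begin{bmatrix} A_i^{\mathrm{as}} & 0 \\ {A_i^{\mathrm{r}}} & I_m \end{bmatrix},$$ where the matrices $\{A_i^{\mathrm{as}}\}_{i\in\mathcal{M}}$ generate an asymptotically stable difference inclusion. (CT) Let $\bar{\mathcal{X}}=\bigcap_{i\in\mathcal{M}}\ker(A_i)$ and $m=\dim(\bar{\mathcal{X}})$. The following are equivalent: (a) the differential inclusion $\dot x(t)=A(w(t))x(t)$ is strongly convergent; (b) there exists an invertible matrix $T\in\mathbb{R}^{n\times n}$ such that, for all $i\in\mathcal{M}$, $$T^{-1}A_iT=\begin{bmatrix} A_i^{\mathrm{as}} & 0 \\ {A_i^{\mathrm{r}}} & 0_m \end{bmatrix},$$ where the matrices $\{A_i^{\mathrm{as}}\}_{i\in\mathcal{M}}$ generate an asymptotically stable differential inclusion.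
   Context: $\mathcal{W}=\{w\in\mathbb{R}^M:\ \sum_{i\in\mathcal{M}}w_i=1,\ w_i\ge0\ \forall i\in\mathcal{M}\}$. The difference (resp. differential) inclusion is strongly convergent if for every sequence $w(k)\in\mathcal{W}$, $k\in\mathbb{N}$ (resp. every measurable function $w(t)\in\mathcal{W}$, $t\ge0$) and every $x(0)\in\mathbb{R}^n$ the solution converges, as time tends to infinity, to some $\bar x\in\bar{\mathcal{X}}$. Matrices $\{F_i\}_{i\in\mathcal{M}}$ generate the difference inclusion $z(k+1)=\sum_{i}w_i(k)F_i\,z(k)$ (resp. differential inclusion $\dot z(t)=\sum_i w_i(t)F_i\,z(t)$), $w\in\mathcal{W}$; it is asymptotically stable if the origin is (robustly) asymptotically stable, i.e. stable with every solution converging to $0$, for all $w(\cdot)$ with values in $\mathcal{W}$. Blocks may be empty; $I_m$ and $0_m$ are the $m\times m$ identity and zero matrices. *)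

theory Defs
  imports "HOL-Analysis.Analysis" "Jordan_Normal_Form.Matrix_Kernel"
begin

text \<open>Matrices and vectors are those of \<open>Jordan_Normal_Form\<close>, whose dimensions are terms, because
  the diagonal blocks have sizes \<open>n - m\<close> and \<open>m\<close> with \<open>m\<close> computed from the data. All indices start
  at 0, so the index set of the vertices is \<open>{..<M}\<close>.\<close>

definition simplex_weights :: "nat \<Rightarrow> real Matrix.vec set" where
  "simplex_weights M = {w \<in> carrier_vec M.
     (\<Sum>i<M. vec_index w i) = 1 \<and> (\<forall>i<M. 0 \<le> vec_index w i)}"

definition comb_mat :: "nat \<Rightarrow> nat \<Rightarrow> (nat \<Rightarrow> real mat) \<Rightarrow> real Matrix.vec \<Rightarrow> real mat" where
  "comb_mat d M A w = Matrix.mat d d (\<lambda>(r, c). \<Sum>i<M. vec_index w i * (A i $$ (r, c)))"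

definition eucl_norm :: "real Matrix.vec \<Rightarrow> real" where
  "eucl_norm v = sqrt (scalar_prod v v)"

definition common_kernel :: "nat \<Rightarrow> nat \<Rightarrow> (nat \<Rightarrow> real mat) \<Rightarrow> real Matrix.vec set" where
  "common_kernel n M A = carrier_vec n \<inter> (\<Inter>i\<in>{..<M}. mat_kernel (A i))"

definition subspace_dim :: "nat \<Rightarrow> real Matrix.vec set \<Rightarrow> nat" where
  "subspace_dim n X = vectorspace.dim class_ring (module_vec TYPE(real) n\<lparr>carrier := X\<rparr>)"


definition dt_weights :: "nat \<Rightarrow> (nat \<Rightarrow> real Matrix.vec) \<Rightarrow> bool" where
  "dt_weights M w \<longleftrightarrow> (\<forall>k. w k \<in> simplex_weights M)"

definition dt_solution ::
  "nat \<Rightarrow> nat \<Rightarrow> (nat \<Rightarrow> real mat) \<Rightarrow> (nat \<Rightarrow> real Matrix.vec) \<Rightarrow> (nat \<Rightarrow> real Matrix.vec) \<Rightarrow> bool" where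
  "dt_solution d M A w x \<longleftrightarrow>
     x 0 \<in> carrier_vec d \<and> (\<forall>k. x (Suc k) = comb_mat d M A (w k) *\<^sub>v x k)"

definition dt_strongly_convergent ::
  "nat \<Rightarrow> nat \<Rightarrow> (nat \<Rightarrow> real mat) \<Rightarrow> real Matrix.vec set \<Rightarrow> bool" where
  "dt_strongly_convergent d M A X \<longleftrightarrow>
     (\<forall>w x. dt_weights M w \<and> dt_solution d M A w x \<longrightarrow>
        (\<exists>xb\<in>X. (\<lambda>k. eucl_norm (x k - xb)) \<longlonglongrightarrow> 0))"

text \<open>Robust stability of the origin: \<open>\<delta>\<close> does not depend on the weight signal.\<close>

definition dt_asymp_stable :: "nat \<Rightarrow> nat \<Rightarrow> (nat \<Rightarrow> real mat) \<Rightarrow> bool" where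
  "dt_asymp_stable d M A \<longleftrightarrow>
     (\<forall>\<epsilon>>0. \<exists>\<delta>>0. \<forall>w z. dt_weights M w \<and> dt_solution d M A w z \<and> eucl_norm (z 0) < \<delta> \<longrightarrow>
        (\<forall>k. eucl_norm (z k) < \<epsilon>)) \<and>
     (\<forall>w z. dt_weights M w \<and> dt_solution d M A w z \<longrightarrow> (\<lambda>k. eucl_norm (z k)) \<longlonglongrightarrow> 0)"


definition ct_weights :: "nat \<Rightarrow> (real \<Rightarrow> real Matrix.vec) \<Rightarrow> bool" where
  "ct_weights M w \<longleftrightarrow>
     (\<forall>t\<ge>0. w t \<in> simplex_weights M) \<and>
     (\<forall>i<M. (\<lambda>t. vec_index (w t) i) \<in> borel_measurable (lebesgue_on {0..}))"

text \<open>Since the weights are only measurable, solutions are meant in the sense of Caratheodory: locally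
  absolutely continuous functions satisfying the equation almost everywhere, i.e. functions
  satisfying the integral equation below.\<close>

definition ct_solution ::
  "nat \<Rightarrow> nat \<Rightarrow> (nat \<Rightarrow> real mat) \<Rightarrow> (real \<Rightarrow> real Matrix.vec) \<Rightarrow> (real \<Rightarrow> real Matrix.vec) \<Rightarrow> bool" where
  "ct_solution d M A w x \<longleftrightarrow>
     (\<forall>t\<ge>0. x t \<in> carrier_vec d) \<and>
     (\<forall>t\<ge>0. \<forall>j<d.
        set_integrable lebesgue {0..t} (\<lambda>s. vec_index (comb_mat d M A (w s) *\<^sub>v x s) j) \<and>
        vec_index (x t) j = vec_index (x 0) j +
          set_lebesgue_integral lebesgue {0..t} (\<lambda>s. vec_index (comb_mat d M A (w s) *\<^sub>v x s) j))"

definition ct_strongly_convergent ::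
  "nat \<Rightarrow> nat \<Rightarrow> (nat \<Rightarrow> real mat) \<Rightarrow> real Matrix.vec set \<Rightarrow> bool" where
  "ct_strongly_convergent d M A X \<longleftrightarrow>
     (\<forall>w x. ct_weights M w \<and> ct_solution d M A w x \<longrightarrow>
        (\<exists>xb\<in>X. ((\<lambda>t. eucl_norm (x t - xb)) \<longlongrightarrow> 0) at_top))"

definition ct_asymp_stable :: "nat \<Rightarrow> nat \<Rightarrow> (nat \<Rightarrow> real mat) \<Rightarrow> bool" where
  "ct_asymp_stable d M A \<longleftrightarrow>
     (\<forall>\<epsilon>>0. \<exists>\<delta>>0. \<forall>w z. ct_weights M w \<and> ct_solution d M A w z \<and> eucl_norm (z 0) < \<delta> \<longrightarrow>
        (\<forall>t\<ge>0. eucl_norm (z t) < \<epsilon>)) \<and>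
     (\<forall>w z. ct_weights M w \<and> ct_solution d M A w z \<longrightarrow> ((\<lambda>t. eucl_norm (z t)) \<longlongrightarrow> 0) at_top)"

end

theory Submission
  imports Defs "Jordan_Normal_Form.DL_Rank"
begin

text \<open>
  Let \<open>X\<close> be the subspace on which each \<open>A i\<close> acts as the scalar \<open>\<delta>\<close>, which is 1 in discrete and 0 in
  continuous time, and let the last columns of \<open>T\<close> be a basis of \<open>X\<close>. Then the matrices
  \<open>T\<^sup>-\<^sup>1 * A i * T\<close> have the required block form (\<open>block_form_exists\<close>). In these coordinates a solution is a
  pair \<open>(z, y)\<close>: the transversal component \<open>z\<close> obeys the inclusion of the blocks \<open>As i\<close>, and the
  increments or the derivative of \<open>y\<close> are convex combinations of the vectors \<open>Ar i *\<^sub>v z\<close>.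

  If all solutions converge to elements of \<open>X\<close>, then all solutions \<open>z\<close> tend to zero, because each of them
  can be completed to a solution of the whole system; what remains to be shown is that the origin is
  stable uniformly in the weights. Conversely, if the \<open>As\<close>-inclusion is
  asymptotically stable, then \<open>z\<close> tends to zero, but for the convergence of \<open>y\<close> one needs that \<open>z\<close> is
  summable (integrable). Both gaps are closed by uniform exponential stability, and this follows
  from attractivity alone.

  That step is the heart of the proof, and it is a statement on a bounded set \<open>R\<close> of matrices
  (\<open>uniformly_exponentially_stable\<close>): if every infinite product of matrices in \<open>R\<close>, applied to any
  vector, tends to zero, then all finite products decay at a common geometric rate. It is proved
  in two rounds, each of which assembles one bad trajectory out of finite pieces. In the first, the
  vectors whose orbits are bounded form a subspace; from a vector outside it, one reaches arbitrarily
  large vectors that are still outside, and repeating this gives an unbounded trajectory. So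
  the products are uniformly bounded. In the second, the worst-case limit superior of the norm can be
  preserved step by step, up to arbitrarily small losses, by total boundedness of bounded sets in
  finite dimension; were it positive, one would obtain a trajectory that does not tend to zero.

  In discrete time \<open>R\<close> is the set of convex combinations of the matrices. In continuous time it is the set of
  all transition matrices over unit time, for all measurable weights. The total boundedness used
  above is a property of every bounded set in finite dimension, and so takes the place of weak compactness
  of the set of weight signals. The passage from differential equations to products of matrices uses existence, uniqueness and a growth estimate for
  Caratheodory solutions of linear equations with bounded measurable coefficients, together with
  the splicing of weight signals at integer times.\<close>

(* The dollar sign then denotes the entries of vectors whose dimension is a term. *)
unbundle no vec_syntax

section \<open>Bases adapted to a subspace\<close>

text \<open>Membership of linear combinations is stated term by term because in a basis adapted to a
  subspace only some of the basis vectors lie in it, and the others then have coefficient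
  zero.\<close>

lemma (in vec_space) lincomb_list_mem:
  assumes "set ws \<subseteq> carrier_vec n"
    and "0\<^sub>v n \<in> Y" and "\<And>x y. x \<in> Y \<Longrightarrow> y \<in> Y \<Longrightarrow> x + y \<in> Y"
    and "\<And>i. i < length ws \<Longrightarrow> c i \<cdot>\<^sub>v ws ! i \<in> Y"
  shows "lincomb_list c ws \<in> Y"
  using assms(1,4)
proof (induction ws arbitrary: c)
  case Nil
  then show ?case using assms(2) by simp
next
  case (Cons w ws)
  have "c 0 \<cdot>\<^sub>v w \<in> Y" using Cons.prems(2)[of 0] by simp
  moreover have "lincomb_list (c \<circ> Suc) ws \<in> Y"
    using Cons.IH[of "c \<circ> Suc"] Cons.prems(1) Cons.prems(2)[of "Suc i" for i] by (auto simp: o_def)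
  ultimately show ?case using assms(3) by (simp add: o_def)
qed

text \<open>A basis of \<open>X\<close>, found as a maximal independent subset, is extended to a
  basis of the whole space; the columns of \<open>T\<close> are the new vectors followed by those of
  \<open>X\<close>, so that \<open>S = T\<^sup>-\<^sup>1\<close> reads off coordinates and
  \<open>X\<close> is where the leading ones vanish.\<close>

lemma subspace_adapted_basis:
  assumes X: "X \<subseteq> carrier_vec n" and X0: "0\<^sub>v n \<in> X"
    and Xadd: "\<And>x y. x \<in> X \<Longrightarrow> y \<in> X \<Longrightarrow> x + y \<in> X"
    and Xsmult: "\<And>c x. x \<in> X \<Longrightarrow> c \<cdot>\<^sub>v x \<in> X"
  obtains T S :: "real mat" where "T \<in> carrier_mat n n" "S \<in> carrier_mat n n"
    "T * S = 1\<^sub>m n" "S * T = 1\<^sub>m n" "subspace_dim n X \<le> n"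
    "\<And>x. x \<in> carrier_vec n \<Longrightarrow>
       x \<in> X \<longleftrightarrow> (\<forall>i < n - subspace_dim n X. vec_index (S *\<^sub>v x) i = 0)"
proof -
  interpret V: vec_space "TYPE(real)" n .
  have subm: "submodule class_ring X (module_vec TYPE(real) n)"
    unfolding submodule_def using X X0 Xadd Xsmult V.module_axioms by (simp add: class_ring_simps)
  have subs: "subspace class_ring X (module_vec TYPE(real) n)"
    using subm V.vectorspace_axioms by (simp add: subspace_def)
  interpret W: vectorspace class_ring "module_vec TYPE(real) n\<lparr>carrier := X\<rparr>"
    using V.subspace_is_vs[OF subs] .
  have bnd: "finite B \<and> card B \<le> n" if "B \<subseteq> carrier_vec n" "V.lin_indpt B" for B
    using V.li_le_dim[OF V.fin_dim _ that(2)] that(1) V.dim_is_n by auto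
  have ind0: "V.lin_indpt {}" by (auto simp: V.lin_dep_def)
  obtain B where B: "finite B" and Bmax: "maximal B (\<lambda>B. B \<subseteq> X \<and> V.lin_indpt B)"
    using maximal_exists[of "\<lambda>B. B \<subseteq> X \<and> V.lin_indpt B" n "{}"] bnd[OF subset_trans[OF _ X]] ind0
    by auto
  have BX: "B \<subseteq> X" and Bli: "V.lin_indpt B" using Bmax by (auto simp: maximal_def)
  have carX: "carrier (module_vec TYPE(real) n\<lparr>carrier := X\<rparr>) = X" by simp
  have Wbasis: "W.basis B"
  proof (rule W.max_li_is_basis)
    show "maximal B (\<lambda>S. S \<subseteq> carrier (module_vec TYPE(real) n\<lparr>carrier := X\<rparr>) \<and> W.lin_indpt S)"
      unfolding maximal_def carX
    proof (intro conjI allI impI)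
      show "B \<subseteq> X" "W.lin_indpt B" using BX Bli V.span_li_not_depend(2)[OF _ subm] by simp_all
      fix C assume "B \<subseteq> C \<and> C \<subseteq> X \<and> W.lin_indpt C"
      then show "C = B" using Bmax V.span_li_not_depend(2)[OF _ subm, of C] by (simp add: maximal_def)
    qed
  qed
  have m: "subspace_dim n X = card B"
    unfolding subspace_dim_def using W.dim_basis[OF B Wbasis] .
  have spB: "V.span B = X"
    using Wbasis V.span_li_not_depend(1)[OF BX subm] unfolding W.basis_def by simp
  obtain D where D: "finite D" and
     Dmax: "maximal D (\<lambda>D. B \<subseteq> D \<and> D \<subseteq> carrier_vec n \<and> V.lin_indpt D)"
    using maximal_exists[of "\<lambda>D. B \<subseteq> D \<and> D \<subseteq> carrier_vec n \<and> V.lin_indpt D" n B]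
      bnd subset_trans[OF BX X] Bli by auto
  have BD: "B \<subseteq> D" and DV: "D \<subseteq> carrier_vec n" and Dli: "V.lin_indpt D"
    using Dmax by (auto simp: maximal_def)
  have Dbasis: "V.basis D"
  proof (rule V.max_li_is_basis)
    show "maximal D (\<lambda>S. S \<subseteq> carrier_vec n \<and> V.lin_indpt S)"
      unfolding maximal_def
    proof (intro conjI allI impI)
      fix C assume "D \<subseteq> C \<and> C \<subseteq> carrier_vec n \<and> V.lin_indpt C"
      then show "C = D" using Dmax subset_trans[OF BD, of C] by (simp add: maximal_def)
    qed (use DV Dli in auto)
  qed
  have cD: "card D = n" using V.dim_basis[OF D Dbasis] V.dim_is_n by simp
  obtain bl where bl: "set bl = B" "distinct bl" using finite_distinct_list[OF B] by blast
  obtain cl where cl: "set cl = D - B" "distinct cl" using finite_distinct_list[of "D - B"] D by blast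
  define ws where "ws = cl @ bl"
  have ws: "set ws = D" "distinct ws" using bl cl BD by (auto simp: ws_def)
  have lws: "length ws = n" using ws cD distinct_card by metis
  have lbl: "length bl = card B" using bl distinct_card by metis
  have mn: "card B \<le> n" using BD D cD card_mono by metis
  have lcl: "length cl = n - card B" using lws lbl by (simp add: ws_def)
  define T where "T = mat_of_cols n ws"
  have T: "T \<in> carrier_mat n n" using mat_of_cols_carrier(1)[of n ws] lws by (simp add: T_def del: mat_of_cols_carrier)
  have colsT: "cols T = ws" unfolding T_def using ws DV by simp
  have "V.rank T = n" by (rule V.lin_indpt_full_rank[OF T]) (auto simp: colsT ws Dli)
  then have "det T \<noteq> 0" using V.det_rank_iff[OF T] by simp
  from det_non_zero_imp_unit[OF T this, unfolded Units_def, of "()"]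
  obtain S where S: "S \<in> carrier_mat n n" and ST: "S * T = 1\<^sub>m n" and TS: "T * S = 1\<^sub>m n"
    by (auto simp: ring_mat_def)
  define Y where "Y = {x \<in> carrier_vec n. \<forall>i < n - card B. vec_index (S *\<^sub>v x) i = 0}"
  have Scol: "S *\<^sub>v (ws ! j) = unit_vec n j" if "j < n" for j
  proof -
    have "ws ! j = col T j" using colsT that T by (metis cols_nth carrier_matD(2))
    then have "S *\<^sub>v (ws ! j) = col (S * T) j" using S T that by (simp add: col_mult2[OF S T that])
    then show ?thesis using that by (simp add: ST)
  qed
  have wsn: "ws ! j \<in> carrier_vec n" if "j < n" for j using that ws DV lws nth_mem by blast
  have XY: "X \<subseteq> Y"
  proof
    fix x assume "x \<in> X"
    then have "x \<in> V.span_list bl" using spB V.span_list_as_span[of bl] bl BX X by auto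
    then obtain c where c: "x = V.lincomb_list c bl" by (auto simp: V.span_list_def)
    show "x \<in> Y" unfolding c
    proof (rule V.lincomb_list_mem)
      show "set bl \<subseteq> carrier_vec n" using bl BX X by auto
      show "0\<^sub>v n \<in> Y" using S by (auto simp: Y_def)
      show "x + y \<in> Y" if "x \<in> Y" "y \<in> Y" for x y
        using that S mult_add_distrib_mat_vec[OF S, of x y]
        by (auto simp: Y_def simp del: index_mult_mat_vec)
      show "c i \<cdot>\<^sub>v bl ! i \<in> Y" if i: "i < length bl" for i
      proof -
        define j where "j = length cl + i"
        have eq: "bl ! i = ws ! j" by (simp add: ws_def j_def)
        have lt: "j < n" "n - card B \<le> j" using i lws lcl by (simp_all add: ws_def j_def)
        have "S *\<^sub>v (c i \<cdot>\<^sub>v ws ! j) = c i \<cdot>\<^sub>v unit_vec n j"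
          using mult_mat_vec[OF S wsn[OF lt(1)]] Scol[OF lt(1)] by simp
        then show ?thesis using wsn[OF lt(1)] lt
          by (simp add: eq Y_def del: index_mult_mat_vec)
      qed
    qed
  qed
  have YX: "Y \<subseteq> X"
  proof
    fix x assume x: "x \<in> Y"
    then have xn: "x \<in> carrier_vec n" by (simp add: Y_def)
    define y where "y = S *\<^sub>v x"
    have "x = (T * S) *\<^sub>v x" using xn by (simp add: TS)
    also have "\<dots> = T *\<^sub>v y" unfolding y_def by (rule assoc_mult_mat_vec[OF T S xn])
    also have "y = Matrix.vec (length ws) (vec_index y)" using S xn lws by (auto simp: y_def)
    also have "T *\<^sub>v \<dots> = V.lincomb_list (vec_index y) ws"
      unfolding T_def using V.lincomb_list_as_mat_mult[of ws] ws DV by force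
    finally have "x = V.lincomb_list (vec_index y) ws" .
    also have "\<dots> \<in> X"
    proof (rule V.lincomb_list_mem)
      show "set ws \<subseteq> carrier_vec n" using ws DV by simp
      show "vec_index y i \<cdot>\<^sub>v ws ! i \<in> X" if i: "i < length ws" for i
      proof (cases "i < length cl")
        case True
        then have "vec_index y i = 0" using x lcl by (simp add: y_def Y_def)
        then show ?thesis using X0 wsn[of i] i lws by auto
      next
        case False
        then have "ws ! i \<in> B" using i bl by (auto simp: ws_def nth_append)
        then show ?thesis using BX Xsmult by blast
      qed
    qed (use X0 Xadd in auto)
    finally show "x \<in> X" .
  qed
  show thesis
  proof (rule that[OF T S TS ST])
    show "subspace_dim n X \<le> n" using m mn by simp
    show "x \<in> X \<longleftrightarrow> (\<forall>i < n - subspace_dim n X. vec_index (S *\<^sub>v x) i = 0)" if "x \<in> carrier_vec n" for x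
      using XY YX that unfolding m by (auto simp: Y_def)
  qed
qed

section \<open>Products of matrices from a bounded family\<close>

text \<open>The \<open>\<ell>\<^sub>1\<close> norm. Its triangle inequality and the bound by the
  norms of the images of the unit vectors are elementary; in a fixed dimension it is equivalent to
  the Euclidean norm.\<close>

definition nrm :: "real Matrix.vec \<Rightarrow> real" where
  "nrm v = (\<Sum>i<dim_vec v. \<bar>v $ i\<bar>)"

lemma nrm_nonneg: "0 \<le> nrm v"
  by (simp add: nrm_def sum_nonneg)

lemma nrm_zero [simp]: "nrm (0\<^sub>v n) = 0"
  by (simp add: nrm_def)

lemma nrm_add: "x \<in> carrier_vec d \<Longrightarrow> y \<in> carrier_vec d \<Longrightarrow> nrm (x + y) \<le> nrm x + nrm y"
  using sum_mono[of "{..<d}" "\<lambda>i. \<bar>x $ i + y $ i\<bar>" "\<lambda>i. \<bar>x $ i\<bar> + \<bar>y $ i\<bar>"]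
  by (simp add: nrm_def sum.distrib abs_triangle_ineq)

lemma nrm_smult: "nrm (c \<cdot>\<^sub>v x) = \<bar>c\<bar> * nrm x"
  by (simp add: nrm_def abs_mult sum_distrib_left)

lemma abs_index_le_nrm: "i < dim_vec v \<Longrightarrow> \<bar>v $ i\<bar> \<le> nrm v"
  unfolding nrm_def by (rule member_le_sum) auto

lemma nrm_mult_mat_vec_le:
  assumes A: "A \<in> carrier_mat d e" and x: "x \<in> carrier_vec e"
    and b: "\<And>i j. i < d \<Longrightarrow> j < e \<Longrightarrow> \<bar>A $$ (i,j)\<bar> \<le> b"
  shows "nrm (A *\<^sub>v x) \<le> real d * b * nrm x"
proof -
  have "\<bar>(A *\<^sub>v x) $ i\<bar> \<le> b * nrm x" if i: "i < d" for i
  proof -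
    have "\<bar>(A *\<^sub>v x) $ i\<bar> = \<bar>\<Sum>j<e. A $$ (i,j) * x $ j\<bar>"
      using A x i by (simp add: scalar_prod_def atLeast0LessThan)
    also have "\<dots> \<le> (\<Sum>j<e. \<bar>A $$ (i,j)\<bar> * \<bar>x $ j\<bar>)"
      by (rule order_trans[OF sum_abs]) (simp add: abs_mult)
    also have "\<dots> \<le> (\<Sum>j<e. b * \<bar>x $ j\<bar>)"
      using b i by (intro sum_mono mult_right_mono) auto
    finally show ?thesis using x by (simp add: nrm_def sum_distrib_left)
  qed
  then have "nrm (A *\<^sub>v x) \<le> (\<Sum>i<d. b * nrm x)"
    using A unfolding nrm_def[of "A *\<^sub>v x"] by (auto simp del: index_mult_mat_vec sum_constant intro!: sum_mono)
  then show ?thesis by simp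
qed

text \<open>Finite dimension enters the uniform estimates through this inequality: a subadditive,
  homogeneous function is controlled by its values on the unit vectors, so that boundedness or
  smallness at finitely many points is uniform on bounded sets.\<close>

lemma seminorm_le_sum_units:
  assumes x: "x \<in> carrier_vec d"
    and p0: "p (0\<^sub>v d) \<le> (0::real)"
    and padd: "\<And>x y. x \<in> carrier_vec d \<Longrightarrow> y \<in> carrier_vec d \<Longrightarrow> p (x + y) \<le> p x + p y"
    and psm: "\<And>c x. x \<in> carrier_vec d \<Longrightarrow> p (c \<cdot>\<^sub>v x) \<le> \<bar>c\<bar> * p x"
  shows "p x \<le> (\<Sum>i<d. \<bar>x $ i\<bar> * p (unit_vec d i))"
proof -
  define v where "v k = Matrix.vec d (\<lambda>i. if i < k then x $ i else 0)" for k
  have vc: "v k \<in> carrier_vec d" for k by (simp add: v_def)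
  have "p (v k) \<le> (\<Sum>i<k. \<bar>x $ i\<bar> * p (unit_vec d i))" if "k \<le> d" for k
    using that
  proof (induction k)
    case 0
    have "v 0 = 0\<^sub>v d" by (auto simp: v_def)
    then show ?case using p0 by simp
  next
    case (Suc k)
    have "v (Suc k) = v k + x $ k \<cdot>\<^sub>v unit_vec d k"
      using Suc.prems by (auto simp: v_def unit_vec_def less_Suc_eq)
    then have "p (v (Suc k)) \<le> p (v k) + p (x $ k \<cdot>\<^sub>v unit_vec d k)"
      using padd[OF vc, of "x $ k \<cdot>\<^sub>v unit_vec d k" k] by simp
    also have "\<dots> \<le> p (v k) + \<bar>x $ k\<bar> * p (unit_vec d k)" using psm by simp
    finally show ?case using Suc by simp
  qed
  from this[of d] have "p (v d) \<le> (\<Sum>i<d. \<bar>x $ i\<bar> * p (unit_vec d i))" by simp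
  moreover have "v d = x" using x by (auto simp: v_def)
  ultimately show ?thesis by simp
qed

text \<open>In a basis adapted to \<open>X\<close> the projection keeps the coordinates that belong
  to \<open>X\<close> and erases the others. It transports estimates on the unit vectors to the
  subspace \<open>X\<close>.\<close>

lemma subspace_projection:
  assumes X: "X \<subseteq> carrier_vec n" and X0: "0\<^sub>v n \<in> X"
    and Xadd: "\<And>x y. x \<in> X \<Longrightarrow> y \<in> X \<Longrightarrow> x + y \<in> X"
    and Xsmult: "\<And>c x. x \<in> X \<Longrightarrow> c \<cdot>\<^sub>v x \<in> X"
  obtains P :: "real mat" where "P \<in> carrier_mat n n"
    "\<And>x. x \<in> carrier_vec n \<Longrightarrow> P *\<^sub>v x \<in> X" "\<And>x. x \<in> X \<Longrightarrow> P *\<^sub>v x = x"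
proof -
  obtain T S :: "real mat" where T: "T \<in> carrier_mat n n" and S: "S \<in> carrier_mat n n"
    and TS: "T * S = 1\<^sub>m n" and ST: "S * T = 1\<^sub>m n" and "subspace_dim n X \<le> n"
    and iff: "\<And>x. x \<in> carrier_vec n \<Longrightarrow>
       x \<in> X \<longleftrightarrow> (\<forall>i < n - subspace_dim n X. (S *\<^sub>v x) $ i = 0)"
    by (rule subspace_adapted_basis[OF assms]) (assumption | rule that)+
  define m where "m = n - subspace_dim n X"
  \<comment> \<open>the projection in the adapted coordinates\<close>
  define D where "D = Matrix.mat n n (\<lambda>(i,j). if i = j \<and> m \<le> i then 1 else (0::real))"
  have D: "D \<in> carrier_mat n n" by (simp add: D_def)
  have Dv: "D *\<^sub>v v = Matrix.vec n (\<lambda>i. if m \<le> i then v $ i else 0)" if v: "v \<in> carrier_vec n" for v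
  proof (rule eq_vecI)
    fix i assume "i < dim_vec (Matrix.vec n (\<lambda>i. if m \<le> i then v $ i else 0))"
    then have i: "i < n" by simp
    have "(D *\<^sub>v v) $ i = (\<Sum>j<n. (if i = j \<and> m \<le> i then 1 else 0) * v $ j)"
      using v i by (simp add: D_def scalar_prod_def atLeast0LessThan)
    also have "\<dots> = (\<Sum>j<n. if j = i then (if m \<le> i then v $ i else 0) else 0)"
      by (rule sum.cong) auto
    finally show "(D *\<^sub>v v) $ i = Matrix.vec n (\<lambda>i. if m \<le> i then v $ i else 0) $ i"
      using i by simp
  qed (simp add: D_def)
  show thesis
  proof (rule that[of "T * D * S"])
    show "T * D * S \<in> carrier_mat n n" using T S D by simp
    have eq: "T * D * S *\<^sub>v x = T *\<^sub>v (D *\<^sub>v (S *\<^sub>v x))" if x: "x \<in> carrier_vec n" for x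
    proof -
      have "T * D * S *\<^sub>v x = T * D *\<^sub>v (S *\<^sub>v x)"
        by (rule assoc_mult_mat_vec[OF mult_carrier_mat[OF T D] S x])
      also have "\<dots> = T *\<^sub>v (D *\<^sub>v (S *\<^sub>v x))"
        by (rule assoc_mult_mat_vec[OF T D]) (use S x in simp)
      finally show ?thesis .
    qed
    show "T * D * S *\<^sub>v x \<in> X" if x: "x \<in> carrier_vec n" for x
    proof -
      define u where "u = D *\<^sub>v (S *\<^sub>v x)"
      have u: "u \<in> carrier_vec n" using D S x by (simp add: u_def)
      have "S *\<^sub>v (T *\<^sub>v u) = (S * T) *\<^sub>v u" using assoc_mult_mat_vec[OF S T u] by simp
      also have "\<dots> = u" using u by (simp add: ST)
      finally have "S *\<^sub>v (T *\<^sub>v u) = u" .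
      then show ?thesis unfolding eq[OF x] u_def[symmetric]
        using iff[of "T *\<^sub>v u"] T u Dv[of "S *\<^sub>v x"] S x by (simp add: u_def m_def)
    qed
    show "T * D * S *\<^sub>v x = x" if x: "x \<in> X" for x
    proof -
      have xc: "x \<in> carrier_vec n" using X x by auto
      have "D *\<^sub>v (S *\<^sub>v x) = S *\<^sub>v x"
        unfolding Dv[OF mult_mat_vec_carrier[OF S xc]]
        using iff[OF xc] x S xc by (intro eq_vecI) (auto simp: not_le simp flip: m_def)
      then have "T * D * S *\<^sub>v x = T *\<^sub>v (S *\<^sub>v x)" using eq[OF xc] by simp
      also have "\<dots> = (T * S) *\<^sub>v x" using assoc_mult_mat_vec[OF T S xc] by simp
      finally show ?thesis using xc by (simp add: TS)
    qed
  qed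
qed

text \<open>The list is read in order of time: its head is the matrix applied first.\<close>

definition run :: "real mat list \<Rightarrow> real Matrix.vec \<Rightarrow> real Matrix.vec" where
  "run l v = fold (\<lambda>A v. A *\<^sub>v v) l v"

lemma run_Nil [simp]: "run [] v = v"
  and run_Cons [simp]: "run (A # l) v = run l (A *\<^sub>v v)"
  and run_append [simp]: "run (l @ l') v = run l' (run l v)"
  by (simp_all add: run_def)

locale bounded_family =
  fixes d :: nat and R :: "real mat set" and L :: real
  assumes family_carrier: "A \<in> R \<Longrightarrow> A \<in> carrier_mat d d"
    and family_bound: "A \<in> R \<Longrightarrow> x \<in> carrier_vec d \<Longrightarrow> nrm (A *\<^sub>v x) \<le> L * nrm x"
    and L_nonneg: "0 \<le> L"
begin

lemma run_carrier: "l \<in> lists R \<Longrightarrow> x \<in> carrier_vec d \<Longrightarrow> run l x \<in> carrier_vec d"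
proof (induction l arbitrary: x)
  case (Cons A l)
  then show ?case using mult_mat_vec_carrier[OF family_carrier] by auto
qed simp

lemma run_add:
  "l \<in> lists R \<Longrightarrow> x \<in> carrier_vec d \<Longrightarrow> y \<in> carrier_vec d \<Longrightarrow> run l (x + y) = run l x + run l y"
proof (induction l arbitrary: x y)
  case (Cons A l)
  then have "A \<in> R" by auto
  note A = family_carrier[OF this]
  show ?case using Cons mult_add_distrib_mat_vec[OF A] mult_mat_vec_carrier[OF A] by simp
qed simp

lemma run_smult:
  "l \<in> lists R \<Longrightarrow> x \<in> carrier_vec d \<Longrightarrow> run l (c \<cdot>\<^sub>v x) = c \<cdot>\<^sub>v run l x"
proof (induction l arbitrary: x)
  case (Cons A l)
  then have "A \<in> R" by auto
  note A = family_carrier[OF this]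
  show ?case using Cons mult_mat_vec[OF A] mult_mat_vec_carrier[OF A] by simp
qed simp

lemma run_zero: "l \<in> lists R \<Longrightarrow> run l (0\<^sub>v d) = 0\<^sub>v d"
proof (induction l)
  case (Cons A l)
  moreover have "A *\<^sub>v 0\<^sub>v d = 0\<^sub>v d" using family_carrier[of A] Cons.prems by (intro eq_vecI) auto
  ultimately show ?case by simp
qed simp

text \<open>The matrix \<open>P\<close> will be the identity, or the projection onto a subspace on
  which alone the products are under control.\<close>

lemma nrm_run_le_sum_units:
  assumes "l \<in> lists R" "P \<in> carrier_mat d d" "x \<in> carrier_vec d"
  shows "nrm (run l (P *\<^sub>v x)) \<le> (\<Sum>i<d. \<bar>x $ i\<bar> * nrm (run l (P *\<^sub>v unit_vec d i)))"
proof (rule seminorm_le_sum_units[OF assms(3)])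
  have "P *\<^sub>v 0\<^sub>v d = 0\<^sub>v d" using assms by auto
  then show "nrm (run l (P *\<^sub>v 0\<^sub>v d)) \<le> 0"
    using run_zero[OF assms(1)] by simp
  show "nrm (run l (P *\<^sub>v (x + y))) \<le> nrm (run l (P *\<^sub>v x)) + nrm (run l (P *\<^sub>v y))"
    if "x \<in> carrier_vec d" "y \<in> carrier_vec d" for x y
    using that assms run_add[OF assms(1), of "P *\<^sub>v x" "P *\<^sub>v y"]
    by (auto simp: mult_add_distrib_mat_vec[OF assms(2)] intro!: nrm_add run_carrier)
  show "nrm (run l (P *\<^sub>v (c \<cdot>\<^sub>v x))) \<le> \<bar>c\<bar> * nrm (run l (P *\<^sub>v x))" if "x \<in> carrier_vec d" for c x
    using that assms run_smult[OF assms(1), of "P *\<^sub>v x" c]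
    by (auto simp: mult_mat_vec[OF assms(2)] nrm_smult)
qed

definition bounded_orbit :: "real Matrix.vec \<Rightarrow> bool" where
  "bounded_orbit x \<longleftrightarrow> (\<exists>c. \<forall>l\<in>lists R. nrm (run l x) \<le> c)"

text \<open>The vectors with a bounded orbit form a subspace. With a projection \<open>P\<close>
  onto it, the bounds on the orbits of the finitely many vectors \<open>P e\<^sub>i\<close> give one
  constant for the whole subspace.\<close>

lemma bounded_orbits_uniform:
  obtains K where "0 \<le> K"
    "\<And>x l. x \<in> carrier_vec d \<Longrightarrow> bounded_orbit x \<Longrightarrow> l \<in> lists R \<Longrightarrow> nrm (run l x) \<le> K * nrm x"
proof -
  define E where "E = {x \<in> carrier_vec d. bounded_orbit x}"
  obtain P where P: "P \<in> carrier_mat d d" "\<And>x. x \<in> carrier_vec d \<Longrightarrow> P *\<^sub>v x \<in> E"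
    "\<And>x. x \<in> E \<Longrightarrow> P *\<^sub>v x = x"
  proof (rule subspace_projection[of E d])
    show "E \<subseteq> carrier_vec d" by (auto simp: E_def)
    show "0\<^sub>v d \<in> E" using run_zero by (auto simp: E_def bounded_orbit_def intro!: exI[of _ 0])
    show "x + y \<in> E" if xy: "x \<in> E" "y \<in> E" for x y
    proof -
      obtain c c' where c: "\<forall>l\<in>lists R. nrm (run l x) \<le> c" "\<forall>l\<in>lists R. nrm (run l y) \<le> c'"
        using xy by (auto simp: E_def bounded_orbit_def)
      have "nrm (run l (x + y)) \<le> c + c'" if l: "l \<in> lists R" for l
      proof -
        have "nrm (run l (x + y)) \<le> nrm (run l x) + nrm (run l y)"
          using xy l by (auto simp: E_def run_add intro!: nrm_add run_carrier)
        then show ?thesis using c l by (smt (verit))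
      qed
      then show ?thesis using xy by (auto simp: E_def bounded_orbit_def)
    qed
    show "c \<cdot>\<^sub>v x \<in> E" if x: "x \<in> E" for c x
    proof -
      obtain c' where c: "\<forall>l\<in>lists R. nrm (run l x) \<le> c'"
        using x by (auto simp: E_def bounded_orbit_def)
      have "nrm (run l (c \<cdot>\<^sub>v x)) \<le> \<bar>c\<bar> * c'" if l: "l \<in> lists R" for l
        using x l c by (auto simp: E_def run_smult nrm_smult intro!: mult_left_mono)
      then show ?thesis using x by (auto simp: E_def bounded_orbit_def)
    qed
  qed blast
  have "\<forall>i<d. \<exists>c. \<forall>l\<in>lists R. nrm (run l (P *\<^sub>v unit_vec d i)) \<le> c"
    using P(2)[OF unit_vec_carrier] by (auto simp: E_def bounded_orbit_def)
  then obtain c where c: "\<And>i l. i < d \<Longrightarrow> l \<in> lists R \<Longrightarrow> nrm (run l (P *\<^sub>v unit_vec d i)) \<le> c i"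
    by metis
  have c0: "0 \<le> c i" if "i < d" for i using order_trans[OF nrm_nonneg c[OF that, of "[]"]] by simp
  have c_le: "c i \<le> (\<Sum>i<d. c i)" if "i < d" for i
    using that c0 by (intro member_le_sum) auto
  show thesis
  proof (rule that[of "\<Sum>i<d. c i"])
    show "0 \<le> (\<Sum>i<d. c i)" using c0 by (intro sum_nonneg) auto
    fix x l assume x: "x \<in> carrier_vec d" and b: "bounded_orbit x" and l: "l \<in> lists R"
    have "nrm (run l x) = nrm (run l (P *\<^sub>v x))" using x b P(3)[of x] by (simp add: E_def)
    also have "\<dots> \<le> (\<Sum>i<d. \<bar>x $ i\<bar> * nrm (run l (P *\<^sub>v unit_vec d i)))"
      by (rule nrm_run_le_sum_units[OF l P(1) x])
    also have "\<dots> \<le> (\<Sum>i<d. \<bar>x $ i\<bar> * (\<Sum>i<d. c i))"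
    proof (intro sum_mono mult_left_mono)
      fix i assume "i \<in> {..<d}"
      then show "nrm (run l (P *\<^sub>v unit_vec d i)) \<le> (\<Sum>i<d. c i)"
        using c[OF _ l, of i] c_le[of i] by simp
    qed simp
    finally show "nrm (run l x) \<le> (\<Sum>i<d. c i) * nrm x"
      using x by (simp add: nrm_def sum_distrib_left mult.commute)
  qed
qed

text \<open>If the orbit of \<open>x\<close> could become large only after entering the subspace of
  bounded orbits, then it would be bounded: it enters that subspace by one step from a point of norm
  less than \<open>N\<close>, and from there on it grows at most by the uniform constant. So the
  orbit gets large at points from which it is still unbounded, which allows the growth to be
  repeated for ever.\<close>

lemma unbounded_orbit_escape:
  assumes x: "x \<in> carrier_vec d" and unb: "\<not> bounded_orbit x"
  shows "\<exists>l\<in>lists R. \<not> bounded_orbit (run l x) \<and> N \<le> nrm (run l x)"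
proof (rule ccontr)
  assume neg: "\<not> ?thesis"
  have small: "nrm (run l x) < N" if "l \<in> lists R" "\<not> bounded_orbit (run l x)" for l
    using neg that not_le by blast
  obtain K where K0: "0 \<le> K" and
    K: "\<And>x l. x \<in> carrier_vec d \<Longrightarrow> bounded_orbit x \<Longrightarrow> l \<in> lists R \<Longrightarrow> nrm (run l x) \<le> K * nrm x"
    using bounded_orbits_uniform by blast
  \<comment> \<open>the bound holds at the moment of entering the subspace of bounded orbits, and the induction
    carries it on, since it speaks of all further products\<close>
  have entered: "bounded_orbit (run l x) \<Longrightarrow> l \<in> lists R \<Longrightarrow>
      \<forall>l'\<in>lists R. nrm (run l' (run l x)) \<le> K * (L * N)" for l
  proof (induction l rule: rev_induct)
    case Nil
    then show ?case using unb by simp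
  next
    case (snoc A l)
    then have A: "A \<in> R" and l: "l \<in> lists R" by auto
    show ?case
    proof (cases "bounded_orbit (run l x)")
      case True
      show ?thesis
      proof
        fix l' assume "l' \<in> lists R"
        then have "A # l' \<in> lists R" using A by simp
        then show "nrm (run l' (run (l @ [A]) x)) \<le> K * (L * N)"
          using bspec[OF snoc.IH[OF True l], of "A # l'"] by simp
      qed
    next
      case False
      have c: "run l x \<in> carrier_vec d" using run_carrier l x by blast
      have "nrm (A *\<^sub>v run l x) \<le> L * nrm (run l x)" by (rule family_bound[OF A c])
      also have "\<dots> \<le> L * N" using small[OF l False] L_nonneg by (intro mult_left_mono) auto
      finally have le: "K * nrm (A *\<^sub>v run l x) \<le> K * (L * N)" using K0 by (rule mult_left_mono)
      show ?thesis
        using K[OF mult_mat_vec_carrier[OF family_carrier[OF A] c]] snoc.prems(1) le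
        by (fastforce intro: order_trans)
    qed
  qed
  have "nrm (run l x) \<le> max N (K * (L * N))" if l: "l \<in> lists R" for l
  proof (cases "bounded_orbit (run l x)")
    case True
    from entered[OF this l] have "nrm (run [] (run l x)) \<le> K * (L * N)" by blast
    then show ?thesis by simp
  next
    case False
    then show ?thesis using small[OF l] by force
  qed
  then show False using unb by (auto simp: bounded_orbit_def)
qed

text \<open>A vector with unbounded orbit would be the start of one unbounded trajectory: finite
  products that reach norm \<open>1, 2, 3, \<dots>\<close> at vectors of unbounded orbit are
  concatenated.\<close>

theorem uniformly_bounded:
  assumes bdd: "\<And>\<sigma> x. (\<And>k. \<sigma> k \<in> R) \<Longrightarrow> x \<in> carrier_vec d \<Longrightarrow>
      \<exists>c. \<forall>k::nat. nrm (run (map \<sigma> [0..<k]) x) \<le> c"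
  obtains K where "0 \<le> K"
    "\<And>x l. x \<in> carrier_vec d \<Longrightarrow> l \<in> lists R \<Longrightarrow> nrm (run l x) \<le> K * nrm x"
proof -
  have "bounded_orbit x" if x: "x \<in> carrier_vec d" for x
  proof (rule ccontr)
    assume unb: "\<not> bounded_orbit x"
    have "\<exists>f. \<forall>j. (f j \<in> lists R \<and> \<not> bounded_orbit (run (f j) x) \<and> j \<le> length (f j)) \<and>
       (\<exists>q. f (Suc j) = f j @ q) \<and> real j \<le> nrm (run (f (Suc j)) x)"
    proof (rule dependent_nat_choice[where
          P = "\<lambda>j l. l \<in> lists R \<and> \<not> bounded_orbit (run l x) \<and> j \<le> length l" and
          Q = "\<lambda>j l l'. (\<exists>q. l' = l @ q) \<and> real j \<le> nrm (run l' x)"])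
      show "\<exists>l. l \<in> lists R \<and> \<not> bounded_orbit (run l x) \<and> 0 \<le> length l"
        using unb by (intro exI[of _ "[]"]) auto
    next
      fix l and j :: nat assume l: "l \<in> lists R \<and> \<not> bounded_orbit (run l x) \<and> j \<le> length l"
      obtain q where q: "q \<in> lists R" "\<not> bounded_orbit (run q (run l x))"
         "max (real j) (nrm (run l x) + 1) \<le> nrm (run q (run l x))"
        using unbounded_orbit_escape[of "run l x" "max (real j) (nrm (run l x) + 1)"] l run_carrier x by blast
      \<comment> \<open>ensured by the summand 1 in the target norm\<close>
      have "q \<noteq> []" using q(3) by auto
      then have len: "Suc j \<le> length (l @ q)" using l by (cases q) auto
      then show "\<exists>y. (y \<in> lists R \<and> \<not> bounded_orbit (run y x) \<and> Suc j \<le> length y) \<and>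
            (\<exists>q. y = l @ q) \<and> real j \<le> nrm (run y x)"
        using q l len by (intro exI[of _ "l @ q"]) auto
    qed
    then obtain f where f: "\<And>j. f j \<in> lists R" "\<And>j. j \<le> length (f j)"
      "\<And>j. \<exists>q. f (Suc j) = f j @ q" "\<And>j. real j \<le> nrm (run (f (Suc j)) x)" by blast
    have prefix: "\<exists>q. f j = f i @ q" if "i \<le> j" for i j
      using that
    proof (induction rule: dec_induct)
      case (step j)
      then show ?case using f(3)[of j] by auto
    qed simp
    have nth: "f i ! k = f j ! k" if "k < length (f i)" "k < length (f j)" for i j k
      using prefix[of i j] prefix[of j i] that linear[of i j] by (auto simp: nth_append)
    \<comment> \<open>the lists \<open>f j\<close> extend each other and \<open>f (Suc k)\<close> has an entry at position \<open>k\<close>\<close>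
    define \<sigma> where "\<sigma> k = f (Suc k) ! k" for k
    have \<sigma>: "map \<sigma> [0..<length (f j)] = f j" for j
    proof (rule nth_equalityI)
      fix k assume "k < length (map \<sigma> [0..<length (f j)])"
      then show "map \<sigma> [0..<length (f j)] ! k = f j ! k"
        using nth[of k "Suc k" j] f(2)[of "Suc k"] by (simp add: \<sigma>_def)
    qed simp
    have "\<sigma> k \<in> R" for k using f(1)[of "Suc k"] f(2)[of "Suc k"] by (auto simp: \<sigma>_def)
    then obtain c where c: "\<And>k. nrm (run (map \<sigma> [0..<k]) x) \<le> c" using bdd x by blast
    obtain j :: nat where "c < real j" using reals_Archimedean2 by blast
    then show False using f(4)[of j] c[of "length (f (Suc j))"] \<sigma>[of "Suc j"] by simp
  qed
  then show thesis using bounded_orbits_uniform that by metis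
qed

text \<open>Total boundedness of \<open>{A x | A \<in> R}\<close>, by rounding the coordinates to a
  grid.\<close>

lemma finite_net:
  assumes x: "x \<in> carrier_vec d" and \<delta>: "\<delta> > 0"
  obtains F where "finite F" "F \<subseteq> R" "\<And>A. A \<in> R \<Longrightarrow> \<exists>B\<in>F. nrm (A *\<^sub>v x - B *\<^sub>v x) \<le> \<delta>"
proof -
  \<comment> \<open>grid width; \<open>d\<close> coordinates each contribute at most \<open>h\<close>\<close>
  define h where "h = \<delta> / (real d + 1)"
  have h: "h > 0" using \<delta> by (simp add: h_def)
  define g where "g A = (\<lambda>i\<in>{..<d}. \<lfloor>(A *\<^sub>v x) $ i / h\<rfloor>)" for A
  define K where "K = \<lceil>L * nrm x / h\<rceil> + 1"
  have "g ` R \<subseteq> {..<d} \<rightarrow>\<^sub>E {-K..K}"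
  proof
    fix v assume "v \<in> g ` R"
    then obtain A where A: "A \<in> R" and v: "v = g A" by auto
    have "\<lfloor>(A *\<^sub>v x) $ i / h\<rfloor> \<in> {-K..K}" if i: "i < d" for i
    proof -
      have "\<bar>(A *\<^sub>v x) $ i\<bar> \<le> L * nrm x"
        using abs_index_le_nrm[of i "A *\<^sub>v x"] family_bound[OF A x] family_carrier[OF A] i by auto
      then have le: "\<bar>(A *\<^sub>v x) $ i / h\<bar> \<le> L * nrm x / h"
        using h by (simp add: abs_divide divide_right_mono del: index_mult_mat_vec)
      have "\<lfloor>y\<rfloor> \<in> {-K..K}" if "\<bar>y\<bar> \<le> L * nrm x / h" for y
        using that unfolding K_def atLeastAtMost_iff by linarith
      then show ?thesis using le by blast
    qed
    then show "v \<in> {..<d} \<rightarrow>\<^sub>E {-K..K}" unfolding v g_def by auto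
  qed
  then have fin: "finite (g ` R)" by (rule finite_subset) (intro finite_PiE; simp)
  then obtain F where F: "F \<subseteq> R" "finite F" "g ` R = g ` F"
    using finite_subset_image[OF fin subset_refl] by blast
  show thesis
  proof (rule that[OF F(2,1)])
    fix A assume A: "A \<in> R"
    then obtain B where B: "B \<in> F" "g A = g B" using F(3) by (metis imageE imageI)
    have BR: "B \<in> R" using B F by auto
    have "\<bar>(A *\<^sub>v x - B *\<^sub>v x) $ i\<bar> \<le> h" if i: "i < d" for i
    proof -
      have "\<lfloor>(A *\<^sub>v x) $ i / h\<rfloor> = \<lfloor>(B *\<^sub>v x) $ i / h\<rfloor>"
        using fun_cong[OF B(2), of i] i by (simp add: g_def)
      then have "\<bar>(A *\<^sub>v x) $ i / h - (B *\<^sub>v x) $ i / h\<bar> \<le> 1" by linarith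
      then have "\<bar>((A *\<^sub>v x) $ i - (B *\<^sub>v x) $ i) / h\<bar> \<le> 1" by (simp add: diff_divide_distrib)
      then have "\<bar>(A *\<^sub>v x) $ i - (B *\<^sub>v x) $ i\<bar> \<le> h" using h by (simp add: abs_divide)
      then show ?thesis using i family_carrier[OF A] family_carrier[OF BR] by simp
    qed
    note entry = this
    have dim: "dim_vec (A *\<^sub>v x - B *\<^sub>v x) = d" using family_carrier[OF BR] by simp
    have "nrm (A *\<^sub>v x - B *\<^sub>v x) \<le> (\<Sum>i<d. h)"
      unfolding nrm_def dim by (intro sum_mono entry) simp
    also have "\<dots> \<le> \<delta>" using \<delta> by (simp add: h_def field_simps)
    finally show "\<exists>B\<in>F. nrm (A *\<^sub>v x - B *\<^sub>v x) \<le> \<delta>" using B by blast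
  qed
qed

text \<open>The infimum of all such \<open>c\<close> is the limit as \<open>N \<longlongrightarrow>
  \<infinity>\<close> of the supremum of the norm over all products of length at least
  \<open>N\<close>, a worst-case limit superior.\<close>

definition eventually_below :: "real \<Rightarrow> real Matrix.vec \<Rightarrow> bool" where
  "eventually_below c x \<longleftrightarrow> (\<exists>N. \<forall>l\<in>lists R. N \<le> length l \<longrightarrow> nrm (run l x) \<le> c)"

text \<open>The worst-case limit superior is almost preserved by a suitable first step. Otherwise
  every first step would lead below \<open>c'\<close> after some time. This time can be taken the
  same for the finitely many steps in a \<open>\<delta>\<close>-net of \<open>{A x | A \<in>
  R}\<close>, and passing to the net costs at most \<open>K \<delta> \<le> c - c'\<close>, where
  \<open>K\<close> bounds all products.\<close>

lemma not_eventually_below_step: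
  assumes K: "\<And>x l. x \<in> carrier_vec d \<Longrightarrow> l \<in> lists R \<Longrightarrow> nrm (run l x) \<le> K * nrm x"
    and K0: "0 \<le> K" and x: "x \<in> carrier_vec d" and e: "c' < c"
    and not: "\<not> eventually_below c x"
  shows "\<exists>A\<in>R. \<not> eventually_below c' (A *\<^sub>v x)"
proof (rule ccontr)
  assume "\<not> ?thesis"
  then have "\<forall>A\<in>R. \<exists>N. \<forall>l\<in>lists R. N \<le> length l \<longrightarrow> nrm (run l (A *\<^sub>v x)) \<le> c'"
    by (auto simp: eventually_below_def)
  then obtain N where N: "\<And>A l. A \<in> R \<Longrightarrow> l \<in> lists R \<Longrightarrow> N A \<le> length l \<Longrightarrow> nrm (run l (A *\<^sub>v x)) \<le> c'"
    by metis
  \<comment> \<open>so that \<open>K * \<delta> \<le> c - c'\<close>; the summand 1 covers \<open>K = 0\<close>\<close>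
  define \<delta> where "\<delta> = (c - c') / (K + 1)"
  have \<delta>: "\<delta> > 0" using e K0 by (simp add: \<delta>_def)
  obtain F where F: "finite F" "F \<subseteq> R" "\<And>A. A \<in> R \<Longrightarrow> \<exists>B\<in>F. nrm (A *\<^sub>v x - B *\<^sub>v x) \<le> \<delta>"
    using finite_net[OF x \<delta>] by blast
  define N0 where "N0 = Suc (\<Sum>A\<in>F. N A)"
  have "nrm (run l x) \<le> c" if l: "l \<in> lists R" and len: "N0 \<le> length l" for l
  proof -
    obtain A l' where l': "l = A # l'" using len by (cases l) (auto simp: N0_def)
    then have A: "A \<in> R" and lR: "l' \<in> lists R" using l by auto
    obtain B where B: "B \<in> F" "nrm (A *\<^sub>v x - B *\<^sub>v x) \<le> \<delta>" using F(3)[OF A] by blast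
    have BR: "B \<in> R" using B F by auto
    have cA: "A *\<^sub>v x \<in> carrier_vec d" and cB: "B *\<^sub>v x \<in> carrier_vec d"
      using mult_mat_vec_carrier[OF family_carrier x] A BR by auto
    have "N B \<le> (\<Sum>A\<in>F. N A)" using B F(1) by (intro member_le_sum) auto
    then have "nrm (run l' (B *\<^sub>v x)) \<le> c'" using N[OF BR lR] len by (simp add: l' N0_def)
    moreover have "nrm (run l' (A *\<^sub>v x - B *\<^sub>v x)) \<le> K * \<delta>"
      using K[OF _ lR, of "A *\<^sub>v x - B *\<^sub>v x"] mult_left_mono[OF B(2) K0] cA cB by fastforce
    moreover have "run l' (A *\<^sub>v x) = run l' (A *\<^sub>v x - B *\<^sub>v x) + run l' (B *\<^sub>v x)"
    proof -
      have "A *\<^sub>v x = (A *\<^sub>v x - B *\<^sub>v x) + B *\<^sub>v x"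
        using carrier_vecD[OF cA] carrier_vecD[OF cB]
        by (intro eq_vecI) (simp_all del: index_mult_mat_vec dim_mult_mat_vec)
      then show ?thesis using run_add[OF lR _ cB, of "A *\<^sub>v x - B *\<^sub>v x"] cA cB by simp
    qed
    then have "nrm (run l' (A *\<^sub>v x)) \<le> nrm (run l' (A *\<^sub>v x - B *\<^sub>v x)) + nrm (run l' (B *\<^sub>v x))"
      using cA cB lR by (metis nrm_add run_carrier minus_carrier_vec)
    moreover have "K * \<delta> \<le> c - c'" using e K0 by (simp add: \<delta>_def field_simps)
    ultimately show ?thesis by (simp add: l')
  qed
  then show False using not by (auto simp: eventually_below_def)
qed

text \<open>If some orbit did not become uniformly small, then preserving the worst-case limit
  superior up to losses with a finite sum would build a single trajectory that stays away from zero.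
  Hence for some \<open>N\<close> all products of length at least \<open>N\<close> halve the norm of
  every unit vector, hence of every vector, and \<open>q\<close> is the \<open>N\<close>-th root of
  \<open>1/2\<close>.\<close>

theorem uniformly_exponentially_stable:
  assumes conv: "\<And>\<sigma> x. (\<And>k. \<sigma> k \<in> R) \<Longrightarrow> x \<in> carrier_vec d \<Longrightarrow>
      (\<lambda>k. nrm (run (map \<sigma> [0..<k]) x)) \<longlonglongrightarrow> 0"
  obtains C q where "0 \<le> C" "0 < q" "q < 1"
    "\<And>x l. x \<in> carrier_vec d \<Longrightarrow> l \<in> lists R \<Longrightarrow> nrm (run l x) \<le> C * q ^ length l * nrm x"
proof -
  obtain K where K0: "0 \<le> K" and
    K: "\<And>x l. x \<in> carrier_vec d \<Longrightarrow> l \<in> lists R \<Longrightarrow> nrm (run l x) \<le> K * nrm x"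
  proof (rule uniformly_bounded)
    fix \<sigma> :: "nat \<Rightarrow> real mat" and x :: "real Matrix.vec"
    assume "\<And>k. \<sigma> k \<in> R" "x \<in> carrier_vec d"
    then have "(\<lambda>k. nrm (run (map \<sigma> [0..<k]) x)) \<longlonglongrightarrow> 0" by (rule conv)
    then have "Bseq (\<lambda>k. nrm (run (map \<sigma> [0..<k]) x))"
      using convergentI convergent_imp_Bseq by blast
    then show "\<exists>c. \<forall>k. nrm (run (map \<sigma> [0..<k]) x) \<le> c"
      by (auto simp: Bseq_def abs_le_iff)
  qed blast
  have below: "eventually_below c x" if x: "x \<in> carrier_vec d" and c: "c > 0" for c x
  proof (rule ccontr)
    assume not: "\<not> eventually_below c x"
    \<comment> \<open>a decreasing sequence of thresholds from \<open>c\<close> that stays above \<open>c / 2\<close>\<close>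
    define e where "e j = c * (1 / 2 + (1 / 2) ^ Suc j)" for j
    have e_dec: "e (Suc j) < e j" for j using c by (simp add: e_def)
    have e_ge: "c / 2 \<le> e j" for j using c by (simp add: e_def)
    have "\<exists>f. \<forall>j. (f j \<in> carrier_vec d \<and> \<not> eventually_below (e j) (f j) \<and> (j = 0 \<longrightarrow> f j = x)) \<and>
       (\<exists>A\<in>R. f (Suc j) = A *\<^sub>v f j)"
    proof (rule dependent_nat_choice[where
          P = "\<lambda>j y. y \<in> carrier_vec d \<and> \<not> eventually_below (e j) y \<and> (j = 0 \<longrightarrow> y = x)" and
          Q = "\<lambda>j y z. \<exists>A\<in>R. z = A *\<^sub>v y"])
      show "\<exists>y. y \<in> carrier_vec d \<and> \<not> eventually_below (e 0) y \<and> (0 = (0::nat) \<longrightarrow> y = x)"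
        using not x by (simp add: e_def)
    next
      fix y and j :: nat
      assume y: "y \<in> carrier_vec d \<and> \<not> eventually_below (e j) y \<and> (j = 0 \<longrightarrow> y = x)"
      obtain A where A: "A \<in> R" "\<not> eventually_below (e (Suc j)) (A *\<^sub>v y)"
        using not_eventually_below_step[OF K K0 _ e_dec, of y] y by blast
      then show "\<exists>z. (z \<in> carrier_vec d \<and> \<not> eventually_below (e (Suc j)) z \<and> (Suc j = 0 \<longrightarrow> z = x)) \<and>
          (\<exists>A\<in>R. z = A *\<^sub>v y)"
        using y mult_mat_vec_carrier[OF family_carrier] by (intro exI[of _ "A *\<^sub>v y"]) auto
    qed
    then obtain f where f: "\<And>j. f j \<in> carrier_vec d" "\<And>j. \<not> eventually_below (e j) (f j)"
      "f 0 = x" "\<forall>j. \<exists>A\<in>R. f (Suc j) = A *\<^sub>v f j" by blast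
    obtain \<sigma> where \<sigma>: "\<And>j. \<sigma> j \<in> R" "\<And>j. f (Suc j) = \<sigma> j *\<^sub>v f j" using f(4) by metis
    have run: "run (map \<sigma> [0..<k]) x = f k" for k
      by (induction k) (simp_all add: f(3) \<sigma>(2))
    have "c / 2 < K * nrm (f j)" for j
    proof (rule ccontr)
      assume "\<not> c / 2 < K * nrm (f j)"
      then have "nrm (run l (f j)) \<le> e j" if "l \<in> lists R" for l
        using K[OF f(1) that, of j] e_ge[of j] by linarith
      then show False using f(2)[of j] by (auto simp: eventually_below_def)
    qed
    moreover have "(\<lambda>j. K * nrm (f j)) \<longlonglongrightarrow> K * 0"
      using conv[of \<sigma> x] \<sigma>(1) x by (intro tendsto_intros) (simp add: run)
    ultimately have "c / 2 \<le> K * 0"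
      by (intro LIMSEQ_le_const) (auto intro: less_imp_le)
    then show False using c by simp
  qed
  have "\<forall>i. \<exists>N. \<forall>l\<in>lists R. N \<le> length l \<longrightarrow> nrm (run l (unit_vec d i)) \<le> 1 / 2"
    using below[OF unit_vec_carrier, of "1/2"] by (simp add: eventually_below_def)
  then obtain N where N: "\<And>i l. l \<in> lists R \<Longrightarrow> N i \<le> length l \<Longrightarrow> nrm (run l (unit_vec d i)) \<le> 1 / 2"
    by metis
  define N0 where "N0 = Suc (\<Sum>i<d. N i)"
  have half: "nrm (run l x) \<le> 1 / 2 * nrm x" if x: "x \<in> carrier_vec d" and l: "l \<in> lists R"
    and len: "N0 \<le> length l" for x l
  proof -
    have Ni: "N i \<le> length l" if "i < d" for i
    proof -
      have "N i \<le> (\<Sum>i<d. N i)" using that by (intro member_le_sum) auto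
      then show ?thesis using len by (simp add: N0_def)
    qed
    have "nrm (run l (1\<^sub>m d *\<^sub>v x)) \<le> (\<Sum>i<d. \<bar>x $ i\<bar> * nrm (run l (1\<^sub>m d *\<^sub>v unit_vec d i)))"
      by (rule nrm_run_le_sum_units[OF l _ x]) simp
    also have "\<dots> \<le> (\<Sum>i<d. \<bar>x $ i\<bar> * (1 / 2))"
      using N[OF l Ni] by (intro sum_mono mult_left_mono) auto
    also have "\<dots> = 1 / 2 * nrm x" using x by (simp add: nrm_def sum_distrib_right)
    finally show ?thesis using x by simp
  qed
  define q where "q = root N0 (1 / 2)"
  have q: "0 < q" "q < 1" and qN: "q ^ N0 = 1 / 2"
    using real_root_pow_pos2[of N0 "1 / 2"] by (simp_all add: q_def N0_def del: power_Suc)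
  have "nrm (run l x) \<le> 2 * K * q ^ length l * nrm x" if "x \<in> carrier_vec d" "l \<in> lists R" for x l
    using that
  proof (induction "length l" arbitrary: l x rule: less_induct)
    case less
    show ?case
    proof (cases "length l < N0")
      case True
      then have "q ^ N0 \<le> q ^ length l" using q by (intro power_decreasing) auto
      then have "1 \<le> 2 * q ^ length l" using qN by simp
      then have "K * nrm x * 1 \<le> K * nrm x * (2 * q ^ length l)"
        using K0 nrm_nonneg by (intro mult_left_mono mult_nonneg_nonneg) auto
      then show ?thesis using K[OF less.prems] by (simp add: mult_ac)
    next
      case False
      define l1 where "l1 = take N0 l"
      define l2 where "l2 = drop N0 l"
      have l: "l = l1 @ l2" by (simp add: l1_def l2_def)
      then have lR: "l1 \<in> lists R" "l2 \<in> lists R" using less.prems by auto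
      have len: "length l1 = N0" using False by (simp add: l1_def)
      have "nrm (run l2 (run l1 x)) \<le> 2 * K * q ^ length l2 * nrm (run l1 x)"
        by (rule less.hyps) (use len l lR less.prems run_carrier in \<open>auto simp: N0_def\<close>)
      also have "\<dots> \<le> 2 * K * q ^ length l2 * (1 / 2 * nrm x)"
        using half[OF less.prems(1) lR(1)] len K0 q by (intro mult_left_mono) auto
      also have "\<dots> = 2 * K * q ^ length l * nrm x"
        using len qN by (simp add: l power_add)
      finally show ?thesis by (simp add: l)
    qed
  qed
  then show thesis using that[of "2 * K" q] K0 q by auto
qed

end

section \<open>Convex combinations and block triangular form\<close>

lemma eucl_norm_sum: "eucl_norm v = sqrt (\<Sum>i<dim_vec v. (v $ i)\<^sup>2)"
  by (simp add: eucl_norm_def scalar_prod_def power2_eq_square atLeast0LessThan)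

lemma eucl_norm_nonneg: "0 \<le> eucl_norm v"
  by (simp add: eucl_norm_sum sum_nonneg)

lemma eucl_norm_le_nrm: "eucl_norm v \<le> nrm v"
  using L2_set_le_sum_abs[of "\<lambda>i. v $ i" "{..<dim_vec v}"]
  by (simp add: eucl_norm_sum nrm_def L2_set_def)

lemma nrm_le_eucl_norm: "nrm v \<le> real (dim_vec v) * eucl_norm v"
proof -
  have "\<bar>v $ i\<bar> \<le> eucl_norm v" if i: "i < dim_vec v" for i
  proof -
    have "(v $ i)\<^sup>2 \<le> (\<Sum>i<dim_vec v. (v $ i)\<^sup>2)"
      using i by (intro member_le_sum) auto
    then show ?thesis unfolding eucl_norm_sum by (metis real_sqrt_abs real_sqrt_le_mono)
  qed
  then have "nrm v \<le> (\<Sum>i<dim_vec v. eucl_norm v)"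
    unfolding nrm_def by (intro sum_mono) simp
  then show ?thesis by simp
qed

lemma eucl_norm_tendsto_iff:
  assumes "eventually (\<lambda>t. x t \<in> carrier_vec d) F"
  shows "((\<lambda>t. eucl_norm (x t)) \<longlongrightarrow> 0) F \<longleftrightarrow> ((\<lambda>t. nrm (x t)) \<longlongrightarrow> 0) F"
proof
  assume lim: "((\<lambda>t. eucl_norm (x t)) \<longlongrightarrow> 0) F"
  have "((\<lambda>t. real d * eucl_norm (x t)) \<longlongrightarrow> real d * 0) F"
    by (intro tendsto_intros lim)
  then have lim': "((\<lambda>t. real d * eucl_norm (x t)) \<longlongrightarrow> 0) F" by simp
  show "((\<lambda>t. nrm (x t)) \<longlongrightarrow> 0) F"
  proof (rule Lim_null_comparison[OF _ lim'])
    show "eventually (\<lambda>t. norm (nrm (x t)) \<le> real d * eucl_norm (x t)) F"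
      using assms
    proof eventually_elim
      case (elim t)
      then show ?case using nrm_le_eucl_norm[of "x t"] nrm_nonneg[of "x t"] by simp
    qed
  qed
next
  assume "((\<lambda>t. nrm (x t)) \<longlongrightarrow> 0) F"
  then show "((\<lambda>t. eucl_norm (x t)) \<longlongrightarrow> 0) F"
    by (rule Lim_null_comparison[rotated]) (simp add: eucl_norm_le_nrm eucl_norm_nonneg)
qed

lemma nrm_tendsto_zeroI:
  assumes "eventually (\<lambda>t. x t \<in> carrier_vec d) F"
    and lim: "\<And>j. j < d \<Longrightarrow> ((\<lambda>t. x t $ j) \<longlongrightarrow> 0) F"
  shows "((\<lambda>t. nrm (x t)) \<longlongrightarrow> 0) F"
proof -
  have *: "((\<lambda>t. \<Sum>j<d. \<bar>x t $ j\<bar>) \<longlongrightarrow> (\<Sum>j<d. \<bar>0\<bar>)) F"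
    by (intro tendsto_sum tendsto_rabs lim) simp
  have **: "eventually (\<lambda>t. (\<Sum>j<d. \<bar>x t $ j\<bar>) = nrm (x t)) F"
    using assms(1) by eventually_elim (simp add: nrm_def)
  show ?thesis using Lim_transform_eventually[OF * **] by simp
qed

lemma nrm_mult_mat_vec_bound:
  assumes A: "(A :: real mat) \<in> carrier_mat r d"
  obtains b where "0 \<le> b" "\<And>x. x \<in> carrier_vec d \<Longrightarrow> nrm (A *\<^sub>v x) \<le> b * nrm x"
proof -
  define b where "b = (\<Sum>i<r. \<Sum>j<d. \<bar>A $$ (i,j)\<bar>)"
  have "\<bar>A $$ (i,j)\<bar> \<le> b" if "i < r" "j < d" for i j
  proof -
    have "\<bar>A $$ (i,j)\<bar> \<le> (\<Sum>j<d. \<bar>A $$ (i,j)\<bar>)" using that by (intro member_le_sum) auto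
    also have "\<dots> \<le> b" unfolding b_def using that
      by (intro member_le_sum[of i _ "\<lambda>i. \<Sum>j<d. \<bar>A $$ (i,j)\<bar>"]) (auto intro: sum_nonneg)
    finally show ?thesis .
  qed
  then have "nrm (A *\<^sub>v x) \<le> real r * b * nrm x" if "x \<in> carrier_vec d" for x
    using nrm_mult_mat_vec_le[OF A that] by blast
  moreover have "0 \<le> b" by (auto simp: b_def intro!: sum_nonneg)
  ultimately show thesis using that[of "real r * b"] by simp
qed

text \<open>Used for the components along the common kernel, whose increments are bounded by the
  decaying transversal components, and for the pointwise limit of the Picard iteration.\<close>

lemma tendsto_of_geometric_increments:
  fixes f :: "nat \<Rightarrow> real"
  assumes "\<And>k. \<bar>f (Suc k) - f k\<bar> \<le> c * q ^ k" and "0 < q" "q < 1"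
  shows "\<exists>l. f \<longlonglongrightarrow> l"
proof -
  have "summable (\<lambda>k. f (Suc k) - f k)"
    by (rule summable_comparison_test'[of "\<lambda>k. c * q ^ k" 0])
       (use assms in \<open>auto intro!: summable_mult summable_geometric\<close>)
  then have "(\<lambda>k. \<Sum>i<k. f (Suc i) - f i) \<longlonglongrightarrow> (\<Sum>i. f (Suc i) - f i)"
    by (rule summable_LIMSEQ)
  then have "(\<lambda>k. (f k - f 0) + f 0) \<longlonglongrightarrow> (\<Sum>i. f (Suc i) - f i) + f 0"
    unfolding sum_lessThan_telescope by (rule tendsto_add) simp
  then show ?thesis by auto
qed

lemma simplex_weightsD:
  assumes "w \<in> simplex_weights M"
  shows "(\<Sum>i<M. w $ i) = 1" "\<And>i. i < M \<Longrightarrow> 0 \<le> w $ i" "\<And>i. i < M \<Longrightarrow> w $ i \<le> 1"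
proof -
  show sum: "(\<Sum>i<M. w $ i) = 1" and nn: "\<And>i. i < M \<Longrightarrow> 0 \<le> w $ i"
    using assms by (auto simp: simplex_weights_def)
  show "w $ i \<le> 1" if "i < M" for i
    using member_le_sum[of i "{..<M}" "\<lambda>i. w $ i"] that nn sum by simp
qed

lemma comb_mat_carrier [simp]: "comb_mat d M A w \<in> carrier_mat d d"
  by (simp add: comb_mat_def)

text \<open>Applied to rectangular matrices as well, which is needed for the blocks \<open>Ar
  i\<close>.\<close>

definition comb_act ::
  "nat \<Rightarrow> nat \<Rightarrow> (nat \<Rightarrow> real mat) \<Rightarrow> real Matrix.vec \<Rightarrow> real Matrix.vec \<Rightarrow> real Matrix.vec" where
  "comb_act r M B w x = Matrix.vec r (\<lambda>j. \<Sum>i<M. w $ i * (B i *\<^sub>v x) $ j)"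

lemma comb_mat_mult_vec:
  assumes A: "\<And>i. i < M \<Longrightarrow> A i \<in> carrier_mat d d" and x: "x \<in> carrier_vec d"
  shows "comb_mat d M A w *\<^sub>v x = comb_act d M A w x"
proof (rule eq_vecI)
  fix j assume "j < dim_vec (comb_act d M A w x)"
  then have j: "j < d" by (simp add: comb_act_def)
  have "(comb_mat d M A w *\<^sub>v x) $ j = (\<Sum>c<d. (\<Sum>i<M. w $ i * A i $$ (j, c)) * x $ c)"
    using x j by (simp add: comb_mat_def scalar_prod_def atLeast0LessThan)
  also have "\<dots> = (\<Sum>i<M. w $ i * (\<Sum>c<d. A i $$ (j, c) * x $ c))"
    by (simp add: sum_distrib_right sum_distrib_left mult.assoc) (rule sum.swap)
  also have "\<dots> = (\<Sum>i<M. w $ i * (A i *\<^sub>v x) $ j)"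
  proof (rule sum.cong[OF refl])
    fix i assume "i \<in> {..<M}"
    then have "A i \<in> carrier_mat d d" using A by simp
    then show "w $ i * (\<Sum>c<d. A i $$ (j, c) * x $ c) = w $ i * (A i *\<^sub>v x) $ j"
      using x j by (simp add: scalar_prod_def atLeast0LessThan)
  qed
  finally show "(comb_mat d M A w *\<^sub>v x) $ j = comb_act d M A w x $ j"
    using j by (simp add: comb_act_def)
qed (simp add: comb_act_def comb_mat_def)

lemma mult_comb_act:
  assumes Q: "Q \<in> carrier_mat r d" and A: "\<And>i. i < M \<Longrightarrow> A i \<in> carrier_mat d e"
    and x: "x \<in> carrier_vec e"
  shows "Q *\<^sub>v comb_act d M A w x = comb_act r M (\<lambda>i. Q * A i) w x"
proof (rule eq_vecI)
  fix j assume "j < dim_vec (comb_act r M (\<lambda>i. Q * A i) w x)"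
  then have j: "j < r" by (simp add: comb_act_def)
  have "(Q *\<^sub>v comb_act d M A w x) $ j = (\<Sum>c<d. Q $$ (j,c) * (\<Sum>i<M. w $ i * (A i *\<^sub>v x) $ c))"
    using Q j by (simp add: comb_act_def scalar_prod_def atLeast0LessThan)
  also have "\<dots> = (\<Sum>i<M. w $ i * (\<Sum>c<d. Q $$ (j,c) * (A i *\<^sub>v x) $ c))"
    by (simp add: sum_distrib_left mult.left_commute) (rule sum.swap)
  also have "\<dots> = (\<Sum>i<M. w $ i * ((Q * A i) *\<^sub>v x) $ j)"
  proof (rule sum.cong[OF refl])
    fix i assume "i \<in> {..<M}"
    then have Ai: "A i \<in> carrier_mat d e" using A by simp
    have "((Q * A i) *\<^sub>v x) $ j = (Q *\<^sub>v (A i *\<^sub>v x)) $ j"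
      using assoc_mult_mat_vec[OF Q Ai x] by simp
    also have "\<dots> = (\<Sum>c<d. Q $$ (j,c) * (A i *\<^sub>v x) $ c)"
      using Q Ai j by (simp add: scalar_prod_def atLeast0LessThan)
    finally show "w $ i * (\<Sum>c<d. Q $$ (j,c) * (A i *\<^sub>v x) $ c) = w $ i * ((Q * A i) *\<^sub>v x) $ j" by simp
  qed
  finally show "(Q *\<^sub>v comb_act d M A w x) $ j = comb_act r M (\<lambda>i. Q * A i) w x $ j"
    using j by (simp add: comb_act_def)
qed (use Q in \<open>simp add: comb_act_def\<close>)

lemma comb_act_bound:
  assumes B: "\<And>i. i < M \<Longrightarrow> B i \<in> carrier_mat r d"
  obtains b where "0 \<le> b"
    "\<And>w x. w \<in> simplex_weights M \<Longrightarrow> x \<in> carrier_vec d \<Longrightarrow> nrm (comb_act r M B w x) \<le> b * nrm x"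
proof -
  have "\<exists>b. 0 \<le> b \<and> (\<forall>x\<in>carrier_vec d. nrm (B i *\<^sub>v x) \<le> b * nrm x)" if "i < M" for i
    using nrm_mult_mat_vec_bound[OF B[OF that]] by metis
  then obtain b where b: "\<And>i. i < M \<Longrightarrow> 0 \<le> b i"
    "\<And>i x. i < M \<Longrightarrow> x \<in> carrier_vec d \<Longrightarrow> nrm (B i *\<^sub>v x) \<le> b i * nrm x" by metis
  have "nrm (comb_act r M B w x) \<le> (\<Sum>i<M. b i) * nrm x"
    if w: "w \<in> simplex_weights M" and x: "x \<in> carrier_vec d" for w x
  proof -
    have "nrm (comb_act r M B w x) = (\<Sum>j<r. \<bar>\<Sum>i<M. w $ i * (B i *\<^sub>v x) $ j\<bar>)"
      by (simp add: nrm_def comb_act_def)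
    also have "\<dots> \<le> (\<Sum>j<r. \<Sum>i<M. \<bar>(B i *\<^sub>v x) $ j\<bar>)"
    proof (intro sum_mono order_trans[OF sum_abs])
      fix i j assume "i \<in> {..<M}"
      then have "\<bar>w $ i\<bar> \<le> 1" using simplex_weightsD[OF w] by simp
      then have "\<bar>w $ i\<bar> * \<bar>(B i *\<^sub>v x) $ j\<bar> \<le> 1 * \<bar>(B i *\<^sub>v x) $ j\<bar>" by (rule mult_right_mono) simp
      then show "\<bar>w $ i * (B i *\<^sub>v x) $ j\<bar> \<le> \<bar>(B i *\<^sub>v x) $ j\<bar>" by (simp add: abs_mult)
    qed
    also have "\<dots> = (\<Sum>i<M. \<Sum>j<r. \<bar>(B i *\<^sub>v x) $ j\<bar>)" by (rule sum.swap)
    also have "\<dots> = (\<Sum>i<M. nrm (B i *\<^sub>v x))"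
    proof (rule sum.cong[OF refl])
      fix i assume "i \<in> {..<M}"
      then have "dim_row (B i) = r" using B by auto
      then show "(\<Sum>j<r. \<bar>(B i *\<^sub>v x) $ j\<bar>) = nrm (B i *\<^sub>v x)" by (simp add: nrm_def)
    qed
    also have "\<dots> \<le> (\<Sum>i<M. b i * nrm x)" using b(2) x by (intro sum_mono) auto
    finally show ?thesis by (simp add: sum_distrib_right)
  qed
  moreover have "0 \<le> (\<Sum>i<M. b i)" using b(1) by (intro sum_nonneg) simp
  ultimately show thesis using that by metis
qed

lemma comb_mat_bound:
  assumes A: "\<And>i. i < M \<Longrightarrow> A i \<in> carrier_mat d d"
  obtains b where "0 < b"
    "\<And>w x. w \<in> simplex_weights M \<Longrightarrow> x \<in> carrier_vec d \<Longrightarrow> nrm (comb_mat d M A w *\<^sub>v x) \<le> b * nrm x"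
proof -
  obtain b where b: "0 \<le> b"
    "\<And>w x. w \<in> simplex_weights M \<Longrightarrow> x \<in> carrier_vec d \<Longrightarrow> nrm (comb_act d M A w x) \<le> b * nrm x"
    by (rule comb_act_bound[where B = A, OF A]) (assumption | rule that)+
  have "nrm (comb_mat d M A w *\<^sub>v x) \<le> (b + 1) * nrm x"
    if "w \<in> simplex_weights M" "x \<in> carrier_vec d" for w x
    using b(2)[OF that] nrm_nonneg[of x] by (simp add: comb_mat_mult_vec[OF A that(2)] algebra_simps)
  then show thesis using that[of "b + 1"] b(1) by simp
qed

text \<open>One locale serves both time domains: \<open>\<delta> = 1\<close> in discrete time, where
  \<open>X\<close> consists of common fixed points, and \<open>\<delta> = 0\<close> in continuous
  time, where it is the common kernel. In either case \<open>X\<close> is given by \<open>A i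
  *\<^sub>v x = \<delta> \<cdot>\<^sub>v x\<close>.\<close>

locale block_form =
  fixes n p m M :: nat and A As Ar :: "nat \<Rightarrow> real mat" and T S :: "real mat" and \<delta> :: real
  assumes dims: "n = p + m"
    and A: "i < M \<Longrightarrow> A i \<in> carrier_mat n n"
    and T: "T \<in> carrier_mat n n" and S: "S \<in> carrier_mat n n"
    and TS: "T * S = 1\<^sub>m n" and ST: "S * T = 1\<^sub>m n"
    and As: "i < M \<Longrightarrow> As i \<in> carrier_mat p p"
    and Ar: "i < M \<Longrightarrow> Ar i \<in> carrier_mat m p"
    and blocks: "i < M \<Longrightarrow>
      S * A i * T = four_block_mat (As i) (0\<^sub>m p m) (Ar i) (\<delta> \<cdot>\<^sub>m 1\<^sub>m m)"
begin

abbreviation block :: "nat \<Rightarrow> real mat" where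
  "block i \<equiv> four_block_mat (As i) (0\<^sub>m p m) (Ar i) (\<delta> \<cdot>\<^sub>m 1\<^sub>m m)"

lemma TSx: "x \<in> carrier_vec n \<Longrightarrow> T *\<^sub>v (S *\<^sub>v x) = x"
  using assoc_mult_mat_vec[OF T S] TS by (metis one_mult_mat_vec)

lemma STx: "x \<in> carrier_vec n \<Longrightarrow> S *\<^sub>v (T *\<^sub>v x) = x"
  using assoc_mult_mat_vec[OF S T] ST by (metis one_mult_mat_vec)

lemma block_mult:
  assumes i: "i < M" and y: "y \<in> carrier_vec n"
  shows "block i *\<^sub>v y = (As i *\<^sub>v vec_first y p) @\<^sub>v (Ar i *\<^sub>v vec_first y p + \<delta> \<cdot>\<^sub>v vec_last y m)"
proof -
  have "block i *\<^sub>v y = block i *\<^sub>v (vec_first y p @\<^sub>v vec_last y m)"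
    using y dims by simp
  also have "\<dots> = (As i *\<^sub>v vec_first y p + 0\<^sub>m p m *\<^sub>v vec_last y m) @\<^sub>v
      (Ar i *\<^sub>v vec_first y p + (\<delta> \<cdot>\<^sub>m 1\<^sub>m m) *\<^sub>v vec_last y m)"
    by (rule four_block_mat_mult_vec[OF As[OF i] _ Ar[OF i]]) auto
  also have "0\<^sub>m p m *\<^sub>v vec_last y m = 0\<^sub>v p" by (intro eq_vecI) auto
  also have "(\<delta> \<cdot>\<^sub>m 1\<^sub>m m) *\<^sub>v vec_last y m = \<delta> \<cdot>\<^sub>v vec_last y m"
    by (intro eq_vecI) (auto simp: row_smult)
  finally show ?thesis using mult_mat_vec_carrier[OF As[OF i] vec_first_carrier] by simp
qed

lemma conj_mult:
  assumes x: "x \<in> carrier_vec n"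
  shows "S *\<^sub>v (comb_mat n M A w *\<^sub>v x) = comb_act n M block w (S *\<^sub>v x)"
proof -
  have "S *\<^sub>v (comb_mat n M A w *\<^sub>v x) = comb_act n M (\<lambda>i. S * A i) w x"
    using comb_mat_mult_vec[OF A x] mult_comb_act[OF S A x] by simp
  also have "\<dots> = comb_act n M block w (S *\<^sub>v x)"
  proof -
    have "S * A i *\<^sub>v x = block i *\<^sub>v (S *\<^sub>v x)" if i: "i < M" for i
    proof -
      have SA: "S * A i \<in> carrier_mat n n" using S A[OF i] by simp
      have "block i *\<^sub>v (S *\<^sub>v x) = (S * A i) *\<^sub>v (T *\<^sub>v (S *\<^sub>v x))"
        unfolding blocks[OF i, symmetric]
        by (rule assoc_mult_mat_vec[OF SA T]) (use S x in simp)
      then show ?thesis using TSx[OF x] by simp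
    qed
    then show ?thesis by (auto simp: comb_act_def intro!: eq_vecI sum.cong)
  qed
  finally show ?thesis .
qed

lemma conj_first:
  assumes x: "x \<in> carrier_vec n" and j: "j < p"
  shows "(S *\<^sub>v (comb_mat n M A w *\<^sub>v x)) $ j = (comb_mat p M As w *\<^sub>v vec_first (S *\<^sub>v x) p) $ j"
proof -
  have Sx: "S *\<^sub>v x \<in> carrier_vec n" using S x by simp
  have "(block i *\<^sub>v (S *\<^sub>v x)) $ j = (As i *\<^sub>v vec_first (S *\<^sub>v x) p) $ j" if i: "i < M" for i
    unfolding block_mult[OF i Sx] using As[OF i] Ar[OF i] j by (simp add: index_append_vec)
  then show ?thesis
    unfolding conj_mult[OF x] using j dims
    by (simp add: comb_mat_mult_vec[OF As vec_first_carrier] comb_act_def del: index_mult_mat_vec)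
qed

lemma conj_last:
  assumes x: "x \<in> carrier_vec n" and j: "j < m" and w: "w \<in> simplex_weights M"
  shows "(S *\<^sub>v (comb_mat n M A w *\<^sub>v x)) $ (p + j) =
     comb_act m M Ar w (vec_first (S *\<^sub>v x) p) $ j + \<delta> * (S *\<^sub>v x) $ (p + j)"
proof -
  have Sx: "S *\<^sub>v x \<in> carrier_vec n" using S x by simp
  define y where "y = S *\<^sub>v x"
  have y: "y \<in> carrier_vec n" using Sx y_def by simp
  have "(block i *\<^sub>v y) $ (p + j) = (Ar i *\<^sub>v vec_first y p) $ j + \<delta> * y $ (p + j)"
    if i: "i < M" for i
    unfolding block_mult[OF i y] using As[OF i] Ar[OF i] j y dims
    by (simp add: index_append_vec vec_last_def)
  then have "comb_act n M block w y $ (p + j) =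
      (\<Sum>i<M. w $ i * ((Ar i *\<^sub>v vec_first y p) $ j + \<delta> * y $ (p + j)))"
    using j dims by (simp add: comb_act_def del: index_mult_mat_vec)
  also have "\<dots> = (\<Sum>i<M. w $ i * (Ar i *\<^sub>v vec_first y p) $ j) + (\<Sum>i<M. w $ i) * (\<delta> * y $ (p + j))"
    by (simp add: distrib_left sum.distrib sum_distrib_right del: index_mult_mat_vec)
  finally show ?thesis
    unfolding conj_mult[OF x] y_def using simplex_weightsD(1)[OF w] j by (simp add: comb_act_def)
qed

lemma fixed_of_first_zero:
  assumes y: "y \<in> carrier_vec n" "\<And>j. j < p \<Longrightarrow> y $ j = 0" and i: "i < M"
  shows "A i *\<^sub>v (T *\<^sub>v y) = \<delta> \<cdot>\<^sub>v (T *\<^sub>v y)"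
proof -
  have Ty: "T *\<^sub>v y \<in> carrier_vec n" using T y by simp
  have ATy: "A i *\<^sub>v (T *\<^sub>v y) \<in> carrier_vec n" using A[OF i] Ty by simp
  have first0: "vec_first y p = 0\<^sub>v p" using y(2) by (auto simp: vec_first_def)
  have "S *\<^sub>v (A i *\<^sub>v (T *\<^sub>v y)) = (S * A i) *\<^sub>v (T *\<^sub>v y)"
    using assoc_mult_mat_vec[OF S A[OF i] Ty] by simp
  also have "\<dots> = block i *\<^sub>v y"
    unfolding blocks[OF i, symmetric] using S A[OF i] T y(1)
    by (intro assoc_mult_mat_vec[symmetric]) auto
  also have "\<dots> = \<delta> \<cdot>\<^sub>v y"
  proof (rule eq_vecI)
    fix j assume "j < dim_vec (\<delta> \<cdot>\<^sub>v y)"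
    then have j: "j < p + m" using y(1) dims by simp
    have "As i *\<^sub>v 0\<^sub>v p = 0\<^sub>v p" "Ar i *\<^sub>v 0\<^sub>v p = 0\<^sub>v m"
      using As[OF i] Ar[OF i] by (auto intro!: eq_vecI)
    then show "(block i *\<^sub>v y) $ j = (\<delta> \<cdot>\<^sub>v y) $ j"
      unfolding block_mult[OF i y(1)] first0 using j y dims
      by (auto simp: index_append_vec vec_last_def)
  qed (use y(1) dims As[OF i] in simp)
  finally have "T *\<^sub>v (S *\<^sub>v (A i *\<^sub>v (T *\<^sub>v y))) = T *\<^sub>v (\<delta> \<cdot>\<^sub>v y)" by simp
  then show ?thesis using TSx[OF ATy] mult_mat_vec[OF T y(1)] by simp
qed

text \<open>This turns convergence of coordinates into strong convergence. The limit has no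
  transversal component, and every such vector belongs to the common kernel because of the zero
  block and the scalar block.\<close>

lemma converges_to_fixed:
  assumes x: "eventually (\<lambda>t. x t \<in> carrier_vec n) F"
    and first: "\<And>j. j < p \<Longrightarrow> ((\<lambda>t. (S *\<^sub>v x t) $ j) \<longlongrightarrow> 0) F"
    and last: "\<And>j. j < m \<Longrightarrow> \<exists>l. ((\<lambda>t. (S *\<^sub>v x t) $ (p + j)) \<longlongrightarrow> l) F"
  shows "\<exists>xb\<in>carrier_vec n. (\<forall>i<M. A i *\<^sub>v xb = \<delta> \<cdot>\<^sub>v xb) \<and> ((\<lambda>t. eucl_norm (x t - xb)) \<longlongrightarrow> 0) F"
proof -
  obtain l where l: "\<And>j. j < m \<Longrightarrow> ((\<lambda>t. (S *\<^sub>v x t) $ (p + j)) \<longlongrightarrow> l j) F"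
    using last by metis
  define y where "y = Matrix.vec n (\<lambda>j. if j < p then 0 else l (j - p))"
  have y: "y \<in> carrier_vec n" by (simp add: y_def)
  have lim: "((\<lambda>t. (S *\<^sub>v x t) $ j) \<longlongrightarrow> y $ j) F" if "j < n" for j
    using first[of j] l[of "j - p"] that dims by (auto simp: y_def simp del: index_mult_mat_vec)
  obtain b where b: "0 \<le> b" "\<And>v. v \<in> carrier_vec n \<Longrightarrow> nrm (T *\<^sub>v v) \<le> b * nrm v"
    using nrm_mult_mat_vec_bound[OF T] by blast
  have Ty: "T *\<^sub>v y \<in> carrier_vec n" using T y by simp
  have "((\<lambda>t. nrm (S *\<^sub>v x t - y)) \<longlongrightarrow> 0) F"
  proof (rule nrm_tendsto_zeroI)
    show "eventually (\<lambda>t. S *\<^sub>v x t - y \<in> carrier_vec n) F"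
      using x by eventually_elim (use S y in simp)
    fix j assume j: "j < n"
    have "((\<lambda>t. (S *\<^sub>v x t) $ j - y $ j) \<longlongrightarrow> 0) F"
      using tendsto_diff[OF lim[OF j] tendsto_const[of "y $ j"]] by simp
    then show "((\<lambda>t. (S *\<^sub>v x t - y) $ j) \<longlongrightarrow> 0) F" using j y S by simp
  qed
  then have "((\<lambda>t. b * nrm (S *\<^sub>v x t - y)) \<longlongrightarrow> b * 0) F" by (intro tendsto_intros)
  moreover have "eventually (\<lambda>t. norm (nrm (x t - T *\<^sub>v y)) \<le> b * nrm (S *\<^sub>v x t - y)) F"
    using x
  proof eventually_elim
    case (elim t)
    have Sx: "S *\<^sub>v x t \<in> carrier_vec n" using S elim by simp
    have "x t - T *\<^sub>v y = T *\<^sub>v (S *\<^sub>v x t - y)"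
      using mult_minus_distrib_mat_vec[OF T Sx y] TSx[OF elim] by simp
    then show ?case using b(2)[of "S *\<^sub>v x t - y"] Sx y nrm_nonneg by simp
  qed
  ultimately have "((\<lambda>t. nrm (x t - T *\<^sub>v y)) \<longlongrightarrow> 0) F"
    using Lim_null_comparison[of "\<lambda>t. nrm (x t - T *\<^sub>v y)" "\<lambda>t. b * nrm (S *\<^sub>v x t - y)" F] by simp
  moreover have "eventually (\<lambda>t. x t - T *\<^sub>v y \<in> carrier_vec n) F"
    using x by eventually_elim (use Ty in simp)
  ultimately have "((\<lambda>t. eucl_norm (x t - T *\<^sub>v y)) \<longlongrightarrow> 0) F"
    using eucl_norm_tendsto_iff[of "\<lambda>t. x t - T *\<^sub>v y" n F] by blast
  moreover have "\<forall>i<M. A i *\<^sub>v (T *\<^sub>v y) = \<delta> \<cdot>\<^sub>v (T *\<^sub>v y)"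
    using fixed_of_first_zero[OF y] dims by (simp add: y_def)
  ultimately show ?thesis using Ty by blast
qed

lemma first_tendsto_zero:
  assumes x: "eventually (\<lambda>t. x t \<in> carrier_vec n) F" and xb: "xb \<in> carrier_vec n"
    and zero: "\<And>j. j < p \<Longrightarrow> (S *\<^sub>v xb) $ j = 0"
    and lim: "((\<lambda>t. eucl_norm (x t - xb)) \<longlongrightarrow> 0) F"
  shows "((\<lambda>t. nrm (vec_first (S *\<^sub>v x t) p)) \<longlongrightarrow> 0) F"
proof -
  obtain b where b: "0 \<le> b" "\<And>v. v \<in> carrier_vec n \<Longrightarrow> nrm (S *\<^sub>v v) \<le> b * nrm v"
    using nrm_mult_mat_vec_bound[OF S] by blast
  have "eventually (\<lambda>t. x t - xb \<in> carrier_vec n) F"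
    using x by eventually_elim (use xb in simp)
  then have "((\<lambda>t. nrm (x t - xb)) \<longlongrightarrow> 0) F" using lim eucl_norm_tendsto_iff[of "\<lambda>t. x t - xb" n F] by blast
  then have lim': "((\<lambda>t. b * nrm (x t - xb)) \<longlongrightarrow> b * 0) F" by (intro tendsto_intros)
  show ?thesis
  proof (rule nrm_tendsto_zeroI)
    fix j assume j: "j < p"
    show "((\<lambda>t. vec_first (S *\<^sub>v x t) p $ j) \<longlongrightarrow> 0) F"
    proof (rule Lim_null_comparison[OF _ lim'[simplified]])
      show "eventually (\<lambda>t. norm (vec_first (S *\<^sub>v x t) p $ j) \<le> b * nrm (x t - xb)) F"
        using x
      proof eventually_elim
        case (elim t)
        have "vec_first (S *\<^sub>v x t) p $ j = (S *\<^sub>v x t) $ j - (S *\<^sub>v xb) $ j"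
          using j zero[OF j] by (simp add: vec_first_def)
        also have "\<dots> = (S *\<^sub>v (x t - xb)) $ j"
          using mult_minus_distrib_mat_vec[OF S elim xb] j dims S
          by (simp del: index_mult_mat_vec)
        finally show ?case
          using abs_index_le_nrm[of j "S *\<^sub>v (x t - xb)"] b(2)[of "x t - xb"] elim xb j dims S
          by simp
      qed
    qed
  qed simp
qed

end

section \<open>Discrete time\<close>

text \<open>The columns of \<open>T\<close> with index at least \<open>n - m\<close> lie in
  \<open>X\<close>, where each \<open>A i\<close> acts as the scalar \<open>\<delta>\<close>. This
  determines the right half of \<open>S * A i * T\<close>; the left half is simply cut into
  \<open>As i\<close> and \<open>Ar i\<close>.\<close>

lemma block_form_exists:
  fixes A :: "nat \<Rightarrow> real mat" and \<delta> :: real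
  assumes A: "\<And>i. i < M \<Longrightarrow> A i \<in> carrier_mat n n"
  defines "X \<equiv> {x \<in> carrier_vec n. \<forall>i<M. A i *\<^sub>v x = \<delta> \<cdot>\<^sub>v x}"
  defines "m \<equiv> subspace_dim n X"
  obtains As Ar T S where "block_form n (n - m) m M A As Ar T S \<delta>"
    "\<And>x. x \<in> carrier_vec n \<Longrightarrow> x \<in> X \<longleftrightarrow> (\<forall>j < n - m. (S *\<^sub>v x) $ j = 0)"
proof -
  obtain T S :: "real mat" where T: "T \<in> carrier_mat n n" and S: "S \<in> carrier_mat n n"
    and TS: "T * S = 1\<^sub>m n" and ST: "S * T = 1\<^sub>m n" and "subspace_dim n X \<le> n"
    and iff: "\<And>x. x \<in> carrier_vec n \<Longrightarrow>
       x \<in> X \<longleftrightarrow> (\<forall>i < n - subspace_dim n X. (S *\<^sub>v x) $ i = 0)"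
  proof (rule subspace_adapted_basis[of X n])
    show "X \<subseteq> carrier_vec n" by (auto simp: X_def)
    have zero: "A i *\<^sub>v 0\<^sub>v n = \<delta> \<cdot>\<^sub>v 0\<^sub>v n" if "i < M" for i
      using A[OF that] by (intro eq_vecI) auto
    then show "0\<^sub>v n \<in> X" by (simp add: X_def)
    show "x + y \<in> X" if "x \<in> X" "y \<in> X" for x y
      using that mult_add_distrib_mat_vec[OF A] smult_add_distrib_vec[of x n y \<delta>]
      by (simp add: X_def)
    show "c \<cdot>\<^sub>v x \<in> X" if "x \<in> X" for c x
      using that mult_mat_vec[OF A] by (simp add: X_def smult_smult_assoc mult.commute)
  qed (rule that)
  then have mn: "m \<le> n" by (simp add: m_def)
  define p where "p = n - m"
  have pm: "n = p + m" using mn by (simp add: p_def)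
  define B where "B i = S * A i * T" for i
  have B: "B i \<in> carrier_mat n n" if "i < M" for i using A[OF that] S T by (simp add: B_def)
  define As where "As i = Matrix.mat p p (\<lambda>(r,c). B i $$ (r,c))" for i
  define Ar where "Ar i = Matrix.mat m p (\<lambda>(r,c). B i $$ (p + r, c))" for i
  have Bcol: "B i $$ (r, c) = (if r = c then \<delta> else 0)" if i: "i < M" and r: "r < n" and c: "p \<le> c" "c < n" for i r c
  proof -
    define v where "v = T *\<^sub>v unit_vec n c"
    have v: "v \<in> carrier_vec n" using T by (simp add: v_def)
    have Sv: "S *\<^sub>v v = unit_vec n c"
      unfolding v_def using assoc_mult_mat_vec[OF S T unit_vec_carrier[of n c]] by (simp add: ST)
    have "v \<in> X" using iff[OF v] Sv c by (simp add: p_def m_def)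
    then have Av: "A i *\<^sub>v v = \<delta> \<cdot>\<^sub>v v" using i by (simp add: X_def)
    have "B i *\<^sub>v unit_vec n c = S *\<^sub>v (A i *\<^sub>v v)"
      unfolding B_def v_def using S A[OF i] T
        assoc_mult_mat_vec[of "S * A i" n n T n "unit_vec n c"] assoc_mult_mat_vec[of S n n "A i" n v]
      by (simp add: v_def)
    also have "\<dots> = \<delta> \<cdot>\<^sub>v unit_vec n c" unfolding Av using mult_mat_vec[OF S v] Sv by simp
    finally have "(B i *\<^sub>v unit_vec n c) $ r = (\<delta> \<cdot>\<^sub>v unit_vec n c) $ r" by simp
    moreover have "(B i *\<^sub>v unit_vec n c) $ r = B i $$ (r, c)"
      using B[OF i] r c by simp
    moreover have "(\<delta> \<cdot>\<^sub>v unit_vec n c) $ r = (if r = c then \<delta> else 0)"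
      using r c by simp
    ultimately show ?thesis by simp
  qed
  have "block_form n p m M A As Ar T S \<delta>"
  proof
    fix i assume i: "i < M"
    show AsAr: "As i \<in> carrier_mat p p" "Ar i \<in> carrier_mat m p" by (simp_all add: As_def Ar_def)
    show "S * A i * T = four_block_mat (As i) (0\<^sub>m p m) (Ar i) (\<delta> \<cdot>\<^sub>m 1\<^sub>m m)"
    proof (rule eq_matI)
      fix r c
      assume "r < dim_row (four_block_mat (As i) (0\<^sub>m p m) (Ar i) (\<delta> \<cdot>\<^sub>m 1\<^sub>m m))"
        and "c < dim_col (four_block_mat (As i) (0\<^sub>m p m) (Ar i) (\<delta> \<cdot>\<^sub>m 1\<^sub>m m))"
      then have rc: "r < p + m" "c < p + m" by (simp_all add: As_def Ar_def)
      then show "(S * A i * T) $$ (r,c) = four_block_mat (As i) (0\<^sub>m p m) (Ar i) (\<delta> \<cdot>\<^sub>m 1\<^sub>m m) $$ (r,c)"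
        using Bcol[OF i, of r c] pm unfolding B_def[of i, symmetric]
        by (auto simp: As_def Ar_def not_less)
    qed (use S T pm in \<open>simp_all add: As_def Ar_def\<close>)
  qed (use A T S TS ST pm in simp_all)
  then show thesis
    by (rule that[unfolded p_def[symmetric]]) (simp add: iff p_def m_def)
qed

text \<open>Solutions are exactly the trajectories of the family of all convex combinations.\<close>

lemma dt_exponentially_stable:
  assumes A: "\<And>i. i < M \<Longrightarrow> A i \<in> carrier_mat d d"
    and conv: "\<And>w z. dt_weights M w \<Longrightarrow> dt_solution d M A w z \<Longrightarrow> (\<lambda>k. eucl_norm (z k)) \<longlonglongrightarrow> 0"
  shows "\<exists>C q. 0 \<le> C \<and> 0 < q \<and> q < 1 \<and>
    (\<forall>w z. dt_weights M w \<longrightarrow> dt_solution d M A w z \<longrightarrow> (\<forall>k. nrm (z k) \<le> C * q ^ k * nrm (z 0)))"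
proof -
  define R where "R = comb_mat d M A ` simplex_weights M"
  obtain b where b: "0 < b" "\<And>w x. w \<in> simplex_weights M \<Longrightarrow> x \<in> carrier_vec d \<Longrightarrow>
      nrm (comb_mat d M A w *\<^sub>v x) \<le> b * nrm x"
    by (rule comb_mat_bound[where A = A, OF A]) (assumption | rule that)+
  interpret bounded_family d R b
    by unfold_locales (use b in \<open>auto simp: R_def\<close>)
  obtain C q where Cq: "0 \<le> C" "0 < q" "q < 1"
    "\<And>x l. x \<in> carrier_vec d \<Longrightarrow> l \<in> lists R \<Longrightarrow> nrm (run l x) \<le> C * q ^ length l * nrm x"
  proof (rule uniformly_exponentially_stable)
    fix \<sigma> :: "nat \<Rightarrow> real mat" and x :: "real Matrix.vec"
    assume \<sigma>: "\<And>k. \<sigma> k \<in> R" and x: "x \<in> carrier_vec d"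
    have "\<forall>k. \<exists>w. w \<in> simplex_weights M \<and> \<sigma> k = comb_mat d M A w" using \<sigma> by (auto simp: R_def)
    then obtain w where w: "\<And>k. w k \<in> simplex_weights M" "\<And>k. \<sigma> k = comb_mat d M A (w k)" by metis
    define z where "z k = run (map \<sigma> [0..<k]) x" for k
    have "dt_weights M w" using w by (simp add: dt_weights_def)
    moreover have "dt_solution d M A w z" using x by (simp add: dt_solution_def z_def w(2))
    ultimately have "(\<lambda>k. eucl_norm (z k)) \<longlonglongrightarrow> 0" by (rule conv)
    moreover have "z k \<in> carrier_vec d" for k unfolding z_def using \<sigma> x by (intro run_carrier) auto
    ultimately show "(\<lambda>k. nrm (run (map \<sigma> [0..<k]) x)) \<longlonglongrightarrow> 0"
      using eucl_norm_tendsto_iff[of z d sequentially] by (simp add: z_def)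
  qed (rule that)
  have "nrm (z k) \<le> C * q ^ k * nrm (z 0)" if w: "dt_weights M w" and z: "dt_solution d M A w z" for w z k
  proof -
    define l where "l = map (\<lambda>k. comb_mat d M A (w k)) [0..<k]"
    have "z k = run (map (\<lambda>k. comb_mat d M A (w k)) [0..<k]) (z 0)" for k
      using z by (induction k) (simp_all add: dt_solution_def)
    then have zk: "z k = run l (z 0)" unfolding l_def .
    have "l \<in> lists R" "length l = k" using w by (auto simp: l_def R_def dt_weights_def)
    moreover have "z 0 \<in> carrier_vec d" using z by (simp add: dt_solution_def)
    ultimately show ?thesis using Cq(4)[of "z 0" l] by (simp add: zk)
  qed
  then show ?thesis using Cq by blast
qed

text \<open>The \<open>\<epsilon>\<close>-\<open>\<delta>\<close> form of a uniform linear bound;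
  the summand 1 keeps the denominator positive when \<open>C * d = 0\<close>.\<close>

lemma uniform_bound_imp_delta:
  fixes C \<epsilon> :: real
  assumes "0 \<le> C" "0 < \<epsilon>"
  shows "\<exists>\<delta>>0. \<forall>a b. a \<in> carrier_vec d \<and> nrm b \<le> C * nrm a \<and> eucl_norm a < \<delta> \<longrightarrow> eucl_norm b < \<epsilon>"
proof (intro exI[of _ "\<epsilon> / (C * d + 1)"] conjI allI impI)
  show "0 < \<epsilon> / (C * d + 1)" using assms by (simp add: add_nonneg_pos)
  fix a b assume ab: "a \<in> carrier_vec d \<and> nrm b \<le> C * nrm a \<and> eucl_norm a < \<epsilon> / (C * d + 1)"
  have pos: "0 < C * d + 1" using assms by (simp add: add_nonneg_pos)
  have "eucl_norm b \<le> C * nrm a" using ab eucl_norm_le_nrm[of b] by linarith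
  also have "\<dots> \<le> C * (d * eucl_norm a)"
    using ab nrm_le_eucl_norm[of a] assms by (intro mult_left_mono) auto
  also have "\<dots> \<le> (C * d + 1) * eucl_norm a" using eucl_norm_nonneg[of a] by (simp add: algebra_simps)
  also have "\<dots> < \<epsilon>" using ab pos by (simp add: field_simps)
  finally show "eucl_norm b < \<epsilon>" .
qed

text \<open>For these inclusions stability follows from attractivity, since the latter is
  automatically uniform.\<close>

lemma dt_asymp_stable_iff:
  assumes A: "\<And>i. i < M \<Longrightarrow> A i \<in> carrier_mat d d"
  shows "dt_asymp_stable d M A \<longleftrightarrow>
    (\<forall>w z. dt_weights M w \<and> dt_solution d M A w z \<longrightarrow> (\<lambda>k. eucl_norm (z k)) \<longlonglongrightarrow> 0)"
proof
  assume conv: "\<forall>w z. dt_weights M w \<and> dt_solution d M A w z \<longrightarrow> (\<lambda>k. eucl_norm (z k)) \<longlonglongrightarrow> 0"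
  have "\<exists>C q. 0 \<le> C \<and> 0 < q \<and> q < 1 \<and>
    (\<forall>w z. dt_weights M w \<longrightarrow> dt_solution d M A w z \<longrightarrow> (\<forall>k. nrm (z k) \<le> C * q ^ k * nrm (z 0)))"
    by (rule dt_exponentially_stable[OF A]) (simp_all add: conv)
  then obtain C q where Cq: "0 \<le> C" "0 < q" "q < 1"
    "\<And>w z k. dt_weights M w \<Longrightarrow> dt_solution d M A w z \<Longrightarrow> nrm (z k) \<le> C * q ^ k * nrm (z 0)"
    by blast
  have bound: "nrm (z k) \<le> C * nrm (z 0)" if "dt_weights M w" "dt_solution d M A w z" for w z k
  proof -
    have "C * (q ^ k * nrm (z 0)) \<le> C * (1 * nrm (z 0))"
      using Cq nrm_nonneg by (intro mult_left_mono mult_right_mono power_le_one) auto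
    then show ?thesis using Cq(4)[OF that, of k] by (simp add: mult.assoc)
  qed
  have "\<exists>\<delta>>0. \<forall>w z. dt_weights M w \<and> dt_solution d M A w z \<and> eucl_norm (z 0) < \<delta> \<longrightarrow>
        (\<forall>k. eucl_norm (z k) < \<epsilon>)" if "\<epsilon> > 0" for \<epsilon>
  proof -
    obtain \<delta> where \<delta>: "\<delta> > 0"
      "\<And>a b. a \<in> carrier_vec d \<and> nrm b \<le> C * nrm a \<and> eucl_norm a < \<delta> \<Longrightarrow> eucl_norm b < \<epsilon>"
      using uniform_bound_imp_delta[OF Cq(1) \<open>\<epsilon> > 0\<close>, of d] by blast
    show ?thesis
    proof (intro exI[of _ \<delta>] conjI allI impI \<delta>(1))
      fix w z k assume wz: "dt_weights M w \<and> dt_solution d M A w z \<and> eucl_norm (z 0) < \<delta>"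
      then show "eucl_norm (z k) < \<epsilon>"
        using \<delta>(2)[of "z 0" "z k"] bound[of w z k] by (simp add: dt_solution_def)
    qed
  qed
  then show "dt_asymp_stable d M A" using conv by (simp add: dt_asymp_stable_def)
qed (simp add: dt_asymp_stable_def)

context block_form
begin

lemma dt_first_solution:
  assumes x: "dt_solution n M A w x"
  shows "dt_solution p M As w (\<lambda>k. vec_first (S *\<^sub>v x k) p)"
proof -
  have xc: "x k \<in> carrier_vec n" for k
    by (induction k) (use x in \<open>auto simp: dt_solution_def intro!: mult_mat_vec_carrier[OF comb_mat_carrier]\<close>)
  have "vec_first (S *\<^sub>v x (Suc k)) p = comb_mat p M As (w k) *\<^sub>v vec_first (S *\<^sub>v x k) p" for k
  proof (rule eq_vecI)
    fix j assume "j < dim_vec (comb_mat p M As (w k) *\<^sub>v vec_first (S *\<^sub>v x k) p)"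
    then have j: "j < p" by (simp add: comb_mat_def)
    have "x (Suc k) = comb_mat n M A (w k) *\<^sub>v x k" using x by (simp add: dt_solution_def)
    then show "vec_first (S *\<^sub>v x (Suc k)) p $ j = (comb_mat p M As (w k) *\<^sub>v vec_first (S *\<^sub>v x k) p) $ j"
      using conj_first[OF xc j, of "w k" k] j by (simp add: vec_first_def del: index_mult_mat_vec)
  qed (simp add: comb_mat_def)
  then show ?thesis by (simp add: dt_solution_def)
qed

text \<open>The transversal component decays geometrically, uniformly in the weights, and the
  increments of the other component are bounded by it, so the latter converges too.\<close>

lemma dt_strongly_convergent_if_stable:
  assumes \<delta>: "\<delta> = 1" and stable: "dt_asymp_stable p M As"
  shows "dt_strongly_convergent n M A {x \<in> carrier_vec n. \<forall>i<M. A i *\<^sub>v x = \<delta> \<cdot>\<^sub>v x}"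
  unfolding dt_strongly_convergent_def
proof (intro allI impI, elim conjE)
  fix w x assume w: "dt_weights M w" and x: "dt_solution n M A w x"
  have xc: "x k \<in> carrier_vec n" for k
    by (induction k) (use x in \<open>auto simp: dt_solution_def intro!: mult_mat_vec_carrier[OF comb_mat_carrier]\<close>)
  define z where "z k = vec_first (S *\<^sub>v x k) p" for k
  have zsol: "dt_solution p M As w z" unfolding z_def by (rule dt_first_solution[OF x])
  have "\<exists>C q. 0 \<le> C \<and> 0 < q \<and> q < 1 \<and>
    (\<forall>w z. dt_weights M w \<longrightarrow> dt_solution p M As w z \<longrightarrow> (\<forall>k. nrm (z k) \<le> C * q ^ k * nrm (z 0)))"
    by (rule dt_exponentially_stable[OF As]) (use stable in \<open>simp_all add: dt_asymp_stable_def\<close>)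
  then obtain C q where Cq: "0 \<le> C" "0 < q" "q < 1"
    "\<And>w z k. dt_weights M w \<Longrightarrow> dt_solution p M As w z \<Longrightarrow> nrm (z k) \<le> C * q ^ k * nrm (z 0)"
    by blast
  obtain b where b: "0 \<le> b"
    "\<And>w x. w \<in> simplex_weights M \<Longrightarrow> x \<in> carrier_vec p \<Longrightarrow> nrm (comb_act m M Ar w x) \<le> b * nrm x"
    by (rule comb_act_bound[where B = Ar, OF Ar]) (assumption | rule that)+
  have zc: "z k \<in> carrier_vec p" for k by (simp add: z_def)
  have wk: "w k \<in> simplex_weights M" for k using w by (simp add: dt_weights_def)
  have "(\<lambda>k. eucl_norm (z k)) \<longlonglongrightarrow> 0" using stable w zsol by (simp add: dt_asymp_stable_def)
  then have zlim: "(\<lambda>k. nrm (z k)) \<longlonglongrightarrow> 0"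
    using eucl_norm_tendsto_iff[of z p sequentially] zc by simp
  have "\<exists>xb\<in>carrier_vec n. (\<forall>i<M. A i *\<^sub>v xb = \<delta> \<cdot>\<^sub>v xb) \<and> ((\<lambda>t. eucl_norm (x t - xb)) \<longlonglongrightarrow> 0)"
  proof (rule converges_to_fixed)
    fix j assume j: "j < p"
    have "norm ((S *\<^sub>v x k) $ j) \<le> nrm (z k)" for k
      using abs_index_le_nrm[of j "z k"] j by (simp add: z_def vec_first_def)
    then show "(\<lambda>k. (S *\<^sub>v x k) $ j) \<longlonglongrightarrow> 0"
      by (intro Lim_null_comparison[OF _ zlim] always_eventually allI)
  next
    fix j assume j: "j < m"
    have "\<bar>(S *\<^sub>v x (Suc k)) $ (p + j) - (S *\<^sub>v x k) $ (p + j)\<bar> \<le> (b * C * nrm (z 0)) * q ^ k" for k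
    proof -
      have "x (Suc k) = comb_mat n M A (w k) *\<^sub>v x k" using x by (simp add: dt_solution_def)
      then have "(S *\<^sub>v x (Suc k)) $ (p + j) - (S *\<^sub>v x k) $ (p + j) = comb_act m M Ar (w k) (z k) $ j"
        using conj_last[OF xc j wk, of k k] \<delta> by (simp add: z_def)
      also have "\<bar>\<dots>\<bar> \<le> nrm (comb_act m M Ar (w k) (z k))"
        using abs_index_le_nrm[of j "comb_act m M Ar (w k) (z k)"] j by (simp add: comb_act_def)
      also have "\<dots> \<le> b * nrm (z k)" by (rule b(2)[OF wk zc])
      also have "\<dots> \<le> b * (C * q ^ k * nrm (z 0))"
        using Cq(4)[OF w zsol] b(1) by (intro mult_left_mono)
      finally show ?thesis by (simp add: mult_ac)
    qed
    then show "\<exists>l. (\<lambda>k. (S *\<^sub>v x k) $ (p + j)) \<longlonglongrightarrow> l"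
      using Cq by (intro tendsto_of_geometric_increments)
  qed (use xc in simp)
  then show "\<exists>xb\<in>{x \<in> carrier_vec n. \<forall>i<M. A i *\<^sub>v x = \<delta> \<cdot>\<^sub>v x}. (\<lambda>k. eucl_norm (x k - xb)) \<longlonglongrightarrow> 0"
    by blast
qed

text \<open>Every solution of the \<open>As\<close>-inclusion is the transversal component of a
  solution of the full inclusion. The limit of the latter lies in \<open>X\<close>, so that its
  transversal component is zero.\<close>

lemma dt_stable_if_strongly_convergent:
  assumes conv: "dt_strongly_convergent n M A X"
    and X: "\<And>x. x \<in> X \<Longrightarrow> x \<in> carrier_vec n \<and> (\<forall>j<p. (S *\<^sub>v x) $ j = 0)"
  shows "dt_asymp_stable p M As"
  unfolding dt_asymp_stable_iff[of M As p, OF As, simplified]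
proof (intro allI impI, elim conjE)
  fix w z assume w: "dt_weights M w" and z: "dt_solution p M As w z"
  have z0: "z 0 \<in> carrier_vec p" using z by (simp add: dt_solution_def)
  define x where "x = rec_nat (T *\<^sub>v (z 0 @\<^sub>v 0\<^sub>v m)) (\<lambda>k v. comb_mat n M A (w k) *\<^sub>v v)"
  have z0': "z 0 @\<^sub>v 0\<^sub>v m \<in> carrier_vec n" using z0 dims by simp
  have x: "dt_solution n M A w x" using z0' T by (simp add: dt_solution_def x_def)
  have xc: "x k \<in> carrier_vec n" for k
    by (induction k) (use x in \<open>auto simp: dt_solution_def intro!: mult_mat_vec_carrier[OF comb_mat_carrier]\<close>)
  have zx: "z k = vec_first (S *\<^sub>v x k) p" for k
  proof (induction k)
    case 0
    then show ?case using STx[OF z0'] z0 by (auto simp: x_def vec_first_def)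
  next
    case (Suc k)
    then show ?case using dt_first_solution[OF x] z by (simp add: dt_solution_def)
  qed
  obtain xb where xb: "xb \<in> X" "(\<lambda>k. eucl_norm (x k - xb)) \<longlonglongrightarrow> 0"
    using conv w x by (auto simp: dt_strongly_convergent_def)
  have "(\<lambda>k. nrm (vec_first (S *\<^sub>v x k) p)) \<longlonglongrightarrow> 0"
    by (rule first_tendsto_zero[OF _ _ _ xb(2)]) (use xc X[OF xb(1)] in auto)
  then show "(\<lambda>k. eucl_norm (z k)) \<longlonglongrightarrow> 0"
    using eucl_norm_tendsto_iff[of z p sequentially] by (simp add: zx)
qed

end

section \<open>Linear Caratheodory equations\<close>

text \<open>\<open>x\<close> is an indefinite integral of \<open>f\<close> on \<open>{0..T}\<close>.
  Taking \<open>f s = B s *\<^sub>v x s\<close> gives the Caratheodory solutions of a linear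
  equation; keeping \<open>f\<close> separate makes linear changes of coordinates and restriction to
  some of the components immediate.\<close>

definition primitive :: "nat \<Rightarrow> (real \<Rightarrow> real Matrix.vec) \<Rightarrow> real \<Rightarrow> (real \<Rightarrow> real Matrix.vec) \<Rightarrow> bool" where
  "primitive d f T x \<longleftrightarrow>
     (\<forall>t\<in>{0..T}. x t \<in> carrier_vec d) \<and>
     (\<forall>t\<in>{0..T}. \<forall>j<d. (\<lambda>s. f s $ j) absolutely_integrable_on {0..t} \<and>
        x t $ j = x 0 $ j + integral {0..t} (\<lambda>s. f s $ j))"

lemma primitiveD:
  assumes "primitive d f T x" "0 \<le> t" "t \<le> T"
  shows "x t \<in> carrier_vec d"
    and "j < d \<Longrightarrow> (\<lambda>s. f s $ j) absolutely_integrable_on {0..t}"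
    and "j < d \<Longrightarrow> x t $ j = x 0 $ j + integral {0..t} (\<lambda>s. f s $ j)"
proof -
  have "t \<in> {0..T}" using assms by simp
  then show "x t \<in> carrier_vec d"
    and "j < d \<Longrightarrow> (\<lambda>s. f s $ j) absolutely_integrable_on {0..t}"
    and "j < d \<Longrightarrow> x t $ j = x 0 $ j + integral {0..t} (\<lambda>s. f s $ j)"
    using assms(1) unfolding primitive_def by blast+
qed

lemma primitive_integrable:
  assumes "primitive d f T x" "j < d" "0 \<le> s" "s \<le> t" "t \<le> T"
  shows "(\<lambda>s. f s $ j) absolutely_integrable_on {s..t}" "(\<lambda>s. f s $ j) integrable_on {s..t}"
proof -
  have "(\<lambda>s. f s $ j) absolutely_integrable_on {0..t}" using primitiveD(2)[OF assms(1) _ assms(5,2)] assms by simp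
  then show "(\<lambda>s. f s $ j) absolutely_integrable_on {s..t}"
    by (rule absolutely_integrable_on_subinterval) (use assms in auto)
  then show "(\<lambda>s. f s $ j) integrable_on {s..t}" by (simp add: absolutely_integrable_on_def)
qed

lemma primitive_increment:
  assumes x: "primitive d f T x" and "j < d" "0 \<le> s" "s \<le> t" "t \<le> T"
  shows "x t $ j = x s $ j + integral {s..t} (\<lambda>s. f s $ j)"
proof -
  have "integral {0..s} (\<lambda>s. f s $ j) + integral {s..t} (\<lambda>s. f s $ j) = integral {0..t} (\<lambda>s. f s $ j)"
    by (rule Henstock_Kurzweil_Integration.integral_combine) (use assms primitive_integrable(2)[OF x] in auto)
  then show ?thesis
    using primitiveD(3)[OF x _ _ assms(2), of s] primitiveD(3)[OF x _ _ assms(2), of t] assms by simp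
qed

lemma primitive_continuous:
  assumes "primitive d f T x" "j < d"
  shows "continuous_on {0..T} (\<lambda>t. x t $ j)"
proof (cases "0 \<le> T")
  case True
  have "continuous_on {0..T} (\<lambda>t. x 0 $ j + integral {0..t} (\<lambda>s. f s $ j))"
    by (intro continuous_intros indefinite_integral_continuous_1 primitive_integrable(2)[OF assms]) (use True in auto)
  then show ?thesis
    by (rule continuous_on_eq) (rule primitiveD(3)[OF assms(1) _ _ assms(2), symmetric]; simp)
qed simp

text \<open>The integrands may differ at the end point \<open>T\<close>, a null set. This is what is
  needed where two weight signals are joined at time \<open>T\<close>.\<close>

lemma primitive_transfer:
  assumes x: "primitive d f T x" and "p \<le> d"
    and g: "\<And>s j. 0 \<le> s \<Longrightarrow> s < T \<Longrightarrow> j < p \<Longrightarrow> g s $ j = f s $ j"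
    and y: "\<And>t. 0 \<le> t \<Longrightarrow> t \<le> T \<Longrightarrow> y t \<in> carrier_vec p"
      "\<And>t j. 0 \<le> t \<Longrightarrow> t \<le> T \<Longrightarrow> j < p \<Longrightarrow> y t $ j = x t $ j"
  shows "primitive p g T y"
  unfolding primitive_def
proof (intro conjI ballI allI impI)
  fix t j assume t: "t \<in> {0..T}" and j: "j < p"
  then have jd: "j < d" using assms by simp
  have eq: "g s $ j = f s $ j" if "s \<in> {0..t} - {T}" for s
    using that t g[OF _ _ j, of s] by auto
  have "(\<lambda>s. f s $ j) absolutely_integrable_on {0..t}" using primitiveD(2)[OF x _ _ jd] t by simp
  then show "(\<lambda>s. g s $ j) absolutely_integrable_on {0..t}"
    by (rule absolutely_integrable_spike[of _ _ "{T}"]) (use eq in auto)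
  have "integral {0..t} (\<lambda>s. f s $ j) = integral {0..t} (\<lambda>s. g s $ j)"
    by (rule integral_spike[of "{T}"]) (use eq in auto)
  moreover have "x t $ j = x 0 $ j + integral {0..t} (\<lambda>s. f s $ j)"
    using t by (intro primitiveD(3)[OF x _ _ jd]) auto
  moreover have "y t $ j = x t $ j" "y 0 $ j = x 0 $ j" using t y(2)[OF _ _ j] by auto
  ultimately show "y t $ j = y 0 $ j + integral {0..t} (\<lambda>s. g s $ j)" by presburger
qed (use y(1) in simp)

lemma primitive_mult_mat:
  assumes x: "primitive d f T x" and Q: "Q \<in> carrier_mat r d"
    and f: "\<And>s. f s \<in> carrier_vec d"
  shows "primitive r (\<lambda>s. Q *\<^sub>v f s) T (\<lambda>t. Q *\<^sub>v x t)"
  unfolding primitive_def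
proof (intro conjI ballI allI impI)
  fix t j assume t: "t \<in> {0..T}" and j: "j < r"
  have idx: "(Q *\<^sub>v v) $ j = (\<Sum>c<d. Q $$ (j,c) * v $ c)" if "v \<in> carrier_vec d" for v
    using that Q j by (simp add: scalar_prod_def atLeast0LessThan)
  have ai: "(\<lambda>s. Q $$ (j,c) * f s $ c) absolutely_integrable_on {0..t}" if "c < d" for c
    using primitiveD(2)[OF x _ _ that, of t] t by (intro set_integrable_mult_right) simp
  show "(\<lambda>s. (Q *\<^sub>v f s) $ j) absolutely_integrable_on {0..t}"
    unfolding idx[OF f] by (rule absolutely_integrable_sum) (use ai in auto)
  have "integral {0..t} (\<lambda>s. (Q *\<^sub>v f s) $ j) = (\<Sum>c<d. integral {0..t} (\<lambda>s. Q $$ (j,c) * f s $ c))"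
    unfolding idx[OF f]
    by (rule Henstock_Kurzweil_Integration.integral_sum)
       (use ai in \<open>auto simp: absolutely_integrable_on_def\<close>)
  also have "\<dots> = (\<Sum>c<d. Q $$ (j,c) * (x t $ c - x 0 $ c))"
  proof (rule sum.cong[OF refl])
    fix c assume "c \<in> {..<d}"
    then have "x t $ c = x 0 $ c + integral {0..t} (\<lambda>s. f s $ c)"
      using t by (intro primitiveD(3)[OF x]) auto
    then have "x t $ c - x 0 $ c = integral {0..t} (\<lambda>s. f s $ c)" by linarith
    then show "integral {0..t} (\<lambda>s. Q $$ (j,c) * f s $ c) = Q $$ (j,c) * (x t $ c - x 0 $ c)"
      by (simp only: Henstock_Kurzweil_Integration.integral_mult_right)
  qed
  also have "\<dots> = (Q *\<^sub>v x t) $ j - (Q *\<^sub>v x 0) $ j"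
    using idx[of "x t"] idx[of "x 0"] primitiveD(1)[OF x] t
    by (simp add: right_diff_distrib sum_subtractf del: index_mult_mat_vec)
  finally show "(Q *\<^sub>v x t) $ j = (Q *\<^sub>v x 0) $ j + integral {0..t} (\<lambda>s. (Q *\<^sub>v f s) $ j)" by simp
qed (use mult_mat_vec_carrier[OF Q primitiveD(1)[OF x]] in simp)

lemma absolutely_integrable_shift:
  fixes f :: "real \<Rightarrow> real"
  assumes "f absolutely_integrable_on {a + h..b + h}"
  shows "(\<lambda>s. f (s + h)) absolutely_integrable_on {a..b}"
proof -
  have eq: "f \<circ> (+) h = (\<lambda>s. f (s + h))" "(\<lambda>s. norm (f s)) \<circ> (+) h = (\<lambda>s. norm (f (s + h)))"
    by (simp_all only: fun_eq_iff add.commute[of h] comp_apply simp_thms)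
  show ?thesis
    using assms integrable_on_shift_Icc_real[of f h a b]
      integrable_on_shift_Icc_real[of "\<lambda>s. norm (f s)" h a b]
    unfolding absolutely_integrable_on_def eq by blast
qed

lemma primitive_shift:
  assumes x: "primitive d f (T + h) x" and h: "0 \<le> h"
  shows "primitive d (\<lambda>s. f (s + h)) T (\<lambda>t. x (t + h))"
  unfolding primitive_def
proof (intro conjI ballI allI impI)
  fix t j assume t: "t \<in> {0..T}" and j: "j < d"
  show "(\<lambda>s. f (s + h) $ j) absolutely_integrable_on {0..t}"
    by (rule absolutely_integrable_shift[where f = "\<lambda>s. f s $ j"])
       (rule primitive_integrable(1)[OF x j], use t h in auto)
  have "integral {0..t} (\<lambda>s. f (s + h) $ j) = integral {h..t + h} (\<lambda>s. f s $ j)"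
    using integral_shift_Icc_real[of 0 t "\<lambda>s. f s $ j" h] by (simp add: o_def add.commute)
  then show "x (t + h) $ j = x (0 + h) $ j + integral {0..t} (\<lambda>s. f (s + h) $ j)"
    using primitive_increment[OF x j, of h "t + h"] t h by simp
qed (use primitiveD(1)[OF x] h in auto)

lemma has_integral_exp_linear:
  fixes a t :: real
  assumes "a \<noteq> 0" "0 \<le> t"
  shows "((\<lambda>s. exp (a * s)) has_integral (exp (a * t) - 1) / a) {0..t}"
proof -
  have "((\<lambda>s. exp (a * s)) has_integral exp (a * t) / a - exp (a * 0) / a) {0..t}"
  proof (rule fundamental_theorem_of_calculus)
    fix s assume "s \<in> {0..t}"
    have "((\<lambda>s. exp (a * s) / a) has_real_derivative exp (a * s)) (at s within {0..t})"
      using assms by (auto intro!: derivative_eq_intros)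
    then show "((\<lambda>s. exp (a * s) / a) has_vector_derivative exp (a * s)) (at s within {0..t})"
      by (simp add: has_real_derivative_iff_has_vector_derivative)
  qed (use assms in auto)
  then show ?thesis by (simp add: diff_divide_distrib)
qed

lemma continuous_on_nrm:
  assumes "\<And>t. t \<in> S \<Longrightarrow> x t \<in> carrier_vec d" "\<And>j. j < d \<Longrightarrow> continuous_on S (\<lambda>t. x t $ j)"
  shows "continuous_on S (\<lambda>t. nrm (x t))"
proof -
  have "continuous_on S (\<lambda>t. \<Sum>j<d. \<bar>x t $ j\<bar>)" by (intro continuous_intros assms(2)) auto
  then show ?thesis by (rule continuous_on_eq) (use carrier_vecD[OF assms(1)] in \<open>simp add: nrm_def\<close>)
qed

text \<open>A weak form of Gronwall's inequality. Let \<open>K\<close> be the maximum of \<open>nrm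
  (x s) * exp (- 2 * c * s)\<close>. Inserting \<open>nrm (x s) \<le> K * exp (2 * c * s)\<close>
  into the integral equation at the maximiser gives \<open>K \<le> nrm (x 0) + K /
  2\<close>.\<close>

lemma primitive_growth:
  assumes x: "primitive d f T x" and c: "0 < c"
    and f: "\<And>s. f s \<in> carrier_vec d" "\<And>s. 0 \<le> s \<Longrightarrow> s \<le> T \<Longrightarrow> nrm (f s) \<le> c * nrm (x s)"
    and t: "0 \<le> t" "t \<le> T"
  shows "nrm (x t) \<le> 2 * nrm (x 0) * exp (2 * c * t)"
proof -
  have cont: "continuous_on {0..T} (\<lambda>t. nrm (x t) * exp (- (2 * c * t)))"
    by (intro continuous_intros continuous_on_nrm[of _ _ d] primitive_continuous[OF x])
       (use primitiveD(1)[OF x] in auto)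
  obtain r where r: "r \<in> {0..T}" and
    rmax: "\<And>s. s \<in> {0..T} \<Longrightarrow> nrm (x s) * exp (- (2 * c * s)) \<le> nrm (x r) * exp (- (2 * c * r))"
    using continuous_attains_sup[OF _ _ cont] t by auto
  define K where "K = nrm (x r) * exp (- (2 * c * r))"
  have K0: "0 \<le> K" by (simp add: K_def nrm_nonneg)
  have le: "nrm (x s) \<le> K * exp (2 * c * s)" if "s \<in> {0..T}" for s
  proof -
    have "nrm (x s) = nrm (x s) * exp (- (2 * c * s)) * exp (2 * c * s)"
      by (simp add: mult.assoc flip: exp_add)
    also have "\<dots> \<le> K * exp (2 * c * s)" unfolding K_def
      using rmax[OF that] by (intro mult_right_mono) auto
    finally show ?thesis .
  qed
  have xr: "nrm (x r) = K * exp (2 * c * r)"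
    by (simp add: K_def mult.assoc flip: exp_add)
  have ri: "0 \<le> r" "r \<le> T" using r by auto
  have E: "((\<lambda>s. exp (2 * c * s)) has_integral (exp (2 * c * r) - 1) / (2 * c)) {0..r}"
    using has_integral_exp_linear[of "2 * c" r] c ri by simp
  have int: "(\<lambda>s. \<bar>f s $ j\<bar>) integrable_on {0..r}" if "j < d" for j
    using primitiveD(2)[OF x ri that] by (simp add: absolutely_integrable_on_def)
  have "nrm (x r) \<le> (\<Sum>j<d. \<bar>x 0 $ j\<bar> + integral {0..r} (\<lambda>s. \<bar>f s $ j\<bar>))"
  proof -
    have "nrm (x r) = (\<Sum>j<d. \<bar>x r $ j\<bar>)" using primitiveD(1)[OF x ri] by (simp add: nrm_def)
    also have "\<dots> \<le> (\<Sum>j<d. \<bar>x 0 $ j\<bar> + integral {0..r} (\<lambda>s. \<bar>f s $ j\<bar>))"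
    proof (rule sum_mono)
      fix j assume "j \<in> {..<d}"
      then have j: "j < d" by simp
      have "norm (integral {0..r} (\<lambda>s. f s $ j)) \<le> integral {0..r} (\<lambda>s. \<bar>f s $ j\<bar>)"
        by (rule Henstock_Kurzweil_Integration.integral_norm_bound_integral)
           (use int[OF j] primitive_integrable(2)[OF x j _ ri] in auto)
      then show "\<bar>x r $ j\<bar> \<le> \<bar>x 0 $ j\<bar> + integral {0..r} (\<lambda>s. \<bar>f s $ j\<bar>)"
        using primitiveD(3)[OF x ri j] by simp
    qed
    finally show ?thesis .
  qed
  also have "\<dots> = nrm (x 0) + integral {0..r} (\<lambda>s. \<Sum>j<d. \<bar>f s $ j\<bar>)"
  proof -
    have "integral {0..r} (\<lambda>s. \<Sum>j<d. \<bar>f s $ j\<bar>) = (\<Sum>j<d. integral {0..r} (\<lambda>s. \<bar>f s $ j\<bar>))"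
      by (rule Henstock_Kurzweil_Integration.integral_sum) (use int in auto)
    moreover have "dim_vec (x 0) = d" using primitiveD(1)[OF x, of 0] ri by simp
    ultimately show ?thesis by (simp only: sum.distrib nrm_def)
  qed
  also have "integral {0..r} (\<lambda>s. \<Sum>j<d. \<bar>f s $ j\<bar>) \<le> integral {0..r} (\<lambda>s. c * K * exp (2 * c * s))"
  proof (rule integral_le)
    show "(\<lambda>s. \<Sum>j<d. \<bar>f s $ j\<bar>) integrable_on {0..r}" using int by (intro integrable_sum) auto
    show "(\<lambda>s. c * K * exp (2 * c * s)) integrable_on {0..r}"
      using has_integral_integrable[OF E] by (intro integrable_on_mult_right)
    fix s assume s: "s \<in> {0..r}"
    have "(\<Sum>j<d. \<bar>f s $ j\<bar>) = nrm (f s)" using f(1)[of s] by (simp add: nrm_def)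
    also have "\<dots> \<le> c * nrm (x s)" using f(2) s ri by simp
    also have "\<dots> \<le> c * (K * exp (2 * c * s))" using le[of s] s ri c by (intro mult_left_mono) auto
    finally show "(\<Sum>j<d. \<bar>f s $ j\<bar>) \<le> c * K * exp (2 * c * s)" by (simp add: mult.assoc)
  qed
  also have "\<dots> = c * K * ((exp (2 * c * r) - 1) / (2 * c))"
    using integral_unique[OF E] by simp
  also have "\<dots> = K * (exp (2 * c * r) - 1) / 2" using c by (simp add: field_simps)
  finally have "K * exp (2 * c * r) / 2 \<le> nrm (x 0)" using K0 unfolding xr by (simp add: field_simps)
  moreover have "K * 1 \<le> K * exp (2 * c * r)" using K0 c ri by (intro mult_left_mono) auto
  ultimately have "K \<le> 2 * nrm (x 0)" by simp
  then have "K * exp (2 * c * t) \<le> 2 * nrm (x 0) * exp (2 * c * t)" by (intro mult_right_mono) auto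
  moreover have "nrm (x t) \<le> K * exp (2 * c * t)" using le[of t] t by simp
  ultimately show ?thesis by linarith
qed

locale bounded_coefficients =
  fixes d :: nat and B :: "real \<Rightarrow> real mat" and b :: real
  assumes B_carrier: "B s \<in> carrier_mat d d"
    and B_measurable: "i < d \<Longrightarrow> j < d \<Longrightarrow> (\<lambda>s. B s $$ (i,j)) \<in> borel_measurable (lebesgue_on {0..})"
    and B_bound: "0 \<le> s \<Longrightarrow> i < d \<Longrightarrow> j < d \<Longrightarrow> \<bar>B s $$ (i,j)\<bar> \<le> b"
    and b_nonneg: "0 \<le> b"
begin

definition sol :: "real \<Rightarrow> (real \<Rightarrow> real Matrix.vec) \<Rightarrow> bool" where
  "sol T x \<longleftrightarrow> primitive d (\<lambda>s. B s *\<^sub>v x s) T x"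

text \<open>The summand 1 makes this constant positive.\<close>

definition c :: real where "c = real d * b + 1"

lemma c_pos: "0 < c" using b_nonneg by (simp add: c_def add_nonneg_pos)

lemma db_le_c: "real d * b \<le> c" by (simp add: c_def)

lemma B_mult: "v \<in> carrier_vec d \<Longrightarrow> j < d \<Longrightarrow> (B s *\<^sub>v v) $ j = (\<Sum>l<d. B s $$ (j,l) * v $ l)"
  using B_carrier[of s] by (simp add: scalar_prod_def atLeast0LessThan)

lemma B_mult_carrier: "B s *\<^sub>v v \<in> carrier_vec d"
  using carrier_matD(1)[OF B_carrier] by (intro carrier_vecI) simp

lemma nrm_B_mult: "0 \<le> s \<Longrightarrow> v \<in> carrier_vec d \<Longrightarrow> nrm (B s *\<^sub>v v) \<le> c * nrm v"
proof -
  assume s: "0 \<le> s" and v: "v \<in> carrier_vec d"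
  have "nrm (B s *\<^sub>v v) \<le> real d * b * nrm v"
    using nrm_mult_mat_vec_le[OF B_carrier v B_bound[OF s]] by simp
  also have "\<dots> \<le> c * nrm v" by (intro mult_right_mono db_le_c nrm_nonneg)
  finally show ?thesis .
qed

lemma growth:
  assumes "sol T x" "0 \<le> t" "t \<le> T"
  shows "nrm (x t) \<le> 2 * nrm (x 0) * exp (2 * c * t)"
  using assms(1) unfolding sol_def
  by (rule primitive_growth[OF _ c_pos B_mult_carrier nrm_B_mult])
     (use assms primitiveD(1)[of d _ T x] in \<open>auto simp: sol_def\<close>)

lemma integrand_integrable:
  assumes Y: "\<And>l. l < d \<Longrightarrow> continuous_on {0..t} (\<lambda>s. Y s l)" and j: "j < d"
  shows "(\<lambda>s. \<Sum>l<d. B s $$ (j,l) * Y s l) absolutely_integrable_on {0..t}"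
proof (rule absolutely_integrable_sum)
  fix l assume "l \<in> {..<d}"
  then have l: "l < d" by simp
  show "(\<lambda>s. B s $$ (j,l) * Y s l) absolutely_integrable_on {0..t}"
  proof (rule measurable_bounded_by_integrable_imp_absolutely_integrable)
    have "(\<lambda>s. B s $$ (j,l)) \<in> borel_measurable (lebesgue_on {0..t})"
      by (rule measurable_restrict_mono[OF B_measurable[OF j l]]) auto
    moreover have "(\<lambda>s. Y s l) \<in> borel_measurable (lebesgue_on {0..t})"
      by (rule continuous_imp_measurable_on_sets_lebesgue[OF Y[OF l]]) simp
    ultimately show "(\<lambda>s. B s $$ (j,l) * Y s l) \<in> borel_measurable (lebesgue_on {0..t})"
      by (rule borel_measurable_times)
    show "(\<lambda>s. b * \<bar>Y s l\<bar>) integrable_on {0..t}"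
      by (intro integrable_continuous_real continuous_intros Y l)
    show "norm (B s $$ (j,l) * Y s l) \<le> b * \<bar>Y s l\<bar>" if "s \<in> {0..t}" for s
      using B_bound[OF _ j l, of s] that by (auto simp: abs_mult intro!: mult_right_mono)
  qed simp
qed simp

text \<open>Picard iteration from the zero function. Measured with the weight \<open>exp (- 2 * c *
  t)\<close>, each step halves the distance between consecutive iterates, which gives convergence on
  all of \<open>{0..}\<close> at once; dominated convergence passes the integral equation to the
  limit.\<close>

theorem solution_exists:
  assumes x0: "x0 \<in> carrier_vec d"
  shows "\<exists>x. x 0 = x0 \<and> (\<forall>T. sol T x)"
proof -
  \<comment> \<open>the Picard iterates as functions of time and coordinate; iteration 1 is the constant \<open>x0\<close>\<close>
  define X where "X = rec_nat (\<lambda>(t::real) (j::nat). 0::real)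
     (\<lambda>k Y t j. x0 $ j + integral {0..t} (\<lambda>s. \<Sum>l<d. B s $$ (j,l) * Y s l))"
  define F where "F k j s = (\<Sum>l<d. B s $$ (j,l) * X k s l)" for k j s
  have X0: "X 0 t j = 0" for t j by (simp add: X_def)
  have XS: "X (Suc k) t j = x0 $ j + integral {0..t} (F k j)" for k t j
    unfolding F_def by (simp add: X_def)
  have cont: "continuous_on {0..t} (\<lambda>s. X k s j)" if "j < d" for k t j
    using that
  proof (induction k arbitrary: j)
    case 0
    then show ?case by (simp add: X0)
  next
    case (Suc k)
    have "F k j absolutely_integrable_on {0..t}"
      unfolding F_def by (rule integrand_integrable) (use Suc in auto)
    then have "F k j integrable_on {0..t}" by (simp add: absolutely_integrable_on_def)
    then show ?case unfolding XS by (intro continuous_intros indefinite_integral_continuous_1)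
  qed
  have Fai: "F k j absolutely_integrable_on {0..t}" if "j < d" for k j t
    unfolding F_def using cont that by (intro integrand_integrable) auto
  then have Fi: "F k j integrable_on {0..t}" if "j < d" for k j t
    using that by (simp add: absolutely_integrable_on_def)
  define N where "N = nrm x0"
  have N0: "0 \<le> N" by (simp add: N_def nrm_nonneg)
  have step: "(\<Sum>j<d. \<bar>X (Suc k) t j - X k t j\<bar>) \<le> N * (1/2) ^ k * exp (2 * c * t)" if "0 \<le> t" for k t
    using that
  proof (induction k arbitrary: t)
    case 0
    have "F 0 j = (\<lambda>s. 0)" for j by (rule ext) (simp add: F_def X0)
    then have "(\<Sum>j<d. \<bar>X (Suc 0) t j - X 0 t j\<bar>) = N * 1"
      using x0 by (simp add: XS X0 N_def nrm_def)
    also have "\<dots> \<le> N * exp (2 * c * t)" using N0 c_pos 0 by (intro mult_left_mono) auto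
    finally show ?case by simp
  next
    case (Suc k)
    define G where "G = b * (N * (1/2) ^ k)"
    have G0: "0 \<le> G" using b_nonneg N0 by (simp add: G_def)
    have E: "((\<lambda>s. exp (2 * c * s)) has_integral (exp (2 * c * t) - 1) / (2 * c)) {0..t}"
      using has_integral_exp_linear[of "2 * c" t] c_pos Suc.prems by simp
    have "\<bar>X (Suc (Suc k)) t j - X (Suc k) t j\<bar> \<le> G * (exp (2 * c * t) / (2 * c))" if j: "j < d" for j
    proof -
      have "X (Suc (Suc k)) t j - X (Suc k) t j = integral {0..t} (\<lambda>s. F (Suc k) j s - F k j s)"
        unfolding XS using Fi[OF j] by (simp add: Henstock_Kurzweil_Integration.integral_diff)
      also have "norm \<dots> \<le> integral {0..t} (\<lambda>s. G * exp (2 * c * s))"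
      proof (rule Henstock_Kurzweil_Integration.integral_norm_bound_integral)
        show "(\<lambda>s. F (Suc k) j s - F k j s) integrable_on {0..t}"
          using Fi[OF j] by (intro Henstock_Kurzweil_Integration.integrable_diff) auto
        show "(\<lambda>s. G * exp (2 * c * s)) integrable_on {0..t}"
          using has_integral_integrable[OF E] by (intro integrable_on_mult_right)
        fix s assume s: "s \<in> {0..t}"
        have "\<bar>F (Suc k) j s - F k j s\<bar> = \<bar>\<Sum>l<d. B s $$ (j,l) * (X (Suc k) s l - X k s l)\<bar>"
          by (simp add: F_def right_diff_distrib sum_subtractf)
        also have "\<dots> \<le> (\<Sum>l<d. b * \<bar>X (Suc k) s l - X k s l\<bar>)"
          using B_bound[OF _ j, of s] s
          by (intro order_trans[OF sum_abs] sum_mono) (auto simp: abs_mult intro!: mult_right_mono)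
        also have "\<dots> \<le> b * (N * (1/2) ^ k * exp (2 * c * s))"
          using Suc.IH[of s] s b_nonneg by (auto simp flip: sum_distrib_left intro!: mult_left_mono)
        finally show "norm (F (Suc k) j s - F k j s) \<le> G * exp (2 * c * s)" by (simp add: G_def mult_ac)
      qed
      also have "\<dots> = G * ((exp (2 * c * t) - 1) / (2 * c))" using integral_unique[OF E] by simp
      also have "\<dots> \<le> G * (exp (2 * c * t) / (2 * c))"
        using G0 c_pos by (intro mult_left_mono divide_right_mono) auto
      finally show ?thesis by simp
    qed
    then have "(\<Sum>j<d. \<bar>X (Suc (Suc k)) t j - X (Suc k) t j\<bar>) \<le> (\<Sum>j<d. G * (exp (2 * c * t) / (2 * c)))"
      by (intro sum_mono) simp
    also have "\<dots> = (real d * b / c) * (N * (1/2) ^ Suc k * exp (2 * c * t))" by (simp add: G_def)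
    also have "\<dots> \<le> 1 * (N * (1/2) ^ Suc k * exp (2 * c * t))"
      using db_le_c c_pos N0 by (intro mult_right_mono) auto
    finally show ?case by simp
  qed
  have step1: "\<bar>X (Suc k) t j - X k t j\<bar> \<le> N * exp (2 * c * t) * (1/2) ^ k" if "0 \<le> t" "j < d" for k t j
    using step[OF that(1), of k] member_le_sum[of j "{..<d}" "\<lambda>j. \<bar>X (Suc k) t j - X k t j\<bar>"] that(2)
    by (simp add: mult_ac)
  have "\<exists>l. (\<lambda>k. X k t j) \<longlonglongrightarrow> l" if "0 \<le> t" "j < d" for t j
    by (rule tendsto_of_geometric_increments[OF step1[OF that]]) auto
  then obtain Y where Y: "\<And>t j. 0 \<le> t \<Longrightarrow> j < d \<Longrightarrow> (\<lambda>k. X k t j) \<longlonglongrightarrow> Y t j" by metis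
  have Xb: "\<bar>X k t j\<bar> \<le> 2 * N * exp (2 * c * t)" if "0 \<le> t" "j < d" for k t j
  proof -
    have "X k t j = (\<Sum>i<k. X (Suc i) t j - X i t j)" using sum_lessThan_telescope[of "\<lambda>i. X i t j" k] by (simp add: X0)
    also have "\<bar>\<dots>\<bar> \<le> (\<Sum>i<k. N * exp (2 * c * t) * (1/2) ^ i)"
      by (rule order_trans[OF sum_abs]) (intro sum_mono step1 that)
    also have "\<dots> = N * exp (2 * c * t) * (\<Sum>i<k. (1/2) ^ i)" by (simp add: sum_distrib_left)
    also have "\<dots> \<le> N * exp (2 * c * t) * 2"
      using N0 by (intro mult_left_mono) (simp_all add: sum_gp_strict)
    finally show ?thesis by (simp add: mult_ac)
  qed
  \<comment> \<open>a common integrable majorant of the integrands, from \<open>Xb\<close>\<close>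
  define H where "H s = real d * (b * (2 * N * exp (2 * c * s)))" for s
  define Z where "Z j s = (\<Sum>l<d. B s $$ (j,l) * Y s l)" for j s
  have Flim: "(\<lambda>k. F k j s) \<longlonglongrightarrow> Z j s" if "0 \<le> s" "j < d" for j s
    unfolding F_def Z_def using Y[OF that(1)] by (intro tendsto_intros) auto
  have FH: "norm (F k j s) \<le> H s" if "0 \<le> s" "j < d" for k j s
  proof -
    have "\<bar>F k j s\<bar> \<le> (\<Sum>l<d. b * (2 * N * exp (2 * c * s)))"
      unfolding F_def using B_bound[OF that] Xb[OF that(1)] b_nonneg
      by (intro order_trans[OF sum_abs] sum_mono) (auto simp: abs_mult intro!: mult_mono)
    then show ?thesis by (simp add: H_def)
  qed
  have ZH: "norm (Z j s) \<le> H s" if "0 \<le> s" "j < d" for j s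
    by (rule LIMSEQ_le_const2[OF tendsto_norm[OF Flim[OF that]]]) (use FH[OF that] in auto)
  have Hi: "H integrable_on {0..t}" for t
    unfolding H_def by (intro integrable_continuous_real continuous_intros)
  have Zai: "Z j absolutely_integrable_on {0..t}" if "j < d" for j t
    by (rule dominated_convergence_absolutely_integrable[OF Fai[OF that] Hi])
       (use ZH Flim that in auto)
  have Yeq: "Y t j = x0 $ j + integral {0..t} (Z j)" if "0 \<le> t" "j < d" for t j
  proof (rule LIMSEQ_unique)
    show "(\<lambda>k. X (Suc k) t j) \<longlonglongrightarrow> Y t j" by (rule LIMSEQ_Suc[OF Y[OF that]])
    have "(\<lambda>k. integral {0..t} (F k j)) \<longlonglongrightarrow> integral {0..t} (Z j)"
      by (rule dominated_convergence(2)[OF Fi[OF that(2)] Hi]) (use FH Flim that in auto)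
    then show "(\<lambda>k. X (Suc k) t j) \<longlonglongrightarrow> x0 $ j + integral {0..t} (Z j)"
      unfolding XS by (intro tendsto_intros)
  qed
  define x where "x t = Matrix.vec d (Y t)" for t
  have xc: "x t \<in> carrier_vec d" for t by (simp add: x_def)
  have fZ: "(B s *\<^sub>v x s) $ j = Z j s" if "j < d" for s j
    using B_mult[OF xc that] by (simp add: x_def Z_def)
  have "Y 0 j = x0 $ j" if "j < d" for j using Yeq[of 0 j] that by simp
  then have "x 0 = x0" using x0 by (auto simp: x_def)
  moreover have "sol T x" for T
    unfolding sol_def primitive_def
  proof (intro conjI ballI allI impI xc)
    fix t j assume t: "t \<in> {0..T}" and j: "j < d"
    have eq: "(\<lambda>s. (B s *\<^sub>v x s) $ j) = Z j" using fZ[OF j] by (intro ext)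
    show "(\<lambda>s. (B s *\<^sub>v x s) $ j) absolutely_integrable_on {0..t}" unfolding eq by (rule Zai[OF j])
    have "x t $ j = Y t j" using j by (simp add: x_def)
    then show "x t $ j = x 0 $ j + integral {0..t} (\<lambda>s. (B s *\<^sub>v x s) $ j)"
      unfolding eq \<open>x 0 = x0\<close> using Yeq[OF _ j, of t] t by simp
  qed
  ultimately show ?thesis by blast
qed

text \<open>The columns of \<open>\<Phi>\<close> are the values at time \<open>T\<close> of the
  solutions that start in the unit vectors. The difference between a solution and the corresponding
  combination of these starts at zero, and therefore vanishes by the growth estimate.\<close>

lemma transition_exists:
  assumes T: "0 \<le> T"
  shows "\<exists>\<Phi>\<in>carrier_mat d d. \<forall>x. sol T x \<longrightarrow> x T = \<Phi> *\<^sub>v x 0"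
proof -
  have "\<exists>u. u 0 = unit_vec d i \<and> sol T u" for i
    using solution_exists[of "unit_vec d i"] by auto
  then obtain u where u: "\<And>i. u i 0 = unit_vec d i" "\<And>i. sol T (u i)" by metis
  define \<Phi> where "\<Phi> = Matrix.mat d d (\<lambda>(j,i). u i T $ j)"
  have "x T = \<Phi> *\<^sub>v x 0" if x: "sol T x" for x
  proof -
    have xp: "primitive d (\<lambda>s. B s *\<^sub>v x s) T x" using x by (simp add: sol_def)
    have up: "primitive d (\<lambda>s. B s *\<^sub>v u i s) T (u i)" for i using u(2) by (simp add: sol_def)
    have xc: "x t \<in> carrier_vec d" "u i t \<in> carrier_vec d" if "0 \<le> t" "t \<le> T" for i t
      using primitiveD(1)[OF xp that] primitiveD(1)[OF up that] by auto
    define v where "v t = Matrix.vec d (\<lambda>j. x t $ j - (\<Sum>i<d. x 0 $ i * u i t $ j))" for t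
    have vc: "v t \<in> carrier_vec d" for t by (simp add: v_def)
    have v0: "v 0 = 0\<^sub>v d"
    proof (rule eq_vecI)
      fix j assume "j < dim_vec (0\<^sub>v d :: real Matrix.vec)"
      then have j: "j < d" by simp
      have "(\<Sum>i<d. x 0 $ i * u i 0 $ j) = (\<Sum>i<d. if i = j then x 0 $ j else 0)"
        using j by (intro sum.cong) (auto simp: u(1))
      then show "v 0 $ j = 0\<^sub>v d $ j" using j by (simp add: v_def)
    qed (simp add: v_def)
    define g where "g j s = (B s *\<^sub>v x s) $ j - (\<Sum>i<d. x 0 $ i * (B s *\<^sub>v u i s) $ j)" for j s
    have Bv: "(B s *\<^sub>v v s) $ j = g j s" if s: "0 \<le> s" "s \<le> T" and j: "j < d" for s j
    proof -
      have "(B s *\<^sub>v v s) $ j = (\<Sum>l<d. B s $$ (j,l) * x s $ l) -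
          (\<Sum>l<d. \<Sum>i<d. B s $$ (j,l) * (x 0 $ i * u i s $ l))"
        using B_mult[OF vc j] by (simp add: v_def right_diff_distrib sum_subtractf sum_distrib_left)
      also have "(\<Sum>l<d. \<Sum>i<d. B s $$ (j,l) * (x 0 $ i * u i s $ l)) =
          (\<Sum>i<d. x 0 $ i * (\<Sum>l<d. B s $$ (j,l) * u i s $ l))"
        by (subst sum.swap) (simp add: sum_distrib_left mult.left_commute)
      finally show ?thesis using B_mult[OF xc(1)[OF s] j] B_mult[OF xc(2)[OF s] j] by (simp add: g_def)
    qed
    have "primitive d (\<lambda>s. B s *\<^sub>v v s) T v"
      unfolding primitive_def
    proof (intro conjI ballI allI impI vc)
      fix t j assume "t \<in> {0..T}" and j: "j < d"
      then have t: "0 \<le> t" "t \<le> T" by auto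
      have uai: "(\<lambda>s. x 0 $ i * (B s *\<^sub>v u i s) $ j) absolutely_integrable_on {0..t}" for i
        using primitiveD(2)[OF up t j] by (intro set_integrable_mult_right)
      then have usum: "(\<lambda>s. \<Sum>i<d. x 0 $ i * (B s *\<^sub>v u i s) $ j) absolutely_integrable_on {0..t}"
        by (intro absolutely_integrable_sum) auto
      have gai: "g j absolutely_integrable_on {0..t}"
        unfolding g_def by (intro set_integral_diff(1) primitiveD(2)[OF xp t j] usum)
      have eq: "(B s *\<^sub>v v s) $ j = g j s" if "s \<in> {0..t}" for s using Bv[OF _ _ j, of s] that t by simp
      show "(\<lambda>s. (B s *\<^sub>v v s) $ j) absolutely_integrable_on {0..t}"
        by (rule absolutely_integrable_spike[OF gai, of "{}"]) (use eq in auto)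
      have "integral {0..t} (\<lambda>s. (B s *\<^sub>v v s) $ j) = integral {0..t} (g j)"
        by (rule Henstock_Kurzweil_Integration.integral_cong) (rule eq)
      also have "\<dots> = integral {0..t} (\<lambda>s. (B s *\<^sub>v x s) $ j) -
          integral {0..t} (\<lambda>s. \<Sum>i<d. x 0 $ i * (B s *\<^sub>v u i s) $ j)"
        unfolding g_def using primitiveD(2)[OF xp t j] usum
        by (intro Henstock_Kurzweil_Integration.integral_diff) (simp_all add: absolutely_integrable_on_def)
      also have "integral {0..t} (\<lambda>s. \<Sum>i<d. x 0 $ i * (B s *\<^sub>v u i s) $ j) =
          (\<Sum>i<d. integral {0..t} (\<lambda>s. x 0 $ i * (B s *\<^sub>v u i s) $ j))"
        using uai by (intro Henstock_Kurzweil_Integration.integral_sum) (simp_all add: absolutely_integrable_on_def)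
      also have "\<dots> = (\<Sum>i<d. x 0 $ i * (u i t $ j - u i 0 $ j))"
      proof (rule sum.cong[OF refl])
        fix i
        have "u i t $ j = u i 0 $ j + integral {0..t} (\<lambda>s. (B s *\<^sub>v u i s) $ j)"
          by (rule primitiveD(3)[OF up t j])
        then show "integral {0..t} (\<lambda>s. x 0 $ i * (B s *\<^sub>v u i s) $ j) = x 0 $ i * (u i t $ j - u i 0 $ j)"
          by (simp del: index_mult_mat_vec)
      qed
      also have "integral {0..t} (\<lambda>s. (B s *\<^sub>v x s) $ j) = x t $ j - x 0 $ j"
        using primitiveD(3)[OF xp t j] by simp
      finally show "v t $ j = v 0 $ j + integral {0..t} (\<lambda>s. (B s *\<^sub>v v s) $ j)"
        using j by (simp add: v_def right_diff_distrib sum_subtractf del: index_mult_mat_vec)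
    qed
    then have "sol T v" by (simp add: sol_def)
    from growth[OF this T] have "nrm (v T) \<le> 0" by (simp add: v0)
    then have vz: "v T $ j = 0" if "j < d" for j
      using abs_index_le_nrm[of j "v T"] that vc[of T] by auto
    show ?thesis
    proof (rule eq_vecI)
      fix j assume "j < dim_vec (\<Phi> *\<^sub>v x 0)"
      then have j: "j < d" by (simp add: \<Phi>_def)
      have "x T $ j = (\<Sum>i<d. x 0 $ i * u i T $ j)" using vz[OF j] j by (simp add: v_def)
      also have "\<dots> = (\<Phi> *\<^sub>v x 0) $ j"
        using j xc(1)[of 0] T by (simp add: \<Phi>_def scalar_prod_def atLeast0LessThan mult.commute)
      finally show "x T $ j = (\<Phi> *\<^sub>v x 0) $ j" .
    qed (use xc(1)[of T] T in \<open>simp add: \<Phi>_def\<close>)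
  qed
  moreover have "\<Phi> \<in> carrier_mat d d" by (simp add: \<Phi>_def)
  ultimately show ?thesis by blast
qed

corollary solution_unique:
  assumes "sol T x" "sol T y" "x 0 = y 0" "0 \<le> T"
  shows "x T = y T"
  using transition_exists[OF assms(4)] assms by metis

end

section \<open>Continuous time\<close>

lemma ct_solution_iff:
  "ct_solution d M A w x \<longleftrightarrow> (\<forall>T. primitive d (\<lambda>s. comb_mat d M A (w s) *\<^sub>v x s) T x)"
proof -
  have eq: "(set_integrable lebesgue {0..t} f \<and> a = b + set_lebesgue_integral lebesgue {0..t} f) \<longleftrightarrow>
      (f absolutely_integrable_on {0..t} \<and> a = b + integral {0..t} f)" for t a b and f :: "real \<Rightarrow> real"
    using set_lebesgue_integral_eq_integral(2)[of "{0..t}" f] by auto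
  show ?thesis unfolding ct_solution_def primitive_def eq by (meson atLeastAtMost_iff order_refl)
qed

text \<open>For a bounded function, measurability is the same as integrability over unit intervals,
  and integrability is easily transported along translations and changes at end points.\<close>

lemma measurable_iff_integrable_pieces:
  fixes f :: "real \<Rightarrow> real"
  assumes bnd: "\<And>t. 0 \<le> t \<Longrightarrow> \<bar>f t\<bar> \<le> 1"
  shows "f \<in> borel_measurable (lebesgue_on {0..}) \<longleftrightarrow> (\<forall>k::nat. f integrable_on {real k..real k + 1})"
proof
  assume f: "f \<in> borel_measurable (lebesgue_on {0..})"
  show "\<forall>k::nat. f integrable_on {real k..real k + 1}"
  proof
    fix k :: nat
    have "f absolutely_integrable_on {real k..real k + 1}"
    proof (rule measurable_bounded_by_integrable_imp_absolutely_integrable)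
      show "f \<in> borel_measurable (lebesgue_on {real k..real k + 1})"
        by (rule measurable_restrict_mono[OF f]) auto
      show "(\<lambda>_. 1::real) integrable_on {real k..real k + 1}" by (rule integrable_const_ivl)
      show "norm (f t) \<le> 1" if "t \<in> {real k..real k + 1}" for t using bnd[of t] that by simp
    qed simp
    then show "f integrable_on {real k..real k + 1}" by (simp add: absolutely_integrable_on_def)
  qed
next
  assume int: "\<forall>k::nat. f integrable_on {real k..real k + 1}"
  show "f \<in> borel_measurable (lebesgue_on {0..})"
  proof (rule measurable_piecewise_restrict[of "range (\<lambda>k::nat. {real k..real k + 1})"])
    show "countable (range (\<lambda>k::nat. {real k..real k + 1}))" by simp
    have sub: "{real k..real k + 1} \<subseteq> {0..}" for k :: nat by auto
    show "\<Omega> \<inter> space (lebesgue_on {0..}) \<in> sets (lebesgue_on {0..})"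
      if \<Omega>_piece: "\<Omega> \<in> range (\<lambda>k::nat. {real k..real k + 1})" for \<Omega>
    proof -
      obtain k :: nat where \<Omega>: "\<Omega> = {real k..real k + 1}" using \<Omega>_piece by auto
      then have "\<Omega> \<inter> space (lebesgue_on {0..}) = \<Omega>" using sub[of k] by (auto simp: space_restrict_space)
      moreover have "\<Omega> \<in> sets (lebesgue_on {0..})"
        using sub[of k] by (simp add: \<Omega> sets_restrict_space_iff)
      ultimately show ?thesis by simp
    qed
    show "space (lebesgue_on {0..}) \<subseteq> \<Union> (range (\<lambda>k::nat. {real k..real k + 1}))"
    proof
      fix t assume "t \<in> space (lebesgue_on {0::real..})"
      then have t: "0 \<le> t" by (simp add: space_restrict_space)
      then have "t \<in> {real (nat \<lfloor>t\<rfloor>)..real (nat \<lfloor>t\<rfloor>) + 1}" by simp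
      then show "t \<in> \<Union> (range (\<lambda>k::nat. {real k..real k + 1}))" by blast
    qed
    show "f \<in> borel_measurable (restrict_space (lebesgue_on {0..}) \<Omega>)"
      if \<Omega>_piece: "\<Omega> \<in> range (\<lambda>k::nat. {real k..real k + 1})" for \<Omega>
    proof -
      obtain k :: nat where \<Omega>: "\<Omega> = {real k..real k + 1}" using \<Omega>_piece by auto
      have "restrict_space (lebesgue_on {0..}) \<Omega> = lebesgue_on ({0..} \<inter> \<Omega>)"
        by (rule restrict_restrict_space) (simp_all add: \<Omega>)
      also have "{0..} \<inter> \<Omega> = \<Omega>" using sub[of k] \<Omega> by auto
      finally show ?thesis using integrable_imp_measurable[of f "{real k..real k + 1}"] int by (simp add: \<Omega>)
    qed
  qed
qed

lemma integrable_shift_iff: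
  fixes f :: "real \<Rightarrow> real"
  shows "(\<lambda>t. f (t + h)) integrable_on {a..b} \<longleftrightarrow> f integrable_on {a + h..b + h}"
proof -
  have eq: "f \<circ> (+) h = (\<lambda>t. f (t + h))" by (simp only: fun_eq_iff add.commute[of h] comp_apply simp_thms)
  show ?thesis using integrable_on_shift_Icc_real[of f h a b] unfolding eq .
qed

lemma ct_weights_iff:
  "ct_weights M w \<longleftrightarrow> (\<forall>t\<ge>0. w t \<in> simplex_weights M) \<and>
     (\<forall>i<M. \<forall>k::nat. (\<lambda>t. w t $ i) integrable_on {real k..real k + 1})"
proof -
  have "(\<lambda>t. w t $ i) \<in> borel_measurable (lebesgue_on {0..}) \<longleftrightarrow>
      (\<forall>k::nat. (\<lambda>t. w t $ i) integrable_on {real k..real k + 1})"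
    if "\<forall>t\<ge>0. w t \<in> simplex_weights M" "i < M" for i
    by (rule measurable_iff_integrable_pieces)
       (use that simplex_weightsD(2,3)[where i = i and M = M] in auto)
  then show ?thesis unfolding ct_weights_def by blast
qed

lemma ct_weights_shift:
  assumes w: "ct_weights M w"
  shows "ct_weights M (\<lambda>t. w (t + real h))"
  unfolding ct_weights_iff
proof (intro conjI allI impI)
  fix i and k :: nat assume i: "i < M"
  have "(\<lambda>t. w t $ i) integrable_on {real (k + h)..real (k + h) + 1}"
    using w i unfolding ct_weights_iff by blast
  then show "(\<lambda>t. w (t + real h) $ i) integrable_on {real k..real k + 1}"
    using integrable_shift_iff[of "\<lambda>t. w t $ i" "real h" "real k" "real k + 1"]
    by (simp add: add_ac)
qed (use w in \<open>auto simp: ct_weights_def\<close>)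

text \<open>On \<open>{k..<k + 1}\<close> this runs \<open>W k\<close> with its clock reset to
  zero.\<close>

definition splice :: "(nat \<Rightarrow> real \<Rightarrow> 'a) \<Rightarrow> real \<Rightarrow> 'a" where
  "splice W t = W (nat \<lfloor>t\<rfloor>) (t - real (nat \<lfloor>t\<rfloor>))"

lemma splice_add: "0 \<le> s \<Longrightarrow> s < 1 \<Longrightarrow> splice W (s + real k) = W k s"
proof -
  assume s: "0 \<le> s" "s < 1"
  then have "\<lfloor>s + real k\<rfloor> = int k" by linarith
  then show ?thesis by (simp add: splice_def)
qed

lemma ct_weights_splice:
  assumes W: "\<And>k. ct_weights M (W k)"
  shows "ct_weights M (splice W)"
  unfolding ct_weights_iff
proof (intro conjI allI impI)
  fix t :: real assume "0 \<le> t"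
  then have "0 \<le> t - real (nat \<lfloor>t\<rfloor>)" by (simp add: of_nat_nat)
  then show "splice W t \<in> simplex_weights M"
    using W[of "nat \<lfloor>t\<rfloor>"] unfolding splice_def ct_weights_def by blast
next
  fix i and k :: nat assume i: "i < M"
  have "(\<lambda>t. W k t $ i) integrable_on {real 0..real 0 + 1}"
    using W[of k] i unfolding ct_weights_iff by blast
  then have W01: "(\<lambda>t. W k t $ i) integrable_on {0..1}" by simp
  have "(\<lambda>t. splice W (t + real k) $ i) integrable_on {0..1}"
    by (rule integrable_spike[OF W01, of "{1}"]) (auto simp: splice_add)
  then show "(\<lambda>t. splice W t $ i) integrable_on {real k..real k + 1}"
    using integrable_shift_iff[of "\<lambda>t. splice W t $ i" "real k" 0 1] by (simp add: add.commute)
qed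

definition entry_bound :: "nat \<Rightarrow> nat \<Rightarrow> (nat \<Rightarrow> real mat) \<Rightarrow> real" where
  "entry_bound d M A = (\<Sum>i<M. \<Sum>r<d. \<Sum>c<d. \<bar>A i $$ (r, c)\<bar>)"

lemma comb_mat_bounded_coefficients:
  assumes w: "ct_weights M w"
  shows "bounded_coefficients d (\<lambda>s. comb_mat d M A (w s)) (entry_bound d M A)"
proof
  show "0 \<le> entry_bound d M A" by (auto simp: entry_bound_def intro!: sum_nonneg)
  fix r c assume r: "r < d" and c: "c < d"
  have entry: "comb_mat d M A v $$ (r, c) = (\<Sum>i<M. v $ i * A i $$ (r, c))" for v
    using r c by (simp add: comb_mat_def)
  show "(\<lambda>s. comb_mat d M A (w s) $$ (r, c)) \<in> borel_measurable (lebesgue_on {0..})"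
    unfolding entry using w by (intro borel_measurable_sum borel_measurable_times) (auto simp: ct_weights_def)
  fix s :: real assume "0 \<le> s"
  then have ws: "w s \<in> simplex_weights M" using w by (simp add: ct_weights_def)
  have "\<bar>comb_mat d M A (w s) $$ (r, c)\<bar> \<le> (\<Sum>i<M. \<bar>A i $$ (r, c)\<bar>)"
    unfolding entry
  proof (rule order_trans[OF sum_abs], rule sum_mono)
    fix i assume "i \<in> {..<M}"
    then have "\<bar>w s $ i\<bar> \<le> 1" using simplex_weightsD[OF ws] by simp
    then have "\<bar>w s $ i\<bar> * \<bar>A i $$ (r, c)\<bar> \<le> 1 * \<bar>A i $$ (r, c)\<bar>" by (rule mult_right_mono) simp
    then show "\<bar>w s $ i * A i $$ (r, c)\<bar> \<le> \<bar>A i $$ (r, c)\<bar>" by (simp add: abs_mult)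
  qed
  also have "\<dots> \<le> entry_bound d M A"
    unfolding entry_bound_def
  proof (rule sum_mono)
    fix i
    have "\<bar>A i $$ (r, c)\<bar> \<le> (\<Sum>c<d. \<bar>A i $$ (r, c)\<bar>)" using c by (intro member_le_sum) auto
    also have "\<dots> \<le> (\<Sum>r<d. \<Sum>c<d. \<bar>A i $$ (r, c)\<bar>)"
      using r by (intro member_le_sum[of r _ "\<lambda>r. \<Sum>c<d. \<bar>A i $$ (r, c)\<bar>"]) (auto intro: sum_nonneg)
    finally show "\<bar>A i $$ (r, c)\<bar> \<le> (\<Sum>r<d. \<Sum>c<d. \<bar>A i $$ (r, c)\<bar>)" .
  qed
  finally show "\<bar>comb_mat d M A (w s) $$ (r, c)\<bar> \<le> entry_bound d M A" .
qed simp

abbreviation ct_sol :: "nat \<Rightarrow> nat \<Rightarrow> (nat \<Rightarrow> real mat) \<Rightarrow> (real \<Rightarrow> real Matrix.vec) \<Rightarrow> real \<Rightarrow>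
    (real \<Rightarrow> real Matrix.vec) \<Rightarrow> bool" where
  "ct_sol d M A w T x \<equiv> primitive d (\<lambda>s. comb_mat d M A (w s) *\<^sub>v x s) T x"

text \<open>One constant for all weights, because the entries of all convex combinations have a
  common bound.\<close>

lemma ct_growth:
  obtains L where "0 \<le> L" "\<And>w T x t. ct_weights M w \<Longrightarrow> ct_sol d M A w T x \<Longrightarrow> 0 \<le> t \<Longrightarrow> t \<le> T \<Longrightarrow>
      t \<le> 1 \<Longrightarrow> nrm (x t) \<le> L * nrm (x 0)"
proof -
  define e where "e = real d * entry_bound d M A + 1"
  have e0: "0 < e" by (auto simp: e_def entry_bound_def intro!: add_nonneg_pos mult_nonneg_nonneg sum_nonneg)
  have "nrm (x t) \<le> 2 * exp (2 * e) * nrm (x 0)"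
    if w: "ct_weights M w" and x: "ct_sol d M A w T x" and t: "0 \<le> t" "t \<le> T" "t \<le> 1" for w T x t
  proof -
    interpret bounded_coefficients d "\<lambda>s. comb_mat d M A (w s)" "entry_bound d M A"
      by (rule comb_mat_bounded_coefficients[OF w])
    have "nrm (x t) \<le> 2 * nrm (x 0) * exp (2 * e * t)"
      using growth[of T x t] x t by (simp add: sol_def e_def c_def)
    also have "\<dots> \<le> 2 * nrm (x 0) * exp (2 * e)"
      using t e0 nrm_nonneg[of "x 0"] by (intro mult_left_mono) auto
    finally show ?thesis by (simp add: mult_ac)
  qed
  then show thesis using that[of "2 * exp (2 * e)"] by simp
qed

lemma ct_solution_exists:
  assumes "ct_weights M w" "x0 \<in> carrier_vec d"
  obtains x where "x 0 = x0" "ct_solution d M A w x" "\<And>T. ct_sol d M A w T x"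
proof -
  interpret bounded_coefficients d "\<lambda>s. comb_mat d M A (w s)" "entry_bound d M A"
    by (rule comb_mat_bounded_coefficients[OF assms(1)])
  obtain x where "x 0 = x0" "\<forall>T. sol T x" using solution_exists[OF assms(2)] by blast
  then show thesis using that[of x] by (simp add: sol_def ct_solution_iff)
qed

lemma ct_transition_exists:
  assumes "ct_weights M w"
  obtains \<Phi> where "\<Phi> \<in> carrier_mat d d" "\<And>x. ct_sol d M A w 1 x \<Longrightarrow> x 1 = \<Phi> *\<^sub>v x 0"
proof -
  interpret bounded_coefficients d "\<lambda>s. comb_mat d M A (w s)" "entry_bound d M A"
    by (rule comb_mat_bounded_coefficients[OF assms(1)])
  show thesis using transition_exists[of 1] that by (auto simp: sol_def)
qed

lemma ct_solution_unique:
  assumes w: "ct_weights M w" and x: "ct_solution d M A w x" and y: "ct_solution d M A w y"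
    and "x 0 = y 0" "0 \<le> t"
  shows "x t = y t"
proof -
  interpret bounded_coefficients d "\<lambda>s. comb_mat d M A (w s)" "entry_bound d M A"
    by (rule comb_mat_bounded_coefficients[OF w])
  show ?thesis by (rule solution_unique) (use assms in \<open>simp_all add: sol_def ct_solution_iff\<close>)
qed

text \<open>Sampling at integer times reduces this to products of matrices: \<open>R\<close> is the
  set of all transition matrices over unit time. Each solution, sampled, is a trajectory of
  \<open>R\<close> by translation of its weights, and each sequence in \<open>R\<close> is realised
  by one measurable signal, obtained by splicing. The growth estimate bounds \<open>R\<close> and
  covers the time between the samples.\<close>

lemma ct_exponentially_stable:
  assumes conv: "\<And>w z. ct_weights M w \<Longrightarrow> ct_solution d M A w z \<Longrightarrow> ((\<lambda>t. eucl_norm (z t)) \<longlongrightarrow> 0) at_top"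
  shows "\<exists>C q. 0 \<le> C \<and> 0 < q \<and> q < 1 \<and>
    (\<forall>w z. ct_weights M w \<longrightarrow> ct_solution d M A w z \<longrightarrow>
       (\<forall>t\<ge>0. nrm (z t) \<le> C * q ^ nat \<lfloor>t\<rfloor> * nrm (z 0)))"
proof -
  obtain L where L: "0 \<le> L" "\<And>w T x t. ct_weights M w \<Longrightarrow> ct_sol d M A w T x \<Longrightarrow> 0 \<le> t \<Longrightarrow> t \<le> T \<Longrightarrow>
      t \<le> 1 \<Longrightarrow> nrm (x t) \<le> L * nrm (x 0)"
    by (rule ct_growth) (assumption | rule that)+
  define R where "R = {\<Phi> \<in> carrier_mat d d. \<exists>w. ct_weights M w \<and>
      (\<forall>x. ct_sol d M A w 1 x \<longrightarrow> x 1 = \<Phi> *\<^sub>v x 0)}"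
  interpret bounded_family d R L
  proof
    show "\<Phi> \<in> carrier_mat d d" if "\<Phi> \<in> R" for \<Phi> using that by (simp add: R_def)
    show "nrm (\<Phi> *\<^sub>v x0) \<le> L * nrm x0" if \<Phi>: "\<Phi> \<in> R" and x0: "x0 \<in> carrier_vec d" for \<Phi> x0
    proof -
      obtain w where w: "ct_weights M w" "\<forall>x. ct_sol d M A w 1 x \<longrightarrow> x 1 = \<Phi> *\<^sub>v x 0"
        using \<Phi> by (auto simp: R_def)
      obtain x where x: "x 0 = x0" "\<And>T. ct_sol d M A w T x" using ct_solution_exists[OF w(1) x0] by metis
      then show ?thesis using L(2)[OF w(1) x(2), of 1 1] w(2) by auto
    qed
  qed (rule L(1))
  obtain C q where Cq: "0 \<le> C" "0 < q" "q < 1"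
    "\<And>x l. x \<in> carrier_vec d \<Longrightarrow> l \<in> lists R \<Longrightarrow> nrm (run l x) \<le> C * q ^ length l * nrm x"
  proof (rule uniformly_exponentially_stable)
    fix \<sigma> :: "nat \<Rightarrow> real mat" and x0 :: "real Matrix.vec"
    assume \<sigma>: "\<And>k. \<sigma> k \<in> R" and x0: "x0 \<in> carrier_vec d"
    have "\<forall>k. \<exists>w. ct_weights M w \<and> (\<forall>x. ct_sol d M A w 1 x \<longrightarrow> x 1 = \<sigma> k *\<^sub>v x 0)"
      using \<sigma> by (auto simp: R_def)
    then obtain W where W: "\<And>k. ct_weights M (W k)"
      "\<And>k x. ct_sol d M A (W k) 1 x \<Longrightarrow> x 1 = \<sigma> k *\<^sub>v x 0" by metis
    have ws: "ct_weights M (splice W)" by (rule ct_weights_splice[OF W(1)])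
    obtain x where x: "x 0 = x0" "ct_solution d M A (splice W) x" "\<And>T. ct_sol d M A (splice W) T x"
      using ct_solution_exists[OF ws x0] by metis
    have xc: "x t \<in> carrier_vec d" if "0 \<le> t" for t using x(2) that by (simp add: ct_solution_def)
    have step: "x (1 + real k) = \<sigma> k *\<^sub>v x (real k)" for k
    proof -
      have "ct_sol d M A (\<lambda>t. splice W (t + real k)) 1 (\<lambda>t. x (t + real k))"
        using primitive_shift[OF x(3)[of "1 + real k"]] by simp
      then have "ct_sol d M A (W k) 1 (\<lambda>t. x (t + real k))"
        by (rule primitive_transfer) (use xc splice_add[of _ W k] in auto)
      from W(2)[OF this] show ?thesis by simp
    qed
    have run: "x (real k) = run (map \<sigma> [0..<k]) x0" for k
    proof (induction k)
      case (Suc k)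
      then show ?case using step[of k] by (simp add: add.commute)
    qed (simp add: x(1))
    have "((\<lambda>t. eucl_norm (x t)) \<longlongrightarrow> 0) at_top" by (rule conv[OF ws x(2)])
    then have "(\<lambda>k. eucl_norm (x (real k))) \<longlonglongrightarrow> 0"
      by (rule filterlim_compose) (rule filterlim_real_sequentially)
    moreover have "eventually (\<lambda>k. x (real k) \<in> carrier_vec d) sequentially" using xc by simp
    ultimately have "(\<lambda>k. nrm (x (real k))) \<longlonglongrightarrow> 0" 
      using eucl_norm_tendsto_iff[of "\<lambda>k. x (real k)" d sequentially] by blast
    then show "(\<lambda>k. nrm (run (map \<sigma> [0..<k]) x0)) \<longlonglongrightarrow> 0" by (simp only: run)
  qed (rule that)
  have "nrm (z t) \<le> (L * C) * q ^ nat \<lfloor>t\<rfloor> * nrm (z 0)"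
    if w: "ct_weights M w" and z: "ct_solution d M A w z" and t: "0 \<le> t" for w z t
  proof -
    have zs: "ct_sol d M A (\<lambda>t. w (t + real k)) 1 (\<lambda>t. z (t + real k))" for k
    proof -
      have "ct_sol d M A w (1 + real k) z" using z by (simp add: ct_solution_iff)
      from primitive_shift[OF this] show ?thesis by simp
    qed
    have "\<exists>\<Phi>\<in>R. z (real (Suc k)) = \<Phi> *\<^sub>v z (real k)" for k
    proof -
      obtain \<Phi> where \<Phi>: "\<Phi> \<in> carrier_mat d d"
        "\<And>x. ct_sol d M A (\<lambda>t. w (t + real k)) 1 x \<Longrightarrow> x 1 = \<Phi> *\<^sub>v x 0"
        using ct_transition_exists[OF ct_weights_shift[OF w, of k]] by metis
      then have "\<Phi> \<in> R" using ct_weights_shift[OF w, of k] by (auto simp: R_def)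
      then show ?thesis using \<Phi>(2)[OF zs] by (intro bexI[of _ \<Phi>]) simp_all
    qed
    then obtain \<sigma> where \<sigma>: "\<And>k. \<sigma> k \<in> R" "\<And>k. z (real (Suc k)) = \<sigma> k *\<^sub>v z (real k)" by metis
    define k where "k = nat \<lfloor>t\<rfloor>"
    have "z (real k) = run (map \<sigma> [0..<k]) (z 0)" for k
      by (induction k) (simp_all add: \<sigma>(2) del: of_nat_Suc)
    note zk = this[of k]
    have "nrm (z (real k)) \<le> C * q ^ k * nrm (z 0)"
    proof -
      have "z 0 \<in> carrier_vec d" using z by (simp add: ct_solution_def)
      moreover have "map \<sigma> [0..<k] \<in> lists R" using \<sigma>(1) by auto
      ultimately have "nrm (run (map \<sigma> [0..<k]) (z 0)) \<le> C * q ^ length (map \<sigma> [0..<k]) * nrm (z 0)" by (rule Cq(4))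
      then show ?thesis using zk by simp
    qed
    then have "L * nrm (z (real k)) \<le> L * (C * q ^ k * nrm (z 0))" using L(1) by (rule mult_left_mono)
    moreover have "nrm (z t) \<le> L * nrm (z (real k))"
    proof -
      have "0 \<le> t - real k" "t - real k \<le> 1" unfolding k_def using t by (simp add: of_nat_nat) linarith
      then show ?thesis using L(2)[OF ct_weights_shift[OF w, of k] zs[of k], of "t - real k"] by simp
    qed
    ultimately show ?thesis by (simp add: mult.assoc k_def)
  qed
  then show ?thesis using Cq L(1) by (intro exI[of _ "L * C"] exI[of _ q]) auto
qed

lemma ct_asymp_stable_iff:
  "ct_asymp_stable d M A \<longleftrightarrow>
    (\<forall>w z. ct_weights M w \<and> ct_solution d M A w z \<longrightarrow> ((\<lambda>t. eucl_norm (z t)) \<longlongrightarrow> 0) at_top)"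
proof
  assume conv: "\<forall>w z. ct_weights M w \<and> ct_solution d M A w z \<longrightarrow> ((\<lambda>t. eucl_norm (z t)) \<longlongrightarrow> 0) at_top"
  have "\<exists>C q. 0 \<le> C \<and> 0 < q \<and> q < 1 \<and> (\<forall>w z. ct_weights M w \<longrightarrow> ct_solution d M A w z \<longrightarrow>
       (\<forall>t\<ge>0. nrm (z t) \<le> C * q ^ nat \<lfloor>t\<rfloor> * nrm (z 0)))"
    by (rule ct_exponentially_stable) (simp_all add: conv)
  then obtain C q where Cq: "0 \<le> C" "0 < q" "q < 1"
    "\<And>w z t. ct_weights M w \<Longrightarrow> ct_solution d M A w z \<Longrightarrow> 0 \<le> t \<Longrightarrow> nrm (z t) \<le> C * q ^ nat \<lfloor>t\<rfloor> * nrm (z 0)"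
    by blast
  have bound: "nrm (z t) \<le> C * nrm (z 0)" if "ct_weights M w" "ct_solution d M A w z" "0 \<le> t" for w z t
  proof -
    have "C * (q ^ nat \<lfloor>t\<rfloor> * nrm (z 0)) \<le> C * (1 * nrm (z 0))"
      using Cq nrm_nonneg by (intro mult_left_mono mult_right_mono power_le_one) auto
    then show ?thesis using Cq(4)[OF that] by (simp add: mult.assoc)
  qed
  have "\<exists>\<delta>>0. \<forall>w z. ct_weights M w \<and> ct_solution d M A w z \<and> eucl_norm (z 0) < \<delta> \<longrightarrow>
        (\<forall>t\<ge>0. eucl_norm (z t) < \<epsilon>)" if "\<epsilon> > 0" for \<epsilon>
  proof -
    obtain \<delta> where \<delta>: "\<delta> > 0"
      "\<And>a b. a \<in> carrier_vec d \<and> nrm b \<le> C * nrm a \<and> eucl_norm a < \<delta> \<Longrightarrow> eucl_norm b < \<epsilon>"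
      using uniform_bound_imp_delta[OF Cq(1) \<open>\<epsilon> > 0\<close>, of d] by blast
    show ?thesis
    proof (intro exI[of _ \<delta>] conjI allI impI \<delta>(1))
      fix w z and t :: real
      assume wz: "ct_weights M w \<and> ct_solution d M A w z \<and> eucl_norm (z 0) < \<delta>" and t: "0 \<le> t"
      then have "z 0 \<in> carrier_vec d" by (simp add: ct_solution_def)
      then show "eucl_norm (z t) < \<epsilon>"
        using \<delta>(2)[of "z 0" "z t"] bound[of w z t] wz t by blast
    qed
  qed
  then show "ct_asymp_stable d M A" using conv by (simp add: ct_asymp_stable_def)
qed (simp add: ct_asymp_stable_def)

context block_form
begin

lemma ct_first_solution:
  assumes x: "ct_solution n M A w x"
  shows "ct_solution p M As w (\<lambda>t. vec_first (S *\<^sub>v x t) p)"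
  unfolding ct_solution_iff
proof
  fix T'
  have xc: "x t \<in> carrier_vec n" if "0 \<le> t" for t using x that by (simp add: ct_solution_def)
  have "ct_sol n M A w T' x" using x by (simp add: ct_solution_iff)
  then have "primitive n (\<lambda>s. S *\<^sub>v (comb_mat n M A (w s) *\<^sub>v x s)) T' (\<lambda>t. S *\<^sub>v x t)"
    by (rule primitive_mult_mat[OF _ S]) (intro carrier_vecI, simp add: comb_mat_def)
  then show "ct_sol p M As w T' (\<lambda>t. vec_first (S *\<^sub>v x t) p)"
  proof (rule primitive_transfer)
    fix s :: real and j assume "0 \<le> s" "j < p"
    then show "(comb_mat p M As (w s) *\<^sub>v vec_first (S *\<^sub>v x s) p) $ j =
        (S *\<^sub>v (comb_mat n M A (w s) *\<^sub>v x s)) $ j"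
      using conj_first[OF xc] by simp
  next
    fix t :: real and j assume "j < p"
    then show "vec_first (S *\<^sub>v x t) p $ j = (S *\<^sub>v x t) $ j"
      by (simp add: vec_first_def del: index_mult_mat_vec)
  qed (use dims in simp_all)
qed

text \<open>With \<open>\<delta> = 0\<close> the derivative of these components is the action of
  \<open>Ar\<close> on the transversal component alone.\<close>

lemma ct_last_increment:
  assumes w: "ct_weights M w" and x: "ct_solution n M A w x" and \<delta>: "\<delta> = 0" and j: "j < m"
    and b: "\<And>w v. w \<in> simplex_weights M \<Longrightarrow> v \<in> carrier_vec p \<Longrightarrow> nrm (comb_act m M Ar w v) \<le> b * nrm v"
    and b0: "0 \<le> b"
    and z: "\<And>s. a \<le> s \<Longrightarrow> s \<le> t \<Longrightarrow> nrm (vec_first (S *\<^sub>v x s) p) \<le> B"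
    and at: "0 \<le> a" "a \<le> t" "t \<le> a + 1"
  shows "\<bar>(S *\<^sub>v x t) $ (p + j) - (S *\<^sub>v x a) $ (p + j)\<bar> \<le> b * B"
proof -
  have xc: "x t \<in> carrier_vec n" if "0 \<le> t" for t using x that by (simp add: ct_solution_def)
  have "ct_sol n M A w t x" using x by (simp add: ct_solution_iff)
  then have y: "primitive n (\<lambda>s. S *\<^sub>v (comb_mat n M A (w s) *\<^sub>v x s)) t (\<lambda>t. S *\<^sub>v x t)"
    by (rule primitive_mult_mat[OF _ S]) (intro carrier_vecI, simp add: comb_mat_def)
  have jn: "p + j < n" using j dims by simp
  let ?f = "\<lambda>s. (S *\<^sub>v (comb_mat n M A (w s) *\<^sub>v x s)) $ (p + j)"
  have f: "norm (?f s) \<le> b * B" if s: "s \<in> {a..t}" for s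
  proof -
    have s0: "0 \<le> s" using s at by simp
    then have ws: "w s \<in> simplex_weights M" using w by (simp add: ct_weights_def)
    have "?f s = comb_act m M Ar (w s) (vec_first (S *\<^sub>v x s) p) $ j"
      using conj_last[OF xc[OF s0] j ws] \<delta> by simp
    also have "\<bar>\<dots>\<bar> \<le> nrm (comb_act m M Ar (w s) (vec_first (S *\<^sub>v x s) p))"
      using j by (intro abs_index_le_nrm) (simp add: comb_act_def)
    also have "\<dots> \<le> b * nrm (vec_first (S *\<^sub>v x s) p)" by (rule b[OF ws vec_first_carrier])
    also have "\<dots> \<le> b * B" using z s b0 by (intro mult_left_mono) auto
    finally show ?thesis by simp
  qed
  have "0 \<le> b * B" using f[of a] at by force
  have "\<bar>(S *\<^sub>v x t) $ (p + j) - (S *\<^sub>v x a) $ (p + j)\<bar> = norm (integral {a..t} ?f)"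
    using primitive_increment[OF y jn at(1,2) order_refl] by (simp del: index_mult_mat_vec)
  also have "\<dots> \<le> integral {a..t} (\<lambda>s. b * B)"
    by (rule Henstock_Kurzweil_Integration.integral_norm_bound_integral)
       (use primitive_integrable(2)[OF y jn at(1,2) order_refl] f in auto)
  also have "\<dots> = (t - a) * (b * B)" using at by simp
  also have "\<dots> \<le> 1 * (b * B)" using at \<open>0 \<le> b * B\<close> by (intro mult_right_mono) auto
  finally show ?thesis by simp
qed

text \<open>As in discrete time, the transversal component decays geometrically. The others
  therefore converge along the integers, and within \<open>{k..k + 1}\<close> they move by at most a
  multiple of \<open>q ^ k\<close>.\<close>

lemma ct_strongly_convergent_if_stable:
  assumes \<delta>: "\<delta> = 0" and stable: "ct_asymp_stable p M As"
  shows "ct_strongly_convergent n M A {x \<in> carrier_vec n. \<forall>i<M. A i *\<^sub>v x = \<delta> \<cdot>\<^sub>v x}"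
  unfolding ct_strongly_convergent_def
proof (intro allI impI, elim conjE)
  fix w x assume w: "ct_weights M w" and x: "ct_solution n M A w x"
  have xc: "x t \<in> carrier_vec n" if "0 \<le> t" for t using x that by (simp add: ct_solution_def)
  have evc: "eventually (\<lambda>t. x t \<in> carrier_vec n) at_top"
    using eventually_ge_at_top[of "0::real"] by eventually_elim (rule xc)
  define z where "z t = vec_first (S *\<^sub>v x t) p" for t
  have zsol: "ct_solution p M As w z" unfolding z_def by (rule ct_first_solution[OF x])
  have "\<exists>C q. 0 \<le> C \<and> 0 < q \<and> q < 1 \<and> (\<forall>w z. ct_weights M w \<longrightarrow> ct_solution p M As w z \<longrightarrow>
       (\<forall>t\<ge>0. nrm (z t) \<le> C * q ^ nat \<lfloor>t\<rfloor> * nrm (z 0)))"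
    by (rule ct_exponentially_stable) (use stable in \<open>simp_all add: ct_asymp_stable_def\<close>)
  then obtain C q where Cq: "0 \<le> C" "0 < q" "q < 1"
    "\<And>w z t. ct_weights M w \<Longrightarrow> ct_solution p M As w z \<Longrightarrow> 0 \<le> t \<Longrightarrow> nrm (z t) \<le> C * q ^ nat \<lfloor>t\<rfloor> * nrm (z 0)"
    by blast
  obtain b where b: "0 \<le> b"
    "\<And>w x. w \<in> simplex_weights M \<Longrightarrow> x \<in> carrier_vec p \<Longrightarrow> nrm (comb_act m M Ar w x) \<le> b * nrm x"
    by (rule comb_act_bound[where B = Ar, OF Ar]) (assumption | rule that)+
  define K where "K = C * nrm (z 0)"
  have zK: "nrm (z t) \<le> K * q ^ k" if "real k \<le> t" for t k
  proof -
    have "k \<le> nat \<lfloor>t\<rfloor>" using that by linarith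
    then have "K * q ^ nat \<lfloor>t\<rfloor> \<le> K * q ^ k"
      using Cq nrm_nonneg by (intro mult_left_mono power_decreasing) (auto simp: K_def)
    moreover have "0 \<le> t" using that by linarith
    ultimately show ?thesis using Cq(4)[OF w zsol, of t] by (simp add: K_def mult_ac)
  qed
  have inc: "\<bar>(S *\<^sub>v x t) $ (p + j) - (S *\<^sub>v x (real k)) $ (p + j)\<bar> \<le> b * (K * q ^ k)"
    if "j < m" "real k \<le> t" "t \<le> real k + 1" for j t k
    by (rule ct_last_increment[OF w x \<delta> that(1) b(2,1)]) (use zK that in \<open>auto simp: z_def\<close>)
  have "((\<lambda>t. eucl_norm (z t)) \<longlongrightarrow> 0) at_top" using stable w zsol by (simp add: ct_asymp_stable_def)
  then have zlim: "((\<lambda>t. nrm (z t)) \<longlongrightarrow> 0) at_top"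
    using eucl_norm_tendsto_iff[of z p at_top] by (simp add: z_def)
  have floor_lim: "filterlim (\<lambda>t::real. nat \<lfloor>t\<rfloor>) sequentially at_top"
    unfolding filterlim_at_top
  proof
    fix N :: nat
    show "eventually (\<lambda>t::real. N \<le> nat \<lfloor>t\<rfloor>) at_top"
      using eventually_ge_at_top[of "real N"] by eventually_elim linarith
  qed
  have "\<exists>xb\<in>carrier_vec n. (\<forall>i<M. A i *\<^sub>v xb = \<delta> \<cdot>\<^sub>v xb) \<and> ((\<lambda>t. eucl_norm (x t - xb)) \<longlongrightarrow> 0) at_top"
  proof (rule converges_to_fixed[OF evc])
    fix j assume j: "j < p"
    have "norm ((S *\<^sub>v x t) $ j) \<le> nrm (z t)" for t
      using abs_index_le_nrm[of j "z t"] j by (simp add: z_def vec_first_def)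
    then show "((\<lambda>t. (S *\<^sub>v x t) $ j) \<longlongrightarrow> 0) at_top"
      by (intro Lim_null_comparison[OF _ zlim] always_eventually allI)
  next
    fix j assume j: "j < m"
    have "\<bar>(S *\<^sub>v x (real (Suc k))) $ (p + j) - (S *\<^sub>v x (real k)) $ (p + j)\<bar> \<le> (b * K) * q ^ k" for k
      using inc[OF j, of k "real (Suc k)"] by (simp add: mult.assoc del: index_mult_mat_vec)
    then have "\<exists>l. (\<lambda>k. (S *\<^sub>v x (real k)) $ (p + j)) \<longlonglongrightarrow> l"
      using Cq(2,3) by (rule tendsto_of_geometric_increments)
    then obtain l where l: "(\<lambda>k. (S *\<^sub>v x (real k)) $ (p + j)) \<longlonglongrightarrow> l" by blast
    have l': "((\<lambda>t::real. (S *\<^sub>v x (real (nat \<lfloor>t\<rfloor>))) $ (p + j)) \<longlongrightarrow> l) at_top"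
      by (rule filterlim_compose[OF l floor_lim])
    have "(\<lambda>k. b * (K * q ^ k)) \<longlonglongrightarrow> b * (K * 0)"
      using Cq by (intro tendsto_intros LIMSEQ_power_zero) auto
    then have q': "((\<lambda>t. b * (K * q ^ nat \<lfloor>t\<rfloor>)) \<longlongrightarrow> 0) (at_top :: real filter)"
      using filterlim_compose[OF _ floor_lim] by fastforce
    have "((\<lambda>t. (S *\<^sub>v x t) $ (p + j) - (S *\<^sub>v x (real (nat \<lfloor>t\<rfloor>))) $ (p + j)) \<longlongrightarrow> 0) at_top"
    proof (rule Lim_null_comparison[OF _ q'])
      show "eventually (\<lambda>t. norm ((S *\<^sub>v x t) $ (p + j) - (S *\<^sub>v x (real (nat \<lfloor>t\<rfloor>))) $ (p + j)) \<le>
          b * (K * q ^ nat \<lfloor>t\<rfloor>)) at_top"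
        using eventually_ge_at_top[of "0::real"]
      proof eventually_elim
        case (elim t)
        then have "real (nat \<lfloor>t\<rfloor>) \<le> t" "t \<le> real (nat \<lfloor>t\<rfloor>) + 1" by linarith+
        from inc[OF j this] show ?case unfolding real_norm_def .
      qed
    qed
    from tendsto_add[OF this l'] show "\<exists>l. ((\<lambda>t. (S *\<^sub>v x t) $ (p + j)) \<longlongrightarrow> l) at_top"
      by (intro exI[of _ l]) (simp del: index_mult_mat_vec)
  qed
  then show "\<exists>xb\<in>{x \<in> carrier_vec n. \<forall>i<M. A i *\<^sub>v x = \<delta> \<cdot>\<^sub>v x}. ((\<lambda>t. eucl_norm (x t - xb)) \<longlongrightarrow> 0) at_top"
    by blast
qed

text \<open>A solution of the full inclusion whose transversal component starts at \<open>z
  0\<close> exists by the existence theorem, and by uniqueness its transversal component is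
  \<open>z\<close> at all times.\<close>

lemma ct_stable_if_strongly_convergent:
  assumes conv: "ct_strongly_convergent n M A X"
    and X: "\<And>x. x \<in> X \<Longrightarrow> x \<in> carrier_vec n \<and> (\<forall>j<p. (S *\<^sub>v x) $ j = 0)"
  shows "ct_asymp_stable p M As"
  unfolding ct_asymp_stable_iff
proof (intro allI impI, elim conjE)
  fix w z assume w: "ct_weights M w" and z: "ct_solution p M As w z"
  have z0: "z 0 \<in> carrier_vec p" using z by (simp add: ct_solution_def)
  have z0': "z 0 @\<^sub>v 0\<^sub>v m \<in> carrier_vec n" using z0 dims by simp
  obtain x where x: "x 0 = T *\<^sub>v (z 0 @\<^sub>v 0\<^sub>v m)" "ct_solution n M A w x"
    using ct_solution_exists[OF w mult_mat_vec_carrier[OF T z0']] by metis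
  have evc: "eventually (\<lambda>t. x t \<in> carrier_vec n) at_top"
    using eventually_ge_at_top[of "0::real"] by eventually_elim (use x(2) in \<open>simp add: ct_solution_def\<close>)
  have start: "z 0 = vec_first (S *\<^sub>v x 0) p"
    using STx[OF z0'] z0 by (auto simp: x(1) vec_first_def)
  have zx: "z t = vec_first (S *\<^sub>v x t) p" if "0 \<le> t" for t
    by (rule ct_solution_unique[OF w z ct_first_solution[OF x(2)] start that])
  obtain xb where xb: "xb \<in> X" "((\<lambda>t. eucl_norm (x t - xb)) \<longlongrightarrow> 0) at_top"
    using conv w x(2) by (auto simp: ct_strongly_convergent_def)
  have "((\<lambda>t. nrm (vec_first (S *\<^sub>v x t) p)) \<longlongrightarrow> 0) at_top"
    by (rule first_tendsto_zero[OF evc _ _ xb(2)]) (use X[OF xb(1)] in auto)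
  then have "((\<lambda>t. eucl_norm (vec_first (S *\<^sub>v x t) p)) \<longlongrightarrow> 0) at_top"
    using eucl_norm_tendsto_iff[of "\<lambda>t. vec_first (S *\<^sub>v x t) p" p at_top] by simp
  moreover have "eventually (\<lambda>t. eucl_norm (vec_first (S *\<^sub>v x t) p) = eucl_norm (z t)) at_top"
    using eventually_ge_at_top[of "0::real"] by eventually_elim (simp add: zx)
  ultimately show "((\<lambda>t. eucl_norm (z t)) \<longlongrightarrow> 0) at_top" by (rule Lim_transform_eventually)
qed

end

section \<open>The two equivalences\<close>

lemma common_kernel_eq:
  assumes A: "\<And>i. i < M \<Longrightarrow> A i \<in> carrier_mat n n"
  shows "common_kernel n M A = {x \<in> carrier_vec n. \<forall>i<M. A i *\<^sub>v x = 0 \<cdot>\<^sub>v x}"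
proof -
  have "x \<in> mat_kernel (A i) \<longleftrightarrow> A i *\<^sub>v x = 0 \<cdot>\<^sub>v x" if "x \<in> carrier_vec n" "i < M" for x i
  proof -
    have "0 \<cdot>\<^sub>v x = 0\<^sub>v n" using that(1) by (intro eq_vecI) auto
    then show ?thesis using that(1) A[OF that(2)] by (simp add: mat_kernel_def)
  qed
  then show ?thesis by (auto simp: common_kernel_def)
qed

lemma common_kernel_minus_one_eq:
  assumes A: "\<And>i. i < M \<Longrightarrow> A i \<in> carrier_mat n n"
  shows "common_kernel n M (\<lambda>i. A i - 1\<^sub>m n) = {x \<in> carrier_vec n. \<forall>i<M. A i *\<^sub>v x = 1 \<cdot>\<^sub>v x}"
proof -
  have "(A i - 1\<^sub>m n) *\<^sub>v x = 0 \<cdot>\<^sub>v x \<longleftrightarrow> A i *\<^sub>v x = 1 \<cdot>\<^sub>v x" if x: "x \<in> carrier_vec n" and i: "i < M" for x i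
  proof -
    have "(A i - 1\<^sub>m n) *\<^sub>v x = A i *\<^sub>v x - x"
      using minus_mult_distrib_mat_vec[OF A[OF i] one_carrier_mat x] x by simp
    moreover have "A i *\<^sub>v x \<in> carrier_vec n" using A[OF i] x by simp
    ultimately show ?thesis using x carrier_matD[OF A[OF i]]
      by (simp add: vec_eq_iff del: index_mult_mat_vec)
  qed
  moreover have "common_kernel n M (\<lambda>i. A i - 1\<^sub>m n) =
      {x \<in> carrier_vec n. \<forall>i<M. (A i - 1\<^sub>m n) *\<^sub>v x = 0 \<cdot>\<^sub>v x}"
    by (rule common_kernel_eq) (use A in auto)
  ultimately show ?thesis by auto
qed

text \<open>For \<open>M = 0\<close> there is no equation between matrices that could ensure
  \<open>m \<le> n\<close>, whence the assumption \<open>0 < M\<close>.\<close>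

lemma block_formI:
  assumes A: "\<And>i. i < M \<Longrightarrow> A i \<in> carrier_mat n n" and M: "0 < M"
    and T: "T \<in> carrier_mat n n" and S: "S \<in> carrier_mat n n"
    and TS: "inverts_mat T S" and ST: "inverts_mat S T"
    and blk: "\<And>i. i < M \<Longrightarrow> As i \<in> carrier_mat (n - m) (n - m) \<and> Ar i \<in> carrier_mat m (n - m) \<and>
        S * A i * T = four_block_mat (As i) (0\<^sub>m (n - m) m) (Ar i) (\<delta> \<cdot>\<^sub>m 1\<^sub>m m)"
  shows "block_form n (n - m) m M A As Ar T S \<delta>"
proof
  have "dim_row (S * A 0 * T) = n" using S by simp
  also have "S * A 0 * T = four_block_mat (As 0) (0\<^sub>m (n - m) m) (Ar 0) (\<delta> \<cdot>\<^sub>m 1\<^sub>m m)"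
    using blk[OF M] by simp
  finally show "n = (n - m) + m" using blk[OF M] by auto
qed (use assms in \<open>auto simp: inverts_mat_def\<close>)

lemma (in block_form) inverts: "inverts_mat T S" "inverts_mat S T"
  using T S TS ST by (simp_all add: inverts_mat_def)

lemma simplex_weights_pos: "w \<in> simplex_weights M \<Longrightarrow> 0 < M"
  by (cases M) (auto simp: simplex_weights_def)

theorem theorem1:
  fixes n M :: nat and A :: "nat \<Rightarrow> real mat"
  assumes "\<And>i. i < M \<Longrightarrow> A i \<in> carrier_mat n n"
  shows
    "(let X = common_kernel n M (\<lambda>i. A i - 1\<^sub>m n); m = subspace_dim n X in
        dt_strongly_convergent n M A X \<longleftrightarrow>
        (\<exists>T \<in> carrier_mat n n. \<exists>S \<in> carrier_mat n n. inverts_mat T S \<and> inverts_mat S T \<and>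
          (\<exists>As Ar.
            (\<forall>i<M. As i \<in> carrier_mat (n - m) (n - m) \<and> Ar i \<in> carrier_mat m (n - m) \<and>
               S * A i * T = four_block_mat (As i) (0\<^sub>m (n - m) m) (Ar i) (1\<^sub>m m)) \<and>
            dt_asymp_stable (n - m) M As)))
     \<and>
     (let X = common_kernel n M A; m = subspace_dim n X in
        ct_strongly_convergent n M A X \<longleftrightarrow>
        (\<exists>T \<in> carrier_mat n n. \<exists>S \<in> carrier_mat n n. inverts_mat T S \<and> inverts_mat S T \<and>
          (\<exists>As Ar.
            (\<forall>i<M. As i \<in> carrier_mat (n - m) (n - m) \<and> Ar i \<in> carrier_mat m (n - m) \<and>
               S * A i * T = four_block_mat (As i) (0\<^sub>m (n - m) m) (Ar i) (0\<^sub>m m m)) \<and>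
            ct_asymp_stable (n - m) M As)))"
  unfolding Let_def
proof (intro conjI iffI)
  have one: "(1::real) \<cdot>\<^sub>m 1\<^sub>m k = 1\<^sub>m k" and zero: "(0::real) \<cdot>\<^sub>m 1\<^sub>m k = 0\<^sub>m k k" for k
    by (auto intro!: eq_matI)
  define X where "X = common_kernel n M (\<lambda>i. A i - 1\<^sub>m n)"
  define m where "m = subspace_dim n X"
  have X: "X = {x \<in> carrier_vec n. \<forall>i<M. A i *\<^sub>v x = 1 \<cdot>\<^sub>v x}"
    unfolding X_def by (rule common_kernel_minus_one_eq[OF assms])
  define Y where "Y = common_kernel n M A"
  define l where "l = subspace_dim n Y"
  have Y: "Y = {x \<in> carrier_vec n. \<forall>i<M. A i *\<^sub>v x = 0 \<cdot>\<^sub>v x}"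
    unfolding Y_def by (rule common_kernel_eq[OF assms])
  let ?blocksX = "\<exists>T \<in> carrier_mat n n. \<exists>S \<in> carrier_mat n n. inverts_mat T S \<and> inverts_mat S T \<and>
          (\<exists>As Ar.
            (\<forall>i<M. As i \<in> carrier_mat (n - m) (n - m) \<and> Ar i \<in> carrier_mat m (n - m) \<and>
               S * A i * T = four_block_mat (As i) (0\<^sub>m (n - m) m) (Ar i) (1\<^sub>m m)) \<and>
            dt_asymp_stable (n - m) M As)"
  let ?blocksY = "\<exists>T \<in> carrier_mat n n. \<exists>S \<in> carrier_mat n n. inverts_mat T S \<and> inverts_mat S T \<and>
          (\<exists>As Ar.
            (\<forall>i<M. As i \<in> carrier_mat (n - l) (n - l) \<and> Ar i \<in> carrier_mat l (n - l) \<and>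
               S * A i * T = four_block_mat (As i) (0\<^sub>m (n - l) l) (Ar i) (0\<^sub>m l l)) \<and>
            ct_asymp_stable (n - l) M As)"
  show ?blocksX if conv: "dt_strongly_convergent n M A X"
  proof -
    obtain As Ar T S where blk: "block_form n (n - m) m M A As Ar T S 1"
      and iff: "\<And>x. x \<in> carrier_vec n \<Longrightarrow> x \<in> X \<longleftrightarrow> (\<forall>j < n - m. (S *\<^sub>v x) $ j = 0)"
      by (rule block_form_exists[where A = A and M = M and n = n and \<delta> = 1, folded X, folded m_def])
         (assumption | rule assms that)+
    interpret block_form n "n - m" m M A As Ar T S 1 by (rule blk)
    have "dt_asymp_stable (n - m) M As"
      by (rule dt_stable_if_strongly_convergent[OF conv]) (use iff X in blast)
    moreover have "\<forall>i<M. As i \<in> carrier_mat (n - m) (n - m) \<and> Ar i \<in> carrier_mat m (n - m) \<and>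
        S * A i * T = four_block_mat (As i) (0\<^sub>m (n - m) m) (Ar i) (1\<^sub>m m)"
      using As Ar blocks by (simp add: one)
    ultimately show ?thesis using T S inverts by blast
  qed
  show "dt_strongly_convergent n M A X" if blocks: ?blocksX
  proof (cases "0 < M")
    case True
    obtain T S As Ar where TS: "T \<in> carrier_mat n n" "S \<in> carrier_mat n n" "inverts_mat T S" "inverts_mat S T"
      and blk: "\<forall>i<M. As i \<in> carrier_mat (n - m) (n - m) \<and> Ar i \<in> carrier_mat m (n - m) \<and>
        S * A i * T = four_block_mat (As i) (0\<^sub>m (n - m) m) (Ar i) (1\<^sub>m m)"
      and stable: "dt_asymp_stable (n - m) M As"
      using blocks by blast
    interpret block_form n "n - m" m M A As Ar T S 1
      by (rule block_formI[OF assms True TS]) (use blk in \<open>simp_all add: one\<close>)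
    show ?thesis unfolding X by (rule dt_strongly_convergent_if_stable[OF refl stable])
  next
    case False
    then show ?thesis
      using simplex_weights_pos by (auto simp: dt_strongly_convergent_def dt_weights_def)
  qed
  show ?blocksY if conv: "ct_strongly_convergent n M A Y"
  proof -
    obtain As Ar T S where blk: "block_form n (n - l) l M A As Ar T S 0"
      and iff: "\<And>x. x \<in> carrier_vec n \<Longrightarrow> x \<in> Y \<longleftrightarrow> (\<forall>j < n - l. (S *\<^sub>v x) $ j = 0)"
      by (rule block_form_exists[where A = A and M = M and n = n and \<delta> = 0, folded Y, folded l_def])
         (assumption | rule assms that)+
    interpret block_form n "n - l" l M A As Ar T S 0 by (rule blk)
    have "ct_asymp_stable (n - l) M As"
      by (rule ct_stable_if_strongly_convergent[OF conv]) (use iff Y in blast)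
    moreover have "\<forall>i<M. As i \<in> carrier_mat (n - l) (n - l) \<and> Ar i \<in> carrier_mat l (n - l) \<and>
        S * A i * T = four_block_mat (As i) (0\<^sub>m (n - l) l) (Ar i) (0\<^sub>m l l)"
      using As Ar blocks by (simp add: zero)
    ultimately show ?thesis using T S inverts by blast
  qed
  show "ct_strongly_convergent n M A Y" if blocks: ?blocksY
  proof (cases "0 < M")
    case True
    obtain T S As Ar where TS: "T \<in> carrier_mat n n" "S \<in> carrier_mat n n" "inverts_mat T S" "inverts_mat S T"
      and blk: "\<forall>i<M. As i \<in> carrier_mat (n - l) (n - l) \<and> Ar i \<in> carrier_mat l (n - l) \<and>
        S * A i * T = four_block_mat (As i) (0\<^sub>m (n - l) l) (Ar i) (0\<^sub>m l l)"
      and stable: "ct_asymp_stable (n - l) M As"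
      using blocks by blast
    interpret block_form n "n - l" l M A As Ar T S 0
      by (rule block_formI[OF assms True TS]) (use blk in \<open>simp_all add: zero\<close>)
    show ?thesis unfolding Y by (rule ct_strongly_convergent_if_stable[OF refl stable])
  next
    case False
    then have "\<not> ct_weights M w" for w
      using simplex_weights_pos[of "w 0" M] by (auto simp: ct_weights_def)
    then show ?thesis by (simp add: ct_strongly_convergent_def)
  qed
qed

end
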